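(* Let $\mathbb{K}$ be a field and let $K_n$ ($n\ge 2$) be a weighted oriented complete graph. Then for any $k\ge 1$, $$\operatorname{reg}(I(K_n)^{k})=\max\Big\{\max_{(x_i,x_j)\in E(K_n)}\{r_{ij}(k)\}+2,\ \max_{x_i\in V(K_n)}\{r_i(k)\}+1,\ \max_{(\alpha_1,\dots,\alpha_n)\in\mathcal{M}_{\mathfrak m}}\Big\{\sum_{i=1}^n(\alpha_i-1)\Big\}+1\Big\},$$ where $$r_{ij}(k)=\max\{w(x_j)+1,\ w(x) \mid x\in N^+_{K_n}(x_i)\cap N^+_{K_n}(x_j)\}(k-1)+\sum_{x\in N^+_{K_n}(x_i)\cap N^+_{K_n}[x_j]}(w(x)-1),$$ $$r_i(k)=\max\{w(x)\mid x\in N^+_{K_n}(x_i)\}(k-1)+\sum_{x\in N^+_{K_n}(x_i)}(w(x)-1),$$ and $\mathcal{M}_{\mathfrak m}$ is the set of all $(\alpha_1,\dots,\alpha_n)$ with all $\alpha_i\ge 1$ such that $(x_1^{\alpha_1},\dots,x_n^{\alpha_n})$ is a component of the irredundant irreducible decomposition of the monomial ideal $I(K_n)^k$ (the third term is omitted if $\mathcal{M}_{\mathfrak m}=\emptyset$). Moreover, $$\operatorname{reg}(I(K_n)^{(k)})\le\operatorname{reg}(I(K_n)^k)\quad\text{for all } k\ge 1.$$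
   Context: A weighted oriented graph is a triple $D=(V(D),E(D),w)$ with finite vertex set $V(D)=\{x_1,\dots,x_n\}$, a set $E(D)$ of directed edges (where $(u,v)$ is an edge from $u$ to $v$), without loops or parallel edges (at most one of $(u,v),(v,u)$ is in $E(D)$), and a weight function $w$ from $V(D)$ to the positive integers. A vertex is a source if no edge ends at it; by convention $w(v)=1$ whenever $v$ is a source. A weighted oriented complete graph $K_n$ is a weighted oriented graph on $\{x_1,\dots,x_n\}$ in which for each pair $i\ne j$ exactly one of $(x_i,x_j),(x_j,x_i)$ is an edge. $N^+_{K_n}(x)=\{y:(x,y)\in E(K_n)\}$ and $N^+_{K_n}[x]=N^+_{K_n}(x)\cup\{x\}$. Convention: $\max\{w(x)\mid x\in A\}=1$ if $A=\emptyset$ (used in $r_i(k)$); in $r_{ij}(k)$ the maximum is over $w(x_j)+1$ together with all $w(x)$, $x\in N^+_{K_n}(x_i)\cap N^+_{K_n}(x_j)$. The edge ideal is $I(K_n)=(x_ix_j^{w(x_j)}:(x_i,x_j)\in E(K_n))\subset R=\mathbb{K}[x_1,\dots,x_n]$, and $\mathfrak m=(x_1,\dots,x_n)$. Every monomial ideal is uniquely an irredundant intersection of irreducible monomial ideals (ideals generated by pure powers of some of the variables); these are its components. The $k$-th symbolic power of an ideal $I$ is $I^{(k)}=\bigcap_{P\in \operatorname{Ass}(R/I)}(I^kR_P\cap R)$. $\operatorname{reg}(I)=\max\{j-i : \beta_{i,j}(I)\ne 0\}$ is the Castelnuovo–Mumford regularity. *)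

theory Defs
  imports "HOL-Library.Poly_Mapping" "HOL-Library.Cardinality" "Jordan_Normal_Form.Matrix_Kernel"
begin

section \<open>Polynomial rings and their ideals\<close>

text \<open>
  The polynomial ring over \<open>'k\<close> with one variable for every element of the finite type \<open>'n\<close>.
  A monomial is given by its exponent vector.
\<close>

type_synonym ('n, 'k) mpoly = "('n \<Rightarrow>\<^sub>0 nat) \<Rightarrow>\<^sub>0 'k"

definition mvar :: "'n \<Rightarrow> ('n, 'k::field) mpoly" where
  "mvar i = Poly_Mapping.single (Poly_Mapping.single i 1) 1"

text \<open>
  Ideals of a commutative ring are its submodules when it is regarded as a module over itself
  (\<^theory>\<open>HOL.Modules\<close>; the name \<open>module\<close> alone would be taken from HOL-Algebra).
\<close>

abbreviation is_ideal :: "'a::comm_ring_1 set \<Rightarrow> bool" where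
  "is_ideal \<equiv> Modules.module.subspace (*)"

abbreviation ideal_of :: "'a::comm_ring_1 set \<Rightarrow> 'a set" where
  "ideal_of \<equiv> Modules.module.span (*)"

definition ideal_mult :: "'a::comm_ring_1 set \<Rightarrow> 'a set \<Rightarrow> 'a set" where
  "ideal_mult I J = ideal_of {a * b | a b. a \<in> I \<and> b \<in> J}"

primrec ideal_power :: "'a::comm_ring_1 set \<Rightarrow> nat \<Rightarrow> 'a set" where
  "ideal_power I 0 = UNIV"
| "ideal_power I (Suc k) = ideal_mult I (ideal_power I k)"

definition is_prime_ideal :: "'a::comm_ring_1 set \<Rightarrow> bool" where
  "is_prime_ideal P \<longleftrightarrow>
     is_ideal P \<and> P \<noteq> UNIV \<and> (\<forall>a b. a * b \<in> P \<longrightarrow> a \<in> P \<or> b \<in> P)"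

text \<open>
  \<open>Ass(R/I)\<close>: the prime ideals that are the annihilator of the class of some \<open>f\<close> in \<open>R/I\<close>.
\<close>

definition assoc_primes :: "'a::comm_ring_1 set \<Rightarrow> 'a set set" where
  "assoc_primes I = {P. is_prime_ideal P \<and> (\<exists>f. P = {g. g * f \<in> I})}"

text \<open>
  \<open>J R\<^sub>P \<inter> R\<close>. The elements of \<open>J R\<^sub>P\<close> are the fractions \<open>a/s\<close> with \<open>a \<in> J\<close> and \<open>s \<notin> P\<close>, and
  \<open>f/1 = a/s\<close> holds in \<open>R\<^sub>P\<close> iff some \<open>t \<notin> P\<close> annihilates \<open>s f - a\<close>.
\<close>

definition local_contraction :: "'a::comm_ring_1 set \<Rightarrow> 'a set \<Rightarrow> 'a set" where
  "local_contraction J P =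
     {f. \<exists>a\<in>J. \<exists>s. s \<notin> P \<and> (\<exists>t. t \<notin> P \<and> t * (s * f - a) = 0)}"

definition symbolic_power :: "'a::comm_ring_1 set \<Rightarrow> nat \<Rightarrow> 'a set" where
  "symbolic_power I k = (\<Inter>P\<in>assoc_primes I. local_contraction (ideal_power I k) P)"


section \<open>Irreducible decompositions of monomial ideals\<close>

text \<open>The choice \<open>S = {}\<close> yields the zero ideal.\<close>

definition irreducible_monomial_ideal :: "('n::finite, 'k::field) mpoly set \<Rightarrow> bool" where
  "irreducible_monomial_ideal Q \<longleftrightarrow>
     (\<exists>S a. (\<forall>i\<in>S. 1 \<le> a i) \<and> Q = ideal_of ((\<lambda>i. mvar i ^ a i) ` S))"

definition irredundant_irreducible_decomposition ::
    "('n::finite, 'k::field) mpoly set \<Rightarrow> ('n, 'k) mpoly set set \<Rightarrow> bool" where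
  "irredundant_irreducible_decomposition J C \<longleftrightarrow>
     finite C \<and> (\<forall>Q\<in>C. irreducible_monomial_ideal Q) \<and>
     \<Inter>C = J \<and> (\<forall>Q\<in>C. \<Inter>(C - {Q}) \<noteq> J)"

definition irreducible_components ::
    "('n::finite, 'k::field) mpoly set \<Rightarrow> ('n, 'k) mpoly set set" where
  "irreducible_components J = {Q. \<exists>C. irredundant_irreducible_decomposition J C \<and> Q \<in> C}"

text \<open>\<open>\<M>\<^sub>\<mm>\<close>, depending on the monomial ideal that is decomposed.\<close>

definition full_components :: "('n::finite, 'k::field) mpoly set \<Rightarrow> ('n \<Rightarrow> nat) set" where
  "full_components J =
     {\<alpha>. (\<forall>i. 1 \<le> \<alpha> i) \<and> ideal_of (range (\<lambda>i. mvar i ^ \<alpha> i)) \<in> irreducible_components J}"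


section \<open>Graded Betti numbers and regularity\<close>

definition mdegree :: "('n::finite \<Rightarrow>\<^sub>0 nat) \<Rightarrow> nat" where
  "mdegree t = (\<Sum>i\<in>UNIV. Poly_Mapping.lookup t i)"

definition homogeneous :: "int \<Rightarrow> ('n::finite, 'k::field) mpoly \<Rightarrow> bool" where
  "homogeneous d f \<longleftrightarrow> (\<forall>t\<in>Poly_Mapping.keys f. int (mdegree t) = d)"

text \<open>
  A list \<open>ds\<close> of integers stands for the graded free module \<open>\<Oplus>\<^sub>q R(-ds!q)\<close>, whose \<open>q\<close>-th basis
  element has degree \<open>ds!q\<close>. A degree-preserving homomorphism from \<open>cs\<close> to \<open>rs\<close> is a matrix whose
  \<open>(p,q)\<close> entry is homogeneous of degree \<open>cs!q - rs!p\<close>.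
\<close>

definition graded_map :: "int list \<Rightarrow> int list \<Rightarrow> ('n::finite, 'k::field) mpoly mat \<Rightarrow> bool" where
  "graded_map cs rs A \<longleftrightarrow>
     A \<in> carrier_mat (length rs) (length cs) \<and>
     (\<forall>p<length rs. \<forall>q<length cs. homogeneous (cs ! q - rs ! p) (A $$ (p, q)))"

definition mat_image :: "'a::comm_ring_1 mat \<Rightarrow> 'a vec set" where
  "mat_image A = (\<lambda>v. A *\<^sub>v v) ` carrier_vec (dim_col A)"

text \<open>
  \<open>\<dots> \<rightarrow> F\<^sub>2 \<rightarrow> F\<^sub>1 \<rightarrow> F\<^sub>0 \<rightarrow> I \<rightarrow> 0\<close> with \<open>F\<^sub>i\<close> given by the list \<open>F i\<close>. The matrix
  \<open>\<phi> 0\<close> is the augmentation \<open>F\<^sub>0 \<rightarrow> I \<subseteq> R\<close> (a single row), and \<open>\<phi> (Suc i)\<close> is the differential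
  \<open>F\<^sub>i\<^sub>+\<^sub>1 \<rightarrow> F\<^sub>i\<close>.
\<close>

definition graded_free_resolution ::
    "('n::finite, 'k::field) mpoly set \<Rightarrow> (nat \<Rightarrow> int list) \<Rightarrow> (nat \<Rightarrow> ('n, 'k) mpoly mat) \<Rightarrow> bool"
  where
  "graded_free_resolution I F \<phi> \<longleftrightarrow>
     graded_map (F 0) [0] (\<phi> 0) \<and>
     (\<forall>i. graded_map (F (Suc i)) (F i) (\<phi> (Suc i))) \<and>
     mat_image (\<phi> 0) = {vec 1 (\<lambda>_. f) | f. f \<in> I} \<and>
     (\<forall>i. mat_kernel (\<phi> i) = mat_image (\<phi> (Suc i)))"

definition minimal_graded_free_resolution ::
    "('n::finite, 'k::field) mpoly set \<Rightarrow> (nat \<Rightarrow> int list) \<Rightarrow> (nat \<Rightarrow> ('n, 'k) mpoly mat) \<Rightarrow> bool"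
  where
  "minimal_graded_free_resolution I F \<phi> \<longleftrightarrow>
     graded_free_resolution I F \<phi> \<and>
     (\<forall>i. elements_mat (\<phi> (Suc i)) \<subseteq> ideal_of (range mvar))"

text \<open>
  \<open>\<beta>\<^bsub>i,j\<^esub>(I)\<close> is the multiplicity of \<open>R(-j)\<close> in the \<open>i\<close>-th module of the minimal graded free
  resolution of \<open>I\<close>. That resolution exists for homogeneous \<open>I\<close> and is unique up to isomorphism;
  for other \<open>I\<close> the value is unspecified.
\<close>

definition betti :: "('n::finite, 'k::field) mpoly set \<Rightarrow> nat \<Rightarrow> int \<Rightarrow> nat" where
  "betti I i j =
     (THE b. \<exists>F \<phi>. minimal_graded_free_resolution I F \<phi> \<and> b = count_list (F i) j)"

definition reg :: "('n::finite, 'k::field) mpoly set \<Rightarrow> int" where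
  "reg I = Max {j - int i | i j. betti I i j \<noteq> 0}"


section \<open>Weighted oriented graphs\<close>

text \<open>The vertex set is the whole (finite) type \<open>'n\<close>, so vertices also index the variables.\<close>

definition weighted_oriented_graph :: "('n::finite \<times> 'n) set \<Rightarrow> ('n \<Rightarrow> nat) \<Rightarrow> bool" where
  "weighted_oriented_graph E w \<longleftrightarrow>
     irrefl E \<and> asym E \<and> (\<forall>v. 1 \<le> w v) \<and> (\<forall>v. (\<nexists>u. (u, v) \<in> E) \<longrightarrow> w v = 1)"

definition weighted_oriented_complete_graph ::
    "('n::finite \<times> 'n) set \<Rightarrow> ('n \<Rightarrow> nat) \<Rightarrow> bool" where
  "weighted_oriented_complete_graph E w \<longleftrightarrow> weighted_oriented_graph E w \<and> total E"

definition out_nbhd :: "('n \<times> 'n) set \<Rightarrow> 'n \<Rightarrow> 'n set" where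
  "out_nbhd E x = {y. (x, y) \<in> E}"

definition closed_out_nbhd :: "('n \<times> 'n) set \<Rightarrow> 'n \<Rightarrow> 'n set" where
  "closed_out_nbhd E x = insert x (out_nbhd E x)"

definition edge_ideal ::
    "('n::finite \<times> 'n) set \<Rightarrow> ('n \<Rightarrow> nat) \<Rightarrow> ('n, 'k::field) mpoly set" where
  "edge_ideal E w = ideal_of {mvar i * mvar j ^ w j | i j. (i, j) \<in> E}"

definition max_weight :: "('n::finite \<Rightarrow> nat) \<Rightarrow> 'n set \<Rightarrow> nat" where
  "max_weight w A = (if A = {} then 1 else Max (w ` A))"

text \<open>Subtraction on \<^typ>\<open>nat\<close> is exact here, as \<open>1 \<le> k\<close> and all weights are positive.\<close>

definition r_edge ::
    "('n::finite \<times> 'n) set \<Rightarrow> ('n \<Rightarrow> nat) \<Rightarrow> nat \<Rightarrow> 'n \<Rightarrow> 'n \<Rightarrow> nat" where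
  "r_edge E w k i j =
     Max (insert (w j + 1) (w ` (out_nbhd E i \<inter> out_nbhd E j))) * (k - 1) +
     (\<Sum>x\<in>out_nbhd E i \<inter> closed_out_nbhd E j. (w x - 1))"

definition r_vertex :: "('n::finite \<times> 'n) set \<Rightarrow> ('n \<Rightarrow> nat) \<Rightarrow> nat \<Rightarrow> 'n \<Rightarrow> nat" where
  "r_vertex E w k i =
     max_weight w (out_nbhd E i) * (k - 1) + (\<Sum>x\<in>out_nbhd E i. (w x - 1))"

end

theory Submission
  imports Defs "HOL-Library.Function_Algebras"
begin

text \<open>
  For each vertex \<open>i\<close>, localizing \<open>I\<^sup>k\<close> at the prime of the variables other than \<open>x\<^sub>i\<close> gives the
  \<open>k\<close>-th power of a complete intersection of pure powers of variables. Up to a part of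
  finite length, which is governed by its socle, the ideal \<open>I\<^sup>k\<close> is the intersection of these components, and so is the symbolic power
  unless it equals \<open>I\<^sup>k\<close>. In a fixed multidegree the Koszul complex is a complex of sets of
  variables. In degrees above the claimed bound a monomial outside \<open>I\<^sup>k\<close> lies outside exactly one
  component and is divisible by the corresponding variable, which contracts the complex.
  Conversely, a monomial of maximal degree in the socle, outside one component, or outside two
  components yields an explicit Koszul cycle that is no boundary.

  Koszul homology is related to the minimal resolution by dimension shifting along the syzygies.
  Vanishing in large degrees makes every graded syzygy module finitely generated, so that minimal
  resolutions exist without Hilbert's basis theorem. They are unique because a graded endomorphism
  of a free module that is the identity modulo the variables is invertible.
\<close>

text \<open>In a complete graph every associated prime contains one of any two variables, so the
  quotients by powers of \<open>I\<close> have dimension one and local cohomology only in degrees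
  zero and one. It is never formed, but it explains the constants, the regularity of an ideal being
  one more than that of its quotient. A socle monomial of degree d contributes d + 1. A monomial of
  degree d outside two components gives a class of the first local cohomology in its own degree,
  hence d + 2. A monomial of degree d free of x_i and outside component i gives one after division
  by x_i, that is in degree d - 1, hence d + 1. The obstacle is that \<open>betti\<close> is a
  definite description over all minimal resolutions: nothing can be said about \<open>reg\<close>
  before one exists and its multiplicities are unique. Existence comes out of the vanishing above
  the bound, which is thus needed in every homological degree and is pushed along the syzygies with
  a bound that grows by one at each step.\<close>

abbreviation lookup :: "('a \<Rightarrow>\<^sub>0 'b::zero) \<Rightarrow> 'a \<Rightarrow> 'b" where
  "lookup \<equiv> Poly_Mapping.lookup"

abbreviation single :: "'a \<Rightarrow> 'b \<Rightarrow> 'a \<Rightarrow>\<^sub>0 'b::zero" where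
  "single \<equiv> Poly_Mapping.single"

abbreviation keys :: "('a \<Rightarrow>\<^sub>0 'b::zero) \<Rightarrow> 'a set" where
  "keys \<equiv> Poly_Mapping.keys"

abbreviation expo :: "'n \<Rightarrow> 'n \<Rightarrow>\<^sub>0 nat" where
  "expo i \<equiv> single i (Suc 0)"

interpretation poly_ideal: Modules.module "(*) :: 'a::comm_ring_1 \<Rightarrow> 'a \<Rightarrow> 'a"
  by standard (simp_all add: algebra_simps)

declare poly_ideal.scale_scale [simp del] \<comment> \<open>it loops with \<open>mult.assoc\<close>\<close>

section \<open>Monomials\<close>

lemma exponent_diff_add:
  fixes s t :: "'n \<Rightarrow>\<^sub>0 nat"
  assumes "\<And>i. lookup s i \<le> lookup t i"
  shows "s + (t - s) = t"
  by (rule poly_mapping_eqI) (simp add: lookup_add lookup_minus assms)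

lemma expo_diff_add:
  fixes t :: "'n \<Rightarrow>\<^sub>0 nat"
  assumes "0 < lookup t i"
  shows "expo i + (t - expo i) = t"
  by (rule exponent_diff_add) (use assms in \<open>auto simp: lookup_single when_def\<close>)

lemma mdegree_add: "mdegree (s + t) = mdegree s + mdegree t"
  by (simp add: mdegree_def lookup_add sum.distrib)

lemma mdegree_0 [simp]: "mdegree 0 = 0"
  by (simp add: mdegree_def)

lemma mdegree_single [simp]: "mdegree (single i m) = m"
  by (simp add: mdegree_def lookup_single when_def)

lemma mdegree_eq_0_iff [simp]: "mdegree t = 0 \<longleftrightarrow> t = 0"
  by (auto simp: mdegree_def intro!: poly_mapping_eqI)

lemma lookup_le_mdegree: "lookup t i \<le> mdegree t"
  unfolding mdegree_def by (rule member_le_sum) auto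

lemma finite_mdegree_le: "finite {t :: 'n::finite \<Rightarrow>\<^sub>0 nat. mdegree t \<le> d}"
proof -
  have "finite (PiE (UNIV :: 'n set) (\<lambda>_. {..d}))"
    by (rule finite_PiE) auto
  moreover have "lookup ` {t :: 'n \<Rightarrow>\<^sub>0 nat. mdegree t \<le> d} \<subseteq> PiE UNIV (\<lambda>_. {..d})"
    using order.trans[OF lookup_le_mdegree] by (auto simp: PiE_def)
  ultimately have "finite (lookup ` {t :: 'n \<Rightarrow>\<^sub>0 nat. mdegree t \<le> d})"
    by (rule finite_subset[rotated])
  then show ?thesis
    by (rule finite_imageD) (rule inj_onI, rule poly_mapping_eqI, simp)
qed

lemma lookup_monom_mult_add:
  fixes f :: "('n, 'k::field) mpoly"
  shows "lookup (single s c * f) (s + t) = c * lookup f t"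
proof -
  have "lookup (single s c * f) (s + t)
      = (\<Sum>l. (c * lookup f t when s = l))"
    unfolding lookup_mult lookup_single
  proof (rule Sum_any.cong)
    fix l
    show "(c when s = l) * (\<Sum>q. lookup f q when s + t = l + q)
      = (c * lookup f t when s = l)"
      by (cases "s = l") simp_all
  qed
  then show ?thesis by simp
qed

lemma lookup_monom_mult_eq_0:
  fixes f :: "('n, 'k::field) mpoly"
  assumes "\<And>t. u \<noteq> s + t"
  shows "lookup (single s c * f) u = 0"
proof -
  have "u \<notin> keys (single s c * f)"
    using keys_mult[of "single s c" f] assms by (auto split: if_splits)
  then show ?thesis by (simp add: in_keys_iff)
qed

lemma lookup_mvar_mult:
  fixes f :: "('n, 'k::field) mpoly"
  shows "lookup (mvar i * f) t =
    (if 0 < lookup t i then lookup f (t - expo i) else 0)"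
proof (cases "0 < lookup t i")
  case True
  with lookup_monom_mult_add[of "expo i" 1 f "t - expo i"] show ?thesis
    by (simp add: mvar_def expo_diff_add)
next
  case False
  then have "t \<noteq> expo i + u" for u
    by (auto simp: lookup_add)
  with False show ?thesis
    by (simp add: mvar_def lookup_monom_mult_eq_0)
qed

lemma mvar_power: "mvar i ^ m = single (single i m) (1 :: 'k::field)"
proof (induction m)
  case (Suc m)
  then show ?case
    by (simp add: mvar_def mult_single single_add[symmetric])
qed simp

text \<open>Serves to cut a polynomial down to the exponents in a set and to glue coefficients
  chosen separately for each multidegree.\<close>

definition poly_of :: "('n \<Rightarrow>\<^sub>0 nat) set \<Rightarrow> (('n \<Rightarrow>\<^sub>0 nat) \<Rightarrow> 'k) \<Rightarrow> ('n::finite, 'k::field) mpoly" where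
  "poly_of T g = (\<Sum>t\<in>T. single t (g t))"

lemma lookup_poly_of:
  "finite T \<Longrightarrow> lookup (poly_of T g) t = (if t \<in> T then g t else 0)"
  by (auto simp: poly_of_def lookup_sum lookup_single when_def)

lemma poly_of_keys: "poly_of (keys f) (lookup f) = f"
  by (rule poly_mapping_eqI) (auto simp: lookup_poly_of in_keys_iff)

lemma poly_of_restrict_lookup:
  "lookup (poly_of (keys f \<inter> T) (lookup f)) t
     = (if t \<in> T then lookup f t else 0)"
  by (auto simp: lookup_poly_of in_keys_iff)

lemma lookup_mult_zero:
  fixes f g :: "('n, 'k::field) mpoly"
  shows "lookup (f * g) 0 = lookup f 0 * lookup g 0"
proof -
  have z: "(0 :: 'n \<Rightarrow>\<^sub>0 nat) = l + q \<longleftrightarrow> l = 0 \<and> q = 0" for l q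
    by (auto simp: poly_mapping_eq_iff fun_eq_iff lookup_add)
  have "lookup (f * g) 0 =
    (\<Sum>l :: 'n \<Rightarrow>\<^sub>0 nat. (lookup f 0 * lookup g 0 when l = 0))"
    unfolding lookup_mult z
  proof (rule Sum_any.cong)
    fix l :: "'n \<Rightarrow>\<^sub>0 nat"
    show "lookup f l * (\<Sum>q. lookup g q when l = 0 \<and> q = 0)
      = (lookup f 0 * lookup g 0 when l = 0)"
      by (cases "l = 0") simp_all
  qed
  then show ?thesis by simp
qed

section \<open>Monomial ideals\<close>

text \<open>Membership in a monomial ideal is a condition on each exponent separately, so these
  ideals are handled as sets of exponents. The result is an ideal only if \<open>L\<close> is an
  \<open>upset\<close>.\<close>

definition monideal :: "('n \<Rightarrow>\<^sub>0 nat) set \<Rightarrow> ('n, 'k::field) mpoly set" where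
  "monideal L = {f. keys f \<subseteq> L}"

definition upset :: "('n \<Rightarrow>\<^sub>0 nat) set \<Rightarrow> bool" where
  "upset L \<longleftrightarrow> (\<forall>s\<in>L. \<forall>t. s + t \<in> L)"

lemma upsetD: "upset L \<Longrightarrow> s \<in> L \<Longrightarrow> s + t \<in> L" "upset L \<Longrightarrow> s \<in> L \<Longrightarrow> t + s \<in> L"
  by (auto simp: upset_def add.commute)

lemma upset_mono:
  assumes "upset L" "s \<in> L" "\<And>i. lookup s i \<le> lookup t i"
  shows "t \<in> L"
  using upsetD(1)[OF assms(1,2), of "t - s"] by (simp add: exponent_diff_add assms(3))

lemma upset_generated: "upset {s + t | s t. s \<in> G}"
  unfolding upset_def
proof (intro ballI allI)
  fix u v assume "u \<in> {s + t | s t. s \<in> G}"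
  then obtain s t where "u = s + t" "s \<in> G" by blast
  then have "u + v = s + (t + v)" by (simp add: add.assoc)
  with \<open>s \<in> G\<close> show "u + v \<in> {s + t | s t. s \<in> G}" by blast
qed

lemma mem_monideal_iff: "f \<in> monideal L \<longleftrightarrow> (\<forall>t. t \<notin> L \<longrightarrow> lookup f t = 0)"
  by (auto simp: monideal_def in_keys_iff)

lemma single_mem_monideal: "single t c \<in> monideal L \<longleftrightarrow> c = 0 \<or> t \<in> L"
  by (auto simp: monideal_def)

lemma zero_mem_monideal [simp]: "0 \<in> monideal L"
  by (simp add: monideal_def)

lemma is_ideal_monideal:
  assumes "upset L"
  shows "is_ideal (monideal L :: ('n, 'k::field) mpoly set)"
proof (rule poly_ideal.subspaceI)
  fix c x :: "('n, 'k) mpoly"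
  assume "x \<in> monideal L"
  then show "c * x \<in> monideal L"
    using keys_mult[of c x] upsetD(2)[OF assms] unfolding monideal_def by blast
qed (auto simp: mem_monideal_iff lookup_add)

lemma monideal_subset_ideal:
  fixes J :: "('n::finite, 'k::field) mpoly set"
  assumes J: "is_ideal J" and s: "\<And>t. t \<in> L \<Longrightarrow> single t 1 \<in> J"
  shows "monideal L \<subseteq> J"
proof
  fix f :: "('n, 'k) mpoly"
  assume f: "f \<in> monideal L"
  have "poly_of (keys f) (lookup f) \<in> J"
    unfolding poly_of_def
  proof (rule poly_ideal.subspace_sum[OF J])
    fix t assume "t \<in> keys f"
    then have "single 0 (lookup f t) * single t 1 \<in> J"
      using f by (intro poly_ideal.subspace_scale[OF J] s) (auto simp: monideal_def)
    then show "single t (lookup f t) \<in> J"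
      by (simp add: mult_single)
  qed
  then show "f \<in> J" by (simp add: poly_of_keys)
qed

lemma ideal_of_monomials:
  "ideal_of ((\<lambda>s. single s 1) ` G)
     = (monideal {s + t | s t. s \<in> G} :: ('n::finite, 'k::field) mpoly set)"
proof
  have "s \<in> {s + t | s t. s \<in> G}" if "s \<in> G" for s
    using that by (intro CollectI exI[of _ s] exI[of _ 0]) simp
  then show "ideal_of ((\<lambda>s. single s 1) ` G)
     \<subseteq> (monideal {s + t | s t. s \<in> G} :: ('n, 'k) mpoly set)"
    by (intro poly_ideal.span_minimal[OF _ is_ideal_monideal[OF upset_generated]])
      (simp add: single_mem_monideal image_subset_iff)
  show "(monideal {s + t | s t. s \<in> G} :: ('n, 'k) mpoly set)
      \<subseteq> ideal_of ((\<lambda>s. single s 1) ` G)"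
  proof (rule monideal_subset_ideal[OF poly_ideal.subspace_span])
    fix u assume "u \<in> {s + t | s t. s \<in> G}"
    then obtain s t where u: "u = s + t" "s \<in> G" by auto
    have "single t 1 * single s 1
        \<in> ideal_of ((\<lambda>s. single s 1 :: ('n, 'k) mpoly) ` G)"
      using u(2) by (intro poly_ideal.span_scale poly_ideal.span_base) auto
    then show "single u 1
        \<in> ideal_of ((\<lambda>s. single s 1 :: ('n, 'k) mpoly) ` G)"
      by (simp add: mult_single u(1) add.commute)
  qed
qed

lemma ideal_mult_monideal:
  assumes "upset L" "upset M"
  shows "ideal_mult (monideal L) (monideal M)
     = (monideal {s + t | s t. s \<in> L \<and> t \<in> M} :: ('n::finite, 'k::field) mpoly set)"
proof
  have "upset {s + t | s t. s \<in> L \<and> t \<in> M}"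
    using upsetD(1)[OF assms(2)] by (fastforce simp: upset_def add.assoc)
  then have "is_ideal (monideal {s + t | s t. s \<in> L \<and> t \<in> M} :: ('n, 'k) mpoly set)"
    by (rule is_ideal_monideal)
  moreover have "a * b \<in> monideal {s + t | s t. s \<in> L \<and> t \<in> M}"
    if "a \<in> monideal L" "b \<in> monideal M" for a b :: "('n, 'k) mpoly"
    using that keys_mult[of a b] by (fastforce simp: monideal_def)
  ultimately show "ideal_mult (monideal L) (monideal M)
      \<subseteq> (monideal {s + t | s t. s \<in> L \<and> t \<in> M} :: ('n, 'k) mpoly set)"
    unfolding ideal_mult_def by (intro poly_ideal.span_minimal) auto
  show "(monideal {s + t | s t. s \<in> L \<and> t \<in> M} :: ('n, 'k) mpoly set)
      \<subseteq> ideal_mult (monideal L) (monideal M)"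
    unfolding ideal_mult_def
  proof (rule monideal_subset_ideal[OF poly_ideal.subspace_span], rule poly_ideal.span_base)
    fix u assume "u \<in> {s + t | s t. s \<in> L \<and> t \<in> M}"
    then obtain s t where u: "u = s + t" "s \<in> L" "t \<in> M" by auto
    then have "single u 1 = single s (1::'k) * single t 1"
      by (simp add: mult_single)
    then show "single u 1
        \<in> {a * b | a b :: ('n, 'k) mpoly. a \<in> monideal L \<and> b \<in> monideal M}"
      using u(2,3) by (auto simp: single_mem_monideal intro!: exI)
  qed
qed

text \<open>A nonzero exponent is divisible by some variable. This turns minimality of a resolution,
  stated with the ideal of the variables, into vanishing of constant coefficients.\<close>

lemma ideal_of_range_mvar:
  "ideal_of (Set.range mvar) = {f :: ('n::finite, 'k::field) mpoly. lookup f 0 = 0}"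
proof -
  have eq: "{s + t | s t. s \<in> Set.range expo} = - {0 :: 'n \<Rightarrow>\<^sub>0 nat}"
  proof (intro subset_antisym subsetI)
    fix u :: "'n \<Rightarrow>\<^sub>0 nat" assume "u \<in> - {0}"
    then obtain i where "0 < lookup u i"
      by (auto simp: poly_mapping_eq_iff fun_eq_iff)
    then have "u = expo i + (u - expo i)" by (simp add: expo_diff_add)
    then show "u \<in> {s + t | s t. s \<in> Set.range expo}" by blast
  qed (auto simp: poly_mapping_eq_iff fun_eq_iff lookup_add lookup_single when_def)
  have "Set.range (mvar :: 'n \<Rightarrow> ('n, 'k) mpoly)
      = (\<lambda>s. single s 1) ` Set.range expo"
    by (simp add: mvar_def image_image)
  also have "ideal_of \<dots> = (monideal (- {0}) :: ('n, 'k) mpoly set)"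
    using ideal_of_monomials[of "Set.range (expo :: 'n \<Rightarrow> _)", where 'k = 'k] unfolding eq .
  also have "\<dots> = {f. lookup f 0 = 0}"
    by (auto simp only: mem_monideal_iff Compl_iff singleton_iff mem_Collect_eq not_not simp_thms)
  finally show ?thesis .
qed

section \<open>Homogeneous components\<close>

lemma homogeneousD: "homogeneous d f \<Longrightarrow> lookup f t \<noteq> 0 \<Longrightarrow> int (mdegree t) = d"
  by (simp add: homogeneous_def in_keys_iff)

lemma homogeneousI:
  "(\<And>t. lookup f t \<noteq> 0 \<Longrightarrow> int (mdegree t) = d) \<Longrightarrow> homogeneous d f"
  by (simp add: homogeneous_def in_keys_iff)

lemma homogeneous_0 [simp]: "homogeneous d 0"
  by (simp add: homogeneous_def)

lemma homogeneous_single [simp]: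
  "homogeneous d (single t c) \<longleftrightarrow> c = 0 \<or> int (mdegree t) = d"
  by (auto simp: homogeneous_def)

lemma homogeneous_1 [simp]: "homogeneous d 1 \<longleftrightarrow> d = 0"
  by (auto simp: homogeneous_def)

lemma homogeneous_mvar [simp]: "homogeneous d (mvar i) \<longleftrightarrow> d = 1"
  by (auto simp: mvar_def)

lemma homogeneous_add: "homogeneous d f \<Longrightarrow> homogeneous d g \<Longrightarrow> homogeneous d (f + g)"
  using keys_add[of f g] by (auto simp: homogeneous_def)

lemma homogeneous_uminus [simp]: "homogeneous d (- f) \<longleftrightarrow> homogeneous d f"
  by (simp add: homogeneous_def)

lemma homogeneous_diff: "homogeneous d f \<Longrightarrow> homogeneous d g \<Longrightarrow> homogeneous d (f - g)"
  using homogeneous_add[of d f "- g"] by simp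

lemma homogeneous_sum: "(\<And>x. x \<in> A \<Longrightarrow> homogeneous d (f x)) \<Longrightarrow> homogeneous d (sum f A)"
  by (induction A rule: infinite_finite_induct) (auto intro: homogeneous_add)

lemma homogeneous_mult:
  assumes "homogeneous d f" "homogeneous e g"
  shows "homogeneous (d + e) (f * g)"
  unfolding homogeneous_def
proof
  fix u assume "u \<in> keys (f * g)"
  then obtain s t where "u = s + t" "s \<in> keys f" "t \<in> keys g"
    using keys_mult[of f g] by auto
  with assms show "int (mdegree u) = d + e"
    by (simp add: homogeneous_def mdegree_add)
qed

lemma homogeneous_neg:
  assumes "homogeneous d f" "d < 0" shows "f = 0"
proof (rule poly_mapping_eqI)
  fix t show "lookup f t = lookup 0 t"
    using homogeneousD[OF assms(1), of t] assms(2) by auto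
qed

lemma homogeneous_deg_0:
  assumes "homogeneous 0 f" shows "f = single 0 (lookup f 0)"
proof (rule poly_mapping_eqI)
  fix t
  show "lookup f t
      = lookup (single 0 (lookup f 0)) t"
    using homogeneousD[OF assms, of t] by (auto simp: lookup_single when_def)
qed

definition hcomp :: "int \<Rightarrow> ('n::finite, 'k::field) mpoly \<Rightarrow> ('n, 'k) mpoly" where
  "hcomp d f = poly_of (keys f \<inter> {t. int (mdegree t) = d}) (lookup f)"

lemma lookup_hcomp:
  "lookup (hcomp d f) t = (if int (mdegree t) = d then lookup f t else 0)"
  by (simp add: hcomp_def poly_of_restrict_lookup)

lemma homogeneous_hcomp [simp]: "homogeneous d (hcomp d f)"
  by (rule homogeneousI) (simp add: lookup_hcomp split: if_splits)

lemma hcomp_0 [simp]: "hcomp d 0 = 0"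
  by (simp add: poly_mapping_eq_iff lookup_hcomp fun_eq_iff)

lemma hcomp_add: "hcomp d (f + g) = hcomp d f + hcomp d g"
  by (simp add: poly_mapping_eq_iff lookup_hcomp lookup_add fun_eq_iff)

lemma hcomp_sum: "hcomp d (sum f A) = (\<Sum>x\<in>A. hcomp d (f x))"
  by (induction A rule: infinite_finite_induct) (auto simp: hcomp_add)

lemma hcomp_homogeneous: "homogeneous d f \<Longrightarrow> hcomp d f = f"
  using homogeneousD by (intro poly_mapping_eqI) (auto simp: lookup_hcomp)

text \<open>After the component of degree \<open>d - e\<close> is split off, the rest of
  \<open>f\<close> has no term of that degree, and multiplication by \<open>g\<close> shifts all
  degrees by \<open>e\<close>.\<close>

lemma hcomp_mult:
  assumes "homogeneous e g"
  shows "hcomp d (g * f) = g * hcomp (d - e) f"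
proof -
  define r where "r = f - hcomp (d - e) f"
  have r: "lookup r t = 0" if "int (mdegree t) = d - e" for t
    using that by (simp add: r_def lookup_minus lookup_hcomp)
  have "hcomp d (g * r) = 0"
  proof (rule poly_mapping_eqI, rule ccontr)
    fix u assume "lookup (hcomp d (g * r)) u \<noteq> lookup 0 u"
    then have "int (mdegree u) = d" "u \<in> keys (g * r)"
      by (auto simp: lookup_hcomp in_keys_iff split: if_splits)
    then obtain s t where "u = s + t" "s \<in> keys g" "t \<in> keys r"
      using keys_mult[of g r] by auto
    with assms r[of t] \<open>int (mdegree u) = d\<close> show False
      by (auto simp: homogeneous_def mdegree_add in_keys_iff)
  qed
  moreover have "homogeneous d (g * hcomp (d - e) f)"
    using homogeneous_mult[OF assms homogeneous_hcomp[of "d - e" f]] by simp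
  moreover have "g * f = g * hcomp (d - e) f + g * r"
    by (simp add: r_def algebra_simps)
  ultimately show ?thesis
    by (simp add: hcomp_add hcomp_homogeneous)
qed

lemma sum_hcomp:
  assumes "finite D" "\<And>t. t \<in> keys f \<Longrightarrow> int (mdegree t) \<in> D"
  shows "(\<Sum>d\<in>D. hcomp d f) = f"
proof (rule poly_mapping_eqI)
  fix t
  show "lookup (\<Sum>d\<in>D. hcomp d f) t = lookup f t"
    using assms by (cases "t \<in> keys f")
      (auto simp: lookup_sum lookup_hcomp sum.delta in_keys_iff)
qed

section \<open>Koszul complexes\<close>

text \<open>The signs of the Koszul complex need a linear order on the variables, and the type of
  variables carries none; any injection into the naturals provides one.\<close>

definition vidx :: "'n::finite \<Rightarrow> nat" where
  "vidx = (SOME f. inj f)"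

lemma inj_vidx: "inj (vidx :: 'n::finite \<Rightarrow> nat)"
proof -
  have "\<exists>f :: 'n \<Rightarrow> nat. inj f"
    using finite_imp_inj_to_nat_seg[of "UNIV :: 'n set"] by auto
  then show ?thesis unfolding vidx_def by (rule someI_ex)
qed

lemma vidx_eq_iff [simp]: "vidx i = vidx j \<longleftrightarrow> i = j"
  by (simp add: inj_vidx inj_eq)

text \<open>The sign of moving a new factor \<open>i\<close> past the smaller elements of
  \<open>S\<close> to its place in the increasing wedge product.\<close>

definition ksgn :: "'n::finite \<Rightarrow> 'n set \<Rightarrow> 'a::comm_ring_1" where
  "ksgn i S = (- 1) ^ card {s \<in> S. vidx s < vidx i}"

lemma ksgn_square [simp]: "ksgn i S * ksgn i S = 1" "ksgn i S * (ksgn i S * a) = a"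
  by (simp_all add: ksgn_def power_add[symmetric] mult.assoc[symmetric])

lemma ksgn_neq_0 [simp]: "ksgn i S \<noteq> (0 :: 'a :: field)"
  by (simp add: ksgn_def)

lemma ksgn_insert:
  assumes "m \<notin> S"
  shows "ksgn l (insert m S) = (if vidx m < vidx l then - ksgn l S else ksgn l S)"
proof -
  have "{s \<in> insert m S. vidx s < vidx l} = (if vidx m < vidx l
      then insert m {s \<in> S. vidx s < vidx l} else {s \<in> S. vidx s < vidx l})"
    by auto
  then show ?thesis using assms by (simp add: ksgn_def)
qed

text \<open>Of two distinct variables exactly one precedes the other, so exactly one of the two
  signs changes. This is the anticommutativity of the wedge product.\<close>

lemma ksgn_swap:
  assumes "l \<noteq> m" "l \<notin> S" "m \<notin> S"
  shows "ksgn l S * ksgn m (insert l S) = - (ksgn m S * ksgn l (insert m S))"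
    and "ksgn l (insert m S) * ksgn m (insert l S) = - (ksgn l S * ksgn m S)"
  using assms linorder_neqE_nat[of "vidx l" "vidx m"] by (auto simp: ksgn_insert)

text \<open>
  A chain of degree \<open>p\<close> is a function supported on the sets of \<open>p\<close> variables. A set \<open>S\<close> stands
  for the wedge product of its elements; \<open>x i = 0\<close> removes \<open>i\<close>.
\<close>

definition koszul_d :: "('n::finite \<Rightarrow> 'a) \<Rightarrow> ('n set \<Rightarrow> 'a) \<Rightarrow> 'n set \<Rightarrow> 'a::comm_ring_1" where
  "koszul_d x z S = (\<Sum>i\<in>-S. ksgn i S * (x i * z (insert i S)))"

lemma koszul_d_add: "koszul_d x (\<lambda>S. y S + z S) S = koszul_d x y S + koszul_d x z S"
  by (simp add: koszul_d_def algebra_simps sum.distrib)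

lemma koszul_d_diff: "koszul_d x (\<lambda>S. y S - z S) S = koszul_d x y S - koszul_d x z S"
  by (simp add: koszul_d_def algebra_simps sum_subtractf)

lemma koszul_d_0 [simp]: "koszul_d x (\<lambda>S. 0) S = 0"
  by (simp add: koszul_d_def)

lemma koszul_d_mult: "koszul_d x (\<lambda>S. a * z S) S = a * koszul_d x z S"
  by (simp add: koszul_d_def algebra_simps sum_distrib_left)

lemma koszul_d_sum: "koszul_d x (\<lambda>S. \<Sum>a\<in>A. z a S) S = (\<Sum>a\<in>A. koszul_d x (z a) S)"
  by (induction A rule: infinite_finite_induct) (auto simp: koszul_d_add)

lemma koszul_d_cong:
  "(\<And>i. i \<notin> S \<Longrightarrow> x i * y (insert i S) = x i * z (insert i S)) \<Longrightarrow> koszul_d x y S = koszul_d x z S"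
  by (simp add: koszul_d_def)

lemma koszul_d_card:
  assumes "\<And>S. card S \<noteq> Suc p \<Longrightarrow> z S = 0" "card S \<noteq> p"
  shows "koszul_d x z S = 0"
  unfolding koszul_d_def
proof (rule sum.neutral, rule ballI)
  fix i assume "i \<in> - S"
  then have "card (insert i S) \<noteq> Suc p" using assms(2) by simp
  then show "ksgn i S * (x i * z (insert i S)) = 0" using assms(1) by simp
qed

text \<open>The terms of the ordered pairs (l, m) and (m, l) cancel. They are matched explicitly,
  because showing that the sum equals its own negative would say nothing in characteristic
  two.\<close>

lemma koszul_d_koszul_d: "koszul_d x (koszul_d x z) S = 0"
proof -
  define f where "f l m = ksgn l S * (x l * (ksgn m (insert l S) *
      (x m * z (insert m (insert l S)))))" for l m
  have f: "f l m + f m l = 0" if "l \<noteq> m" "l \<notin> S" "m \<notin> S" for l m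
  proof -
    have "f l m = (ksgn l S * ksgn m (insert l S)) * (x l * x m * z (insert m (insert l S)))"
      by (simp add: f_def mult_ac)
    also have "\<dots> = - f m l"
      unfolding ksgn_swap(1)[OF that] by (simp add: f_def mult_ac insert_commute)
    finally show ?thesis by simp
  qed
  let ?P = "{(l, m). l \<notin> S \<and> m \<notin> S \<and> vidx l < vidx m}"
  let ?N = "{(l, m). l \<notin> S \<and> m \<notin> S \<and> vidx m < vidx l}"
  have "koszul_d x (koszul_d x z) S = (\<Sum>l\<in>-S. \<Sum>m\<in>-insert l S. f l m)"
    by (simp add: koszul_d_def f_def sum_distrib_left)
  also have "\<dots> = (\<Sum>(l, m)\<in>Sigma (-S) (\<lambda>l. -insert l S). f l m)"
    by (rule sum.Sigma) auto
  also have "Sigma (-S) (\<lambda>l. -insert l S) = ?P \<union> ?N"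
    by (auto simp: not_less le_less)
  also have "(\<Sum>(l, m)\<in>?P \<union> ?N. f l m) = (\<Sum>(l, m)\<in>?P. f l m) + (\<Sum>(l, m)\<in>?N. f l m)"
    by (rule sum.union_disjoint) (auto intro: finite_subset[OF subset_UNIV])
  also have "(\<Sum>(l, m)\<in>?N. f l m) = (\<Sum>(l, m)\<in>?P. f m l)"
    by (rule sum.reindex_bij_witness[of _ prod.swap prod.swap]) auto
  also have "(\<Sum>(l, m)\<in>?P. f l m) + (\<Sum>(l, m)\<in>?P. f m l) = (\<Sum>(l, m)\<in>?P. f l m + f m l)"
    by (simp add: sum.distrib case_prod_unfold)
  also have "\<dots> = 0"
    by (rule sum.neutral) (auto intro!: f)
  finally show ?thesis .
qed

text \<open>Exterior multiplication by the basis element of \<open>i\<close>.\<close>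

definition koszul_h :: "'n::finite \<Rightarrow> ('n set \<Rightarrow> 'a) \<Rightarrow> 'n set \<Rightarrow> 'a::comm_ring_1" where
  "koszul_h i z T = (if i \<in> T then ksgn i (T - {i}) * z (T - {i}) else 0)"

lemma koszul_h_0 [simp]: "koszul_h i (\<lambda>S. 0) T = 0"
  by (simp add: koszul_h_def)

text \<open>\<open>koszul_d x\<close> is contraction with the covector \<open>x\<close> and
  \<open>koszul_h i\<close> is exterior multiplication, so their anticommutator is multiplication by
  \<open>x i\<close>.\<close>

lemma koszul_homotopy:
  assumes "x i = 1"
  shows "koszul_d x (koszul_h i z) S + koszul_h i (koszul_d x z) S = z S"
proof (cases "i \<in> S")
  case False
  then have "koszul_d x (koszul_h i z) S
      = (\<Sum>l\<in>-S. if l = i then ksgn l S * (x l * koszul_h i z (insert l S)) else 0)"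
    unfolding koszul_d_def by (intro sum.cong) (auto simp: koszul_h_def)
  also have "\<dots> = z S"
    using False assms by (simp add: koszul_h_def)
  finally show ?thesis using False by (simp add: koszul_h_def)
next
  case True
  define R where "R = S - {i}"
  with True have R: "S = insert i R" "i \<notin> R" by auto
  have c: "- R = insert i (- S)" using R by auto
  have "koszul_h i (koszul_d x z) S = ksgn i R * koszul_d x z R"
    using R by (simp add: koszul_h_def)
  also have "\<dots> = z S + (\<Sum>l\<in>-S. ksgn i R * (ksgn l R * (x l * z (insert l R))))"
    unfolding koszul_d_def c
    by (simp add: R algebra_simps sum_distrib_left assms)
  finally have 1: "koszul_h i (koszul_d x z) S = \<dots>" .
  have "koszul_d x (koszul_h i z) S
      = (\<Sum>l\<in>-S. - (ksgn i R * (ksgn l R * (x l * z (insert l R)))))"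
    unfolding koszul_d_def
  proof (rule sum.cong[OF refl])
    fix l assume "l \<in> - S"
    then have l: "l \<noteq> i" "l \<notin> R" using R by auto
    then have "insert l S - {i} = insert l R" using R by auto
    then have "ksgn l S * (x l * koszul_h i z (insert l S))
      = (ksgn l (insert i R) * ksgn i (insert l R)) * (x l * z (insert l R))"
      using R by (simp add: koszul_h_def mult_ac)
    then show "ksgn l S * (x l * koszul_h i z (insert l S))
        = - (ksgn i R * (ksgn l R * (x l * z (insert l R))))"
      unfolding ksgn_swap(2)[OF l R(2)] by (simp add: mult_ac)
  qed
  then show ?thesis by (simp add: 1 sum_negf)
qed

section \<open>Multidegrees of Koszul chains\<close>

definition ind :: "'n::finite set \<Rightarrow> 'n \<Rightarrow>\<^sub>0 nat" where
  "ind S = (\<Sum>i\<in>S. expo i)"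

lemma lookup_ind [simp]: "lookup (ind S) i = of_bool (i \<in> S)"
  by (simp add: ind_def lookup_sum lookup_single when_def)

lemma mdegree_ind [simp]: "mdegree (ind S) = card S"
  by (simp add: mdegree_def)

abbreviation vars_of :: "('n \<Rightarrow>\<^sub>0 nat) \<Rightarrow> 'n set" where
  "vars_of c \<equiv> keys c"

lemma ind_diff_add: "S \<subseteq> vars_of c \<Longrightarrow> c - ind S + ind S = c"
  by (subst add.commute, rule exponent_diff_add) (auto simp: in_keys_iff Suc_le_eq)

lemma mdegree_diff_ind: "S \<subseteq> vars_of c \<Longrightarrow> mdegree (c - ind S) + card S = mdegree c"
  using ind_diff_add[of S c] mdegree_add[of "c - ind S" "ind S"] by simp

lemma ind_insert: "i \<notin> S \<Longrightarrow> ind (insert i S) = ind S + expo i"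
  by (simp add: ind_def add.commute)

text \<open>Within one multidegree a chain on \<open>S\<close> carries the single monomial
  \<open>c - ind S\<close>, so multiplication by a variable becomes a coefficient: 1 if the variable
  divides \<open>c\<close>, and 0 otherwise.\<close>

definition on_vars :: "('n \<Rightarrow>\<^sub>0 nat) \<Rightarrow> 'n \<Rightarrow> 'k::field" where
  "on_vars c i = of_bool (i \<in> vars_of c)"

text \<open>The coefficient at \<open>S\<close> in the strand of total multidegree \<open>c\<close>.
  Subtraction of exponents truncates, hence the guard
  \<open>S \<subseteq> vars_of c\<close>.\<close>

definition mcoeff :: "('n::finite \<Rightarrow>\<^sub>0 nat) \<Rightarrow> ('n set \<Rightarrow> ('n, 'k::field) mpoly) \<Rightarrow> 'n set \<Rightarrow> 'k" where
  "mcoeff c z S = (if S \<subseteq> vars_of c then lookup (z S) (c - ind S) else 0)"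

lemma mcoeff_0 [simp]: "mcoeff c (\<lambda>S. 0) S = 0"
  by (simp add: mcoeff_def)

lemma lookup_eq_mcoeff: "lookup (z S) b = mcoeff (b + ind S) z S"
proof -
  have "S \<subseteq> vars_of (b + ind S)" by (auto simp: in_keys_iff lookup_add)
  then show ?thesis by (simp add: mcoeff_def)
qed

lemma chain_eqI:
  fixes y z :: "'n::finite set \<Rightarrow> ('n, 'k::field) mpoly"
  assumes "\<And>c S. S \<subseteq> vars_of c \<Longrightarrow> mcoeff c y S = mcoeff c z S"
  shows "y = z"
proof (rule ext, rule poly_mapping_eqI)
  fix S :: "'n set" and b :: "'n \<Rightarrow>\<^sub>0 nat"
  have "S \<subseteq> vars_of (b + ind S)" by (auto simp: in_keys_iff lookup_add)
  then show "lookup (y S) b = lookup (z S) b"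
    by (simp add: lookup_eq_mcoeff assms)
qed

lemma lookup_ksgn_mult:
  fixes f :: "('n::finite, 'k::field) mpoly"
  shows "lookup (ksgn i S * f) t = ksgn i S * lookup f t"
  unfolding ksgn_def by (cases "even (card {s \<in> S. vidx s < vidx i})") auto

text \<open>Removing \<open>i\<close> from a set is compensated by the factor \<open>mvar i\<close>,
  so the differential preserves the total multidegree.\<close>

lemma mcoeff_koszul_d:
  fixes z :: "'n::finite set \<Rightarrow> ('n, 'k::field) mpoly"
  shows "mcoeff c (koszul_d mvar z) S = koszul_d (on_vars c) (mcoeff c z) S"
proof (cases "S \<subseteq> vars_of c")
  case True
  have "ksgn i S * lookup (mvar i * z (insert i S)) (c - ind S)
      = ksgn i S * (on_vars c i * mcoeff c z (insert i S))" if "i \<notin> S" for i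
    using that True
    by (auto simp: lookup_mvar_mult mcoeff_def on_vars_def in_keys_iff lookup_minus ind_insert
        diff_diff_eq)
  with True show ?thesis
    by (simp add: mcoeff_def koszul_d_def lookup_sum lookup_ksgn_mult)
next
  case False
  then show ?thesis by (simp add: mcoeff_def koszul_d_def)
qed

text \<open>
  The multidegree \<open>c\<close> and the degree \<open>j\<close> of a chain are total: a set \<open>S\<close> of variables contributes
  \<open>ind S\<close> and \<open>card S\<close> to them.
\<close>

definition mchains :: "('n::finite \<Rightarrow>\<^sub>0 nat) set \<Rightarrow> nat \<Rightarrow> ('n \<Rightarrow>\<^sub>0 nat) \<Rightarrow> ('n set \<Rightarrow> 'k::field) set" where
  "mchains L p c = {\<zeta>. \<forall>S. \<zeta> S \<noteq> 0 \<longrightarrow> S \<subseteq> vars_of c \<and> card S = p \<and> c - ind S \<in> L}"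

text \<open>For an upset \<open>L\<close> this is the vanishing, in multidegree \<open>c\<close>, of
  Tor_p between the monomial ideal and the residue field. The type argument records the
  field.\<close>

definition mvanish :: "'k::field itself \<Rightarrow> ('n::finite \<Rightarrow>\<^sub>0 nat) set \<Rightarrow> nat \<Rightarrow> ('n \<Rightarrow>\<^sub>0 nat) \<Rightarrow> bool" where
  "mvanish k L p c \<longleftrightarrow> (\<forall>\<zeta>\<in>mchains L p c. koszul_d (on_vars c) \<zeta> = (\<lambda>S. 0 :: 'k) \<longrightarrow>
     (\<exists>\<eta>\<in>mchains L (Suc p) c. koszul_d (on_vars c) \<eta> = \<zeta>))"

definition pchains :: "('n::finite \<Rightarrow>\<^sub>0 nat) set \<Rightarrow> nat \<Rightarrow> int \<Rightarrow> ('n set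
  \<Rightarrow> ('n, 'k::field) mpoly) set" where
  "pchains L p j = {z. \<forall>S. z S \<in> monideal L \<and> homogeneous (j - int p) (z S) \<and> (card S \<noteq> p \<longrightarrow> z S
      = 0)}"

definition pvanish :: "'k::field itself \<Rightarrow> ('n::finite \<Rightarrow>\<^sub>0 nat) set \<Rightarrow> nat \<Rightarrow> int \<Rightarrow> bool" where
  "pvanish k L p j \<longleftrightarrow>
     (\<forall>z\<in>pchains L p j. koszul_d mvar z = (\<lambda>S. 0 :: ('n, 'k) mpoly) \<longrightarrow>
       (\<exists>y\<in>pchains L (Suc p) j. koszul_d mvar y = z))"

lemma mcoeff_mchains:
  assumes "z \<in> pchains L p j" shows "mcoeff c z \<in> mchains L p c"
  using assms by (auto simp: mchains_def pchains_def mcoeff_def mem_monideal_iff)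

lemma mcoeff_eq_0:
  assumes "z \<in> pchains L p j" "int (mdegree c) \<noteq> j" shows "mcoeff c z S = 0"
proof (rule ccontr)
  assume n: "mcoeff c z S \<noteq> 0"
  then have "S \<subseteq> vars_of c" "card S = p" "lookup (z S) (c - ind S) \<noteq> 0"
    using assms(1) by (auto simp: mcoeff_def pchains_def split: if_splits)
  with mdegree_diff_ind[of S c] homogeneousD[of "j - int p" "z S" "c - ind S"] assms show False
    by (auto simp: pchains_def)
qed

text \<open>In total degree \<open>j\<close> the Koszul complex is the direct sum of its multidegree
  strands. One direction embeds a cycle of a single strand, the other solves the strands separately
  and glues the solutions.\<close>

lemma pvanish_iff_mvanish:
  "pvanish TYPE('k::field) L p j \<longleftrightarrow>
     (\<forall>c :: 'n::finite \<Rightarrow>\<^sub>0 nat. int (mdegree c) = j \<longrightarrow> mvanish TYPE('k) L p c)"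
proof (intro iffI allI impI)
  fix c :: "'n \<Rightarrow>\<^sub>0 nat"
  assume pv: "pvanish TYPE('k) L p j" and c: "int (mdegree c) = j"
  show "mvanish TYPE('k) L p c"
    unfolding mvanish_def
  proof (intro ballI impI)
    fix \<zeta> :: "'n set \<Rightarrow> 'k"
    assume \<zeta>: "\<zeta> \<in> mchains L p c" and cyc: "koszul_d (on_vars c) \<zeta> = (\<lambda>S. 0)"
    define z where "z S = (if S \<subseteq> vars_of c then single (c - ind S) (\<zeta> S) else 0)" for S
    have "homogeneous (j - int p) (z S)" for S
      using mdegree_diff_ind[of S c] \<zeta> c by (auto simp: z_def mchains_def)
    moreover have "z S \<in> monideal L \<and> (card S \<noteq> p \<longrightarrow> z S = 0)" for S
      using \<zeta> by (cases "\<zeta> S = 0") (auto simp: z_def mchains_def single_mem_monideal)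
    ultimately have z: "z \<in> pchains L p j"
      by (simp add: pchains_def)
    have mz: "mcoeff c' z = (if c' = c then \<zeta> else (\<lambda>S. 0))" for c'
    proof (rule ext)
      fix S
      show "mcoeff c' z S = (if c' = c then \<zeta> else (\<lambda>S. 0)) S"
      proof (cases "c' = c")
        case True
        then show ?thesis using \<zeta> by (auto simp: mcoeff_def z_def mchains_def)
      next
        case False
        then have "c - ind S \<noteq> c' - ind S" if "S \<subseteq> vars_of c" "S \<subseteq> vars_of c'"
          using that ind_diff_add by metis
        with False show ?thesis by (auto simp: mcoeff_def z_def lookup_single when_def)
      qed
    qed
    have "koszul_d mvar z = (\<lambda>S. 0)"
      by (rule chain_eqI) (use cyc in \<open>auto simp: mcoeff_koszul_d mz\<close>)
    with pv z obtain y where y: "y \<in> pchains L (Suc p) j" "koszul_d mvar y = z"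
      unfolding pvanish_def by blast
    have "koszul_d (on_vars c) (mcoeff c y) = \<zeta>"
      using mcoeff_koszul_d[of c y] y(2) mz[of c] by (auto simp: fun_eq_iff)
    with mcoeff_mchains[OF y(1)] show "\<exists>\<eta>\<in>mchains L (Suc p) c. koszul_d (on_vars c) \<eta> = \<zeta>"
      by blast
  qed
next
  assume mv: "\<forall>c :: 'n \<Rightarrow>\<^sub>0 nat. int (mdegree c) = j \<longrightarrow> mvanish TYPE('k) L p c"
  show "pvanish TYPE('k) L p j"
    unfolding pvanish_def
  proof (intro ballI impI)
    fix z :: "'n set \<Rightarrow> ('n, 'k) mpoly"
    assume z: "z \<in> pchains L p j" and cyc: "koszul_d mvar z = (\<lambda>S. 0)"
    have "\<exists>\<eta>\<in>mchains L (Suc p) c. koszul_d (on_vars c) \<eta> = mcoeff c z"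
      if "int (mdegree c) = j" for c
    proof -
      have "koszul_d (on_vars c) (mcoeff c z) = (\<lambda>S. 0)"
        using mcoeff_koszul_d[of c z] cyc by (simp add: fun_eq_iff)
      with mv that mcoeff_mchains[OF z] show ?thesis unfolding mvanish_def by blast
    qed
    then obtain \<eta> where \<eta>: "\<And>c. int (mdegree c) = j \<Longrightarrow> \<eta> c \<in> mchains L (Suc p) c"
      "\<And>c. int (mdegree c) = j \<Longrightarrow> koszul_d (on_vars c) (\<eta> c) = mcoeff c z"
      by metis
    \<comment> \<open>Only finitely many exponents belong to a given set and total degree, so the
      chosen strands assemble to polynomials.\<close>
    define B where "B S = {b :: 'n \<Rightarrow>\<^sub>0 nat. int (mdegree (b + ind S)) = j}" for S
    have fB: "finite (B S)" for S
      by (rule finite_subset[OF _ finite_mdegree_le[of "nat j"]]) (auto simp: B_def mdegree_add)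
    define y where "y S = poly_of (B S) (\<lambda>b. \<eta> (b + ind S) S)" for S
    have y: "lookup (y S) b
        = (if int (mdegree (b + ind S)) = j then \<eta> (b + ind S) S else 0)" for S b
      unfolding y_def lookup_poly_of[OF fB] by (simp add: B_def)
    have my: "mcoeff c y = (if int (mdegree c) = j then \<eta> c else (\<lambda>S. 0))" for c
    proof (rule ext)
      fix S
      show "mcoeff c y S = (if int (mdegree c) = j then \<eta> c else (\<lambda>S. 0)) S"
      proof (cases "S \<subseteq> vars_of c")
        case True
        then show ?thesis
          by (simp add: mcoeff_def y ind_diff_add)
      next
        case False
        then show ?thesis using \<eta>(1)[of c] by (auto simp: mcoeff_def mchains_def)
      qed
    qed
    have ly: "card S = Suc p \<and> b \<in> L \<and> int (mdegree b) = j - int (Suc p)"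
      if "lookup (y S) b \<noteq> 0" for S b
    proof -
      have b: "int (mdegree (b + ind S)) = j" "\<eta> (b + ind S) S \<noteq> 0"
        using that by (auto simp: y split: if_splits)
      then have "card S = Suc p \<and> b \<in> L"
        using \<eta>(1)[of "b + ind S"] by (auto simp: mchains_def)
      with b(1) show ?thesis by (auto simp: mdegree_add)
    qed
    have "y \<in> pchains L (Suc p) j"
      unfolding pchains_def mem_monideal_iff
      by (auto intro!: homogeneousI poly_mapping_eqI dest!: ly) (use ly in fastforce)+
    moreover have "koszul_d mvar y = z"
      by (rule chain_eqI) (auto simp: mcoeff_koszul_d my \<eta>(2) mcoeff_eq_0[OF z])
    ultimately show "\<exists>y\<in>pchains L (Suc p) j. koszul_d mvar y = z" by blast
  qed
qed

lemma koszul_h_mchains: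
  assumes "\<zeta> \<in> mchains L p c" "i \<in> vars_of c"
    and "\<And>S. \<zeta> S \<noteq> 0 \<Longrightarrow> i \<notin> S \<Longrightarrow> c - ind (insert i S) \<in> M"
  shows "koszul_h i \<zeta> \<in> mchains M (Suc p) c"
  unfolding mchains_def
proof (intro CollectI allI impI)
  fix S assume "koszul_h i \<zeta> S \<noteq> 0"
  then have S: "i \<in> S" "\<zeta> (S - {i}) \<noteq> 0" by (auto simp: koszul_h_def split: if_splits)
  with assms(1) have "S - {i} \<subseteq> vars_of c" "card (S - {i}) = p" by (auto simp: mchains_def)
  with S assms(2) have "S \<subseteq> vars_of c" "card S = Suc p"
    by (auto simp: card_gt_0_iff card_Diff_singleton)
      (metis Suc_pred card_gt_0_iff empty_iff finite)
  moreover have "c - ind S \<in> M"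
    using assms(3)[of "S - {i}"] S by (simp add: insert_absorb)
  ultimately show "S \<subseteq> vars_of c \<and> card S = Suc p \<and> c - ind S \<in> M" by simp
qed

text \<open>The Koszul complex of the whole ring resolves the residue field: any variable that
  occurs in \<open>c\<close> contracts the strand.\<close>

lemma mvanish_UNIV:
  assumes "0 < p \<or> c \<noteq> 0" shows "mvanish TYPE('k::field) UNIV p c"
  unfolding mvanish_def
proof (intro ballI impI)
  fix \<zeta> :: "'a set \<Rightarrow> 'k"
  assume \<zeta>: "\<zeta> \<in> mchains UNIV p c" and cyc: "koszul_d (on_vars c) \<zeta> = (\<lambda>S. 0)"
  show "\<exists>\<eta>\<in>mchains UNIV (Suc p) c. koszul_d (on_vars c) \<eta> = \<zeta>"
  proof (cases "vars_of c = {}")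
    case True
    then have "\<zeta> = (\<lambda>S. 0)" using \<zeta> assms by (force simp: mchains_def fun_eq_iff)
    then show ?thesis by (intro bexI[of _ "\<lambda>S. 0"]) (auto simp: mchains_def)
  next
    case False
    then obtain i where i: "i \<in> vars_of c" by blast
    then have "koszul_d (on_vars c) (koszul_h i \<zeta>) S + koszul_h i (koszul_d (on_vars c) \<zeta>) S = \<zeta> S"
        for S
      by (intro koszul_homotopy) (simp add: on_vars_def)
    then have "koszul_d (on_vars c) (koszul_h i \<zeta>) = \<zeta>"
      by (simp add: cyc fun_eq_iff)
    with koszul_h_mchains[OF \<zeta> i] show ?thesis by blast
  qed
qed

section \<open>Graded free modules and their submodules\<close>

text \<open>Column vectors are functions on the naturals that vanish from the rank on. Addition then
  comes from the function type and needs no carrier set.\<close>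

type_synonym ('n, 'k) pvec = "nat \<Rightarrow> ('n, 'k) mpoly"

definition vscale :: "'a::comm_ring_1 \<Rightarrow> (nat \<Rightarrow> 'a) \<Rightarrow> nat \<Rightarrow> 'a" where
  "vscale r v = (\<lambda>q. r * v q)"

lemma vscale_apply: "vscale r v q = r * v q"
  by (simp add: vscale_def)

interpretation pv: Modules.module "vscale :: 'a::comm_ring_1 \<Rightarrow> _"
  by standard (simp_all add: fun_eq_iff vscale_apply algebra_simps)

lemma sum_fun_apply: "(\<Sum>x\<in>A. f x) q = (\<Sum>x\<in>A. f x q)" for f :: "_ \<Rightarrow> _ \<Rightarrow> 'b::comm_monoid_add"
  by (induction A rule: infinite_finite_induct) auto

definition fvec :: "int list \<Rightarrow> (nat \<Rightarrow> 'a::zero) set" where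
  "fvec cs = {v. \<forall>q\<ge>length cs. v q = 0}"

definition gvec :: "int list \<Rightarrow> int \<Rightarrow> ('n::finite, 'k::field) pvec set" where
  "gvec cs d = {v \<in> fvec cs. \<forall>q<length cs. homogeneous (d - cs ! q) (v q)}"

definition vcomp :: "int list \<Rightarrow> int \<Rightarrow> ('n::finite, 'k::field) pvec \<Rightarrow> ('n, 'k) pvec" where
  "vcomp cs d v = (\<lambda>q. if q < length cs then hcomp (d - cs ! q) (v q) else 0)"

lemma vcomp_gvec [simp]: "vcomp cs d v \<in> gvec cs d"
  by (simp add: gvec_def fvec_def vcomp_def)

lemma vcomp_id: "v \<in> gvec cs d \<Longrightarrow> vcomp cs d v = v"
  by (auto simp: gvec_def fvec_def vcomp_def hcomp_homogeneous fun_eq_iff)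

lemma gvec_fvec: "v \<in> gvec cs d \<Longrightarrow> v \<in> fvec cs"
  by (simp add: gvec_def)

lemma subspace_fvec [simp]: "pv.subspace (fvec cs)"
  by (auto simp: pv.subspace_def fvec_def vscale_apply)

lemma gvec_0 [simp]: "0 \<in> gvec cs d"
  by (simp add: gvec_def fvec_def)

lemma gvec_add: "u \<in> gvec cs d \<Longrightarrow> v \<in> gvec cs d \<Longrightarrow> u + v \<in> gvec cs d"
  by (simp add: gvec_def fvec_def homogeneous_add)

lemma gvec_diff: "u \<in> gvec cs d \<Longrightarrow> v \<in> gvec cs d \<Longrightarrow> u - v \<in> gvec cs d"
  by (simp add: gvec_def fvec_def homogeneous_diff)

lemma gvec_sum: "(\<And>x. x \<in> A \<Longrightarrow> f x \<in> gvec cs d) \<Longrightarrow> sum f A \<in> gvec cs d"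
  by (induction A rule: infinite_finite_induct) (auto intro: gvec_add)

lemma gvec_vscale: "homogeneous e r \<Longrightarrow> v \<in> gvec cs d \<Longrightarrow> vscale r v \<in> gvec cs (e + d)"
  using homogeneous_mult[of e r "d - cs ! q" "v q" for q]
  by (simp add: gvec_def fvec_def vscale_apply add_diff_eq)

lemma vcomp_sum_eq:
  fixes v :: "('n::finite, 'k::field) pvec"
  assumes "v \<in> fvec cs"
  obtains D where "finite D" "(\<Sum>d\<in>D. vcomp cs d v) = v"
proof
  let ?D = "(\<lambda>(q, t). int (mdegree t) + cs ! q) ` (SIGMA q:{..<length cs}. keys (v q))"
  show fin: "finite ?D" by auto
  show "(\<Sum>d\<in>?D. vcomp cs d v) = v"
  proof
    fix q
    show "(\<Sum>d\<in>?D. vcomp cs d v) q = v q"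
    proof (cases "q < length cs")
      case True
      have "(\<Sum>d\<in>?D. vcomp cs d v) q = (\<Sum>d\<in>?D. hcomp (d - cs ! q) (v q))"
        using True by (simp add: vcomp_def sum_fun_apply)
      also have "\<dots> = (\<Sum>d\<in>(\<lambda>d. d - cs ! q) ` ?D. hcomp d (v q))"
        by (subst sum.reindex) (auto simp: inj_on_def)
      also have "\<dots> = v q"
        by (rule sum_hcomp) (use fin True in \<open>force intro: image_eqI\<close>)+
      finally show ?thesis .
    next
      case False
      then show ?thesis using assms by (simp add: vcomp_def fvec_def sum_fun_apply)
    qed
  qed
qed

definition mapply :: "'a::comm_ring_1 mat \<Rightarrow> (nat \<Rightarrow> 'a) \<Rightarrow> nat \<Rightarrow> 'a" where
  "mapply A v = (\<lambda>p. if p < dim_row A then \<Sum>q<dim_col A. A $$ (p, q) * v q else 0)"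

lemma mapply_0 [simp]: "mapply A 0 = 0"
  by (simp add: mapply_def fun_eq_iff)

lemma mapply_add: "mapply A (u + v) = mapply A u + mapply A v"
  by (simp add: mapply_def fun_eq_iff algebra_simps sum.distrib)

lemma mapply_diff: "mapply A (u - v) = mapply A u - mapply A v"
  by (simp add: mapply_def fun_eq_iff algebra_simps sum_subtractf)

lemma mapply_vscale: "mapply A (vscale r v) = vscale r (mapply A v)"
  by (simp add: mapply_def fun_eq_iff vscale_apply algebra_simps sum_distrib_left)

lemma mapply_sum: "mapply A (sum f X) = (\<Sum>x\<in>X. mapply A (f x))"
  by (induction X rule: infinite_finite_induct)
    (simp_all add: mapply_add del: plus_fun_apply zero_fun_apply)

lemma mapply_fvec: "graded_map cs rs A \<Longrightarrow> mapply A v \<in> fvec rs"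
  by (auto simp: graded_map_def fvec_def mapply_def)

lemma vcomp_mapply:
  assumes "graded_map cs rs A"
  shows "vcomp rs d (mapply A v) = mapply A (vcomp cs d v)"
proof
  fix p
  have "hcomp (d - rs ! p) (A $$ (p, q) * v q) = A $$ (p, q) * hcomp (d - cs ! q) (v q)"
    if "p < length rs" "q < length cs" for q
    using hcomp_mult[of "cs ! q - rs ! p" "A $$ (p, q)" "d - rs ! p" "v q"] assms that
    by (simp add: graded_map_def)
  then show "vcomp rs d (mapply A v) p = mapply A (vcomp cs d v) p"
    using assms by (auto simp: graded_map_def vcomp_def mapply_def hcomp_sum intro!: sum.cong)
qed

lemma mapply_gvec: "graded_map cs rs A \<Longrightarrow> v \<in> gvec cs d \<Longrightarrow> mapply A v \<in> gvec rs d"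
  by (metis vcomp_mapply vcomp_id vcomp_gvec)

definition graded_submodule :: "int list \<Rightarrow> ('n::finite, 'k::field) pvec set \<Rightarrow> bool" where
  "graded_submodule cs V \<longleftrightarrow> pv.subspace V \<and> V \<subseteq> fvec cs \<and> (\<forall>v\<in>V. \<forall>d. vcomp cs d v \<in> V)"

definition im_map :: "int list \<Rightarrow> ('n::finite, 'k::field) mpoly mat \<Rightarrow> ('n, 'k) pvec set" where
  "im_map cs A = mapply A ` fvec cs"

definition ker_map :: "int list \<Rightarrow> ('n::finite, 'k::field) mpoly mat \<Rightarrow> ('n, 'k) pvec set" where
  "ker_map cs A = {v \<in> fvec cs. mapply A v = 0}"

lemma graded_submodule_ker:
  assumes "graded_map cs rs A" shows "graded_submodule cs (ker_map cs A)"
proof -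
  have "vcomp cs d v \<in> ker_map cs A" if "v \<in> ker_map cs A" for v d
    using that vcomp_mapply[OF assms, of d v, symmetric] gvec_fvec[OF vcomp_gvec]
    by (simp add: ker_map_def) (simp add: vcomp_def fun_eq_iff)
  moreover have "pv.subspace (ker_map cs A)"
    using pv.subspace_add[OF subspace_fvec] pv.subspace_scale[OF subspace_fvec]
      pv.subspace_0[OF subspace_fvec]
    by (auto simp: pv.subspace_def ker_map_def mapply_add mapply_vscale)
  ultimately show ?thesis
    unfolding graded_submodule_def by (auto simp: ker_map_def)
qed

text \<open>A graded map commutes with taking components, so any preimage can be replaced by its
  component of degree \<open>d\<close>.\<close>

lemma im_map_lift:
  assumes "graded_map cs rs A" "v \<in> im_map cs A" "v \<in> gvec rs d"
  obtains u where "u \<in> gvec cs d" "mapply A u = v"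
proof -
  from assms(2) obtain u where "v = mapply A u" by (auto simp: im_map_def)
  then have "mapply A (vcomp cs d u) = v"
    using vcomp_mapply[OF assms(1), of d u] vcomp_id[OF assms(3)] by simp
  with that vcomp_gvec show ?thesis by blast
qed

section \<open>Koszul homology of graded modules\<close>

definition kd :: "('n::finite set \<Rightarrow> ('n, 'k::field) pvec) \<Rightarrow> 'n set \<Rightarrow> ('n, 'k) pvec" where
  "kd z S = (\<lambda>q. koszul_d mvar (\<lambda>S. z S q) S)"

lemma kd_altdef: "kd z S = (\<Sum>i\<in>-S. vscale (ksgn i S * mvar i) (z (insert i S)))"
  by (simp add: kd_def koszul_d_def fun_eq_iff sum_fun_apply vscale_apply mult_ac)

lemma kd_kd [simp]: "kd (kd z) S = 0"
  by (simp add: kd_def koszul_d_koszul_d fun_eq_iff)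

lemma kd_diff: "kd (\<lambda>S. y S - z S) S = kd y S - kd z S"
  by (simp add: kd_def koszul_d_diff fun_eq_iff)

lemma kd_mapply: "kd (\<lambda>S. mapply A (z S)) S = mapply A (kd z S)"
  by (simp add: kd_altdef mapply_sum mapply_vscale)

definition kchains ::
    "int list \<Rightarrow> ('n::finite, 'k::field) pvec set \<Rightarrow> nat \<Rightarrow> int \<Rightarrow> ('n set \<Rightarrow> ('n, 'k) pvec) set" where
  "kchains cs V p j =
     {z. \<forall>S. z S \<in> V \<and> z S \<in> gvec cs (j - int p) \<and> (card S \<noteq> p \<longrightarrow> z S = 0)}"

text \<open>For a submodule \<open>V\<close>: Tor_p of \<open>V\<close> with the residue field
  vanishes in degree \<open>j\<close>. The degree is total, so a chain of size \<open>p\<close> has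
  coefficients of degree \<open>j - p\<close>.\<close>

definition kvanish :: "int list \<Rightarrow> ('n::finite, 'k::field) pvec set \<Rightarrow> nat \<Rightarrow> int \<Rightarrow> bool" where
  "kvanish cs V p j \<longleftrightarrow> (\<forall>z\<in>kchains cs V p j. (\<forall>S. kd z S = 0) \<longrightarrow>
     (\<exists>y\<in>kchains cs V (Suc p) j. \<forall>S. kd y S = z S))"

lemma kvanishD:
  assumes "kvanish cs V p j" "z \<in> kchains cs V p j" "\<And>S. kd z S = 0"
  obtains y where "y \<in> kchains cs V (Suc p) j" "\<And>S. kd y S = z S"
  using assms unfolding kvanish_def by blast

lemma kchains_mono: "V \<subseteq> W \<Longrightarrow> z \<in> kchains cs V p j \<Longrightarrow> z \<in> kchains cs W p j"
  by (auto simp: kchains_def)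

lemma kchains_diff:
  assumes "pv.subspace V" "y \<in> kchains cs V p j" "z \<in> kchains cs V p j"
  shows "(\<lambda>S. y S - z S) \<in> kchains cs V p j"
  unfolding kchains_def
proof (intro CollectI allI conjI impI)
  fix S
  have yz: "y S \<in> V" "z S \<in> V" "y S \<in> gvec cs (j - int p)" "z S \<in> gvec cs (j - int p)"
    "card S \<noteq> p \<Longrightarrow> y S = 0 \<and> z S = 0"
    using assms(2,3) by (auto simp: kchains_def)
  show "y S - z S \<in> V" by (rule pv.subspace_diff[OF assms(1) yz(1,2)])
  show "y S - z S \<in> gvec cs (j - int p)" by (rule gvec_diff[OF yz(3,4)])
  show "y S - z S = 0" if "card S \<noteq> p" using yz(5)[OF that] by simp
qed

lemma kd_kchains:
  assumes V: "pv.subspace V" and z: "z \<in> kchains cs V (Suc p) j"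
  shows "kd z \<in> kchains cs V p j"
  unfolding kchains_def
proof (intro CollectI allI conjI impI)
  fix S
  show "kd z S \<in> V"
    unfolding kd_altdef using z
    by (intro pv.subspace_sum[OF V] pv.subspace_scale[OF V]) (simp add: kchains_def)
  have "homogeneous 1 (ksgn i S * mvar i :: ('a, 'b) mpoly)" for i
    unfolding ksgn_def by (cases "even (card {s \<in> S. vidx s < vidx i})") auto
  then have "vscale (ksgn i S * mvar i) (z (insert i S)) \<in> gvec cs (1 + (j - int (Suc p)))" for i
    using z by (intro gvec_vscale) (simp_all add: kchains_def)
  then show "kd z S \<in> gvec cs (j - int p)"
    unfolding kd_altdef by (intro gvec_sum) simp
  assume "card S \<noteq> p"
  then show "kd z S = 0"
    using z koszul_d_card[of p "\<lambda>S. z S q" S mvar for q]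
    by (simp add: kd_def kchains_def fun_eq_iff)
qed

lemma mapply_kchains:
  assumes "graded_map cs rs A" "z \<in> kchains cs (fvec cs) p j"
  shows "(\<lambda>S. mapply A (z S)) \<in> kchains rs (im_map cs A) p j"
  using assms mapply_gvec[OF assms(1)] by (auto simp: kchains_def im_map_def)

lemma kchains_lift:
  assumes A: "graded_map cs rs A" and z: "z \<in> kchains rs (im_map cs A) p j"
  obtains y where "y \<in> kchains cs (fvec cs) p j" "\<And>S. mapply A (y S) = z S"
proof -
  have "\<exists>u. u \<in> gvec cs (j - int p) \<and> mapply A u = z S \<and> (card S \<noteq> p \<longrightarrow> u = 0)" for S
  proof (cases "card S = p")
    case True
    with z im_map_lift[OF A, of "z S" "j - int p"] show ?thesis by (auto simp: kchains_def)
  next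
    case False
    with z show ?thesis by (intro exI[of _ 0]) (simp add: kchains_def)
  qed
  then obtain y where "\<And>S. y S \<in> gvec cs (j - int p)" "\<And>S. mapply A (y S) = z S"
    "\<And>S. card S \<noteq> p \<longrightarrow> y S = 0"
    by metis
  with that[of y] gvec_fvec show ?thesis by (auto simp: kchains_def)
qed

text \<open>Each coordinate gives a shifted Koszul complex of the ring, which has homology only in
  homological degree zero, represented by constants.\<close>

lemma free_acyclic:
  assumes z: "z \<in> kchains cs (fvec cs) p j" and cyc: "\<And>S. kd z S = 0"
    and p: "0 < p \<or> (\<forall>q. lookup (z {} q) 0 = 0)"
  obtains y where "y \<in> kchains cs (fvec cs) (Suc p) j" "\<And>S. kd y S = z S"
proof -
  have "\<exists>y\<in>pchains UNIV (Suc p) (j - cs ! q). koszul_d mvar y = (\<lambda>S. z S q)"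
    if q: "q < length cs" for q
  proof -
    have zq: "(\<lambda>S. z S q) \<in> pchains UNIV p (j - cs ! q)"
      using z q by (fastforce simp: kchains_def pchains_def gvec_def monideal_def algebra_simps)
    have cyc': "koszul_d mvar (\<lambda>S. z S q) = (\<lambda>S. 0)"
      using cyc by (auto simp: kd_def fun_eq_iff)
    show ?thesis
    proof (cases "0 < p \<or> j \<noteq> cs ! q")
      case True
      then have "mvanish TYPE('b) UNIV p (c :: 'a \<Rightarrow>\<^sub>0 nat)" if "int (mdegree c) = j - cs ! q" for c
        using that by (intro mvanish_UNIV) auto
      then have "pvanish TYPE('b) (UNIV :: ('a \<Rightarrow>\<^sub>0 nat) set) p (j - cs ! q)"
        by (simp add: pvanish_iff_mvanish)
      with zq cyc' show ?thesis unfolding pvanish_def by blast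
    next
      case False
      \<comment> \<open>The only case outside \<open>mvanish_UNIV\<close>: here the coordinate is a
        constant, and constants are excluded by the assumption.\<close>
      then have "z S q = 0" for S
      proof (cases "S = {}")
        case True
        have "homogeneous 0 (z {} q)"
          using zq False by (simp add: pchains_def)
        from homogeneous_deg_0[OF this] p False True show ?thesis by simp
      next
        case S: False
        then have "card S \<noteq> p" using False by simp
        with z show ?thesis by (simp add: kchains_def)
      qed
      then show ?thesis
        by (intro bexI[of _ "\<lambda>S. 0"]) (auto simp: pchains_def fun_eq_iff)
    qed
  qed
  then obtain Y where Y: "\<And>q. q < length cs \<Longrightarrow> Y q \<in> pchains UNIV (Suc p) (j - cs ! q)"
    "\<And>q. q < length cs \<Longrightarrow> koszul_d mvar (Y q) = (\<lambda>S. z S q)"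
    by metis
  define y where "y S = (\<lambda>q. if q < length cs then Y q S else 0)" for S
  have "y S \<in> gvec cs (j - int (Suc p))" "card S \<noteq> Suc p \<Longrightarrow> y S = 0" for S
    using Y(1) by (auto simp: y_def gvec_def fvec_def pchains_def algebra_simps fun_eq_iff)
  then have "y \<in> kchains cs (fvec cs) (Suc p) j"
    by (auto simp: kchains_def intro: gvec_fvec)
  moreover have "kd y S = z S" for S
  proof
    fix q
    show "kd y S q = z S q"
    proof (cases "q < length cs")
      case True
      then show ?thesis using Y(2)[OF True] by (simp add: kd_def y_def)
    next
      case False
      then show ?thesis using z by (simp add: kd_def y_def kchains_def fvec_def)
    qed
  qed
  ultimately show ?thesis by (rule that)
qed

text \<open>Dimension shifting along 0 -> kernel -> free -> image -> 0. For \<open>p = 0\<close> the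
  free module has homology too; a kernel without constant coefficients maps to zero in it.\<close>

lemma kvanish_ker:
  assumes A: "graded_map cs rs A" and van: "kvanish rs (im_map cs A) (Suc p) j"
    and min: "0 < p \<or> (\<forall>v\<in>ker_map cs A. \<forall>q. lookup (v q) 0 = 0)"
  shows "kvanish cs (ker_map cs A) p j"
  unfolding kvanish_def
proof (intro ballI impI)
  fix z assume z: "z \<in> kchains cs (ker_map cs A) p j" and cyc: "\<forall>S. kd z S = 0"
  have zF: "z \<in> kchains cs (fvec cs) p j"
    by (rule kchains_mono[OF _ z]) (auto simp: ker_map_def)
  have "0 < p \<or> (\<forall>q. lookup (z {} q) 0 = 0)"
    using min z by (auto simp: kchains_def)
  with zF cyc obtain y where y: "y \<in> kchains cs (fvec cs) (Suc p) j" "\<And>S. kd y S = z S"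
    using free_acyclic by metis
  have "kd (\<lambda>S. mapply A (y S)) S = 0" for S
    using z by (simp add: kd_mapply y(2) kchains_def ker_map_def)
  with van mapply_kchains[OF A y(1)] obtain u
      where u: "u \<in> kchains rs (im_map cs A) (Suc (Suc p)) j"
    "\<And>S. kd u S = mapply A (y S)"
    by (rule kvanishD) (rule that)
  from kchains_lift[OF A u(1)] obtain w where w: "w \<in> kchains cs (fvec cs) (Suc (Suc p)) j"
    "\<And>S. mapply A (w S) = u S"
    by blast
  \<comment> \<open>\<open>y\<close> has the right boundary but need not lie in the kernel. Its
    image is the boundary of \<open>u\<close>, so subtracting the boundary of the lift
    \<open>w\<close> of \<open>u\<close> repairs this.\<close>
  define y' where "y' S = y S - kd w S" for S
  have "mapply A (kd w S) = mapply A (y S)" for S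
    using kd_mapply[of A w S] w(2) u(2) by simp
  then have "mapply A (y' S) = 0" for S
    by (simp add: y'_def mapply_diff)
  moreover have "y' \<in> kchains cs (fvec cs) (Suc p) j"
    unfolding y'_def
    by (rule kchains_diff[OF subspace_fvec y(1) kd_kchains[OF subspace_fvec w(1)]])
  ultimately have "y' \<in> kchains cs (ker_map cs A) (Suc p) j"
    by (simp add: kchains_def ker_map_def)
  moreover have "kd y' S = z S" for S
    unfolding y'_def kd_diff by (simp add: y(2))
  ultimately show "\<exists>y\<in>kchains cs (ker_map cs A) (Suc p) j. \<forall>S. kd y S = z S" by blast
qed

text \<open>The other half of the dimension shift: the free module has no homology in positive
  homological degree, so a cycle of the image is detected by the boundary of its lift, a cycle of
  the kernel.\<close>

lemma kvanish_im:
  assumes A: "graded_map cs rs A" and van: "kvanish cs (ker_map cs A) p j"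
  shows "kvanish rs (im_map cs A) (Suc p) j"
  unfolding kvanish_def
proof (intro ballI impI)
  fix v assume v: "v \<in> kchains rs (im_map cs A) (Suc p) j" and cyc: "\<forall>S. kd v S = 0"
  from kchains_lift[OF A v] obtain y where y: "y \<in> kchains cs (fvec cs) (Suc p) j"
    "\<And>S. mapply A (y S) = v S"
    by blast
  have "mapply A (kd y S) = 0" for S
    using kd_mapply[of A y S] y(2) cyc by simp
  with kd_kchains[OF subspace_fvec y(1)] have "kd y \<in> kchains cs (ker_map cs A) p j"
    by (simp add: kchains_def ker_map_def)
  with van obtain w where w: "w \<in> kchains cs (ker_map cs A) (Suc p) j" "\<And>S. kd w S = kd y S"
    by (rule kvanishD) auto
  have wF: "w \<in> kchains cs (fvec cs) (Suc p) j"
    by (rule kchains_mono[OF _ w(1)]) (auto simp: ker_map_def)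
  have "kd (\<lambda>S. y S - w S) S = 0" for S
    by (simp add: kd_diff w(2))
  with kchains_diff[OF subspace_fvec y(1) wF] obtain u where
    u: "u \<in> kchains cs (fvec cs) (Suc (Suc p)) j" "\<And>S. kd u S = y S - w S"
    by (rule free_acyclic) auto
  have "kd (\<lambda>S. mapply A (u S)) S = v S" for S
    using w(1) by (simp add: kd_mapply u(2) mapply_diff y(2) kchains_def ker_map_def)
  with mapply_kchains[OF A u(1)]
  show "\<exists>y\<in>kchains rs (im_map cs A) (Suc (Suc p)) j. \<forall>S. kd y S = v S" by blast
qed

lemma koszul_d_if: "koszul_d x (\<lambda>S. if P then z S else 0) S = (if P then koszul_d x z S else 0)"
  by simp

definition ideal_vec :: "('n::finite, 'k::field) mpoly set \<Rightarrow> ('n, 'k) pvec set" where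
  "ideal_vec J = {v \<in> fvec [0]. v 0 \<in> J}"

lemma kvanish_ideal_vec:
  fixes L :: "('n::finite \<Rightarrow>\<^sub>0 nat) set"
  shows "kvanish [0] (ideal_vec (monideal L :: ('n, 'k::field) mpoly set)) p j
      \<longleftrightarrow> pvanish TYPE('k) L p j"
proof -
  let ?V = "ideal_vec (monideal L :: ('n, 'k) mpoly set)"
  have c1: "(\<lambda>S. z S 0) \<in> pchains L p j" if "z \<in> kchains [0] ?V p j" for z p
    using that by (fastforce simp: kchains_def pchains_def ideal_vec_def gvec_def)
  have c2: "(\<lambda>S q. if q = 0 then z S else 0) \<in> kchains [0] ?V p j" if "z \<in> pchains L p j" for z p
    using that by (auto simp: kchains_def pchains_def ideal_vec_def gvec_def fvec_def fun_eq_iff)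
  have fv: "z S q = 0" if "z \<in> kchains [0] ?V p j" "0 < q" for z p S q
    using that by (auto simp: kchains_def ideal_vec_def fvec_def)
  show ?thesis
  proof
    assume kv: "kvanish [0] ?V p j"
    show "pvanish TYPE('k) L p j"
      unfolding pvanish_def
    proof (intro ballI impI)
      fix z :: "'n set \<Rightarrow> ('n, 'k) mpoly"
      assume z: "z \<in> pchains L p j" and cyc: "koszul_d mvar z = (\<lambda>S. 0)"
      have "kd (\<lambda>S q. if q = 0 then z S else 0) S = 0" for S
        using cyc by (simp add: kd_def koszul_d_if fun_eq_iff)
      with kv c2[OF z] obtain y where y: "y \<in> kchains [0] ?V (Suc p) j"
        "\<And>S. kd y S = (\<lambda>q. if q = 0 then z S else 0)"
        by (rule kvanishD) (rule that)
      have "koszul_d mvar (\<lambda>S. y S 0) S = z S" for S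
        using fun_cong[OF y(2)[of S], of 0] by (simp add: kd_def)
      with c1[OF y(1)] show "\<exists>y\<in>pchains L (Suc p) j. koszul_d mvar y = z" by blast
    qed
  next
    assume pv: "pvanish TYPE('k) L p j"
    show "kvanish [0] ?V p j"
      unfolding kvanish_def
    proof (intro ballI impI)
      fix z assume z: "z \<in> kchains [0] ?V p j" and cyc: "\<forall>S. kd z S = 0"
      have "koszul_d mvar (\<lambda>S. z S 0) = (\<lambda>S. 0)"
        using cyc by (auto simp: kd_def fun_eq_iff)
      with pv c1[OF z] obtain y where y: "y \<in> pchains L (Suc p) j"
        "koszul_d mvar y = (\<lambda>S. z S 0)"
        unfolding pvanish_def by blast
      have "kd (\<lambda>S q. if q = 0 then y S else 0) S = z S" for S
        using y(2) fv[OF z] by (auto simp: kd_def koszul_d_if fun_eq_iff)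
      with c2[OF y(1)] show "\<exists>y\<in>kchains [0] ?V (Suc p) j. \<forall>S. kd y S = z S" by blast
    qed
  qed
qed

section \<open>Minimal covers of graded modules\<close>

definition unit_fun :: "nat \<Rightarrow> 'a::zero \<Rightarrow> nat \<Rightarrow> 'a" where
  "unit_fun q a = (\<lambda>r. if r = q then a else 0)"

definition const_free :: "('n::finite, 'k::field) pvec \<Rightarrow> bool" where
  "const_free v \<longleftrightarrow> (\<forall>q. lookup (v q) 0 = 0)"

text \<open>A graded piece is a vector space inside the span of finitely many unit vectors times
  monomials, so a basis of it is finite.\<close>

lemma finite_gens_graded_piece:
  fixes V :: "('n::finite, 'k::field) pvec set"
  shows "\<exists>G. finite G \<and> G \<subseteq> V \<inter> gvec rs d \<and> V \<inter> gvec rs d \<subseteq> pv.span G"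
proof -
  define sc :: "'k \<Rightarrow> ('n, 'k) pvec \<Rightarrow> ('n, 'k) pvec"
    where "sc c v = vscale (single 0 c) v" for c v
  interpret kv: vector_space sc
    by standard (simp_all add: sc_def fun_eq_iff vscale_apply algebra_simps single_add mult_single
        flip: mult.assoc)
  define T :: "('n, 'k) pvec set" where "T = (\<lambda>(q, t). unit_fun q (single t 1)) `
      (SIGMA q:{..<length rs}. {t. mdegree t \<le> nat (d - rs ! q)}) "
  have "finite T"
    unfolding T_def by (intro finite_imageI finite_SigmaI finite_mdegree_le) auto
  have "v \<in> kv.span T" if v: "v \<in> gvec rs d" for v
  proof -
    have "v = (\<Sum>q<length rs. \<Sum>t\<in>keys (v q).
        sc (lookup (v q) t) (unit_fun q (single t 1)))" (is "_ = ?s")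
    proof
      fix r
      have "?s r = (\<Sum>q<length rs. if q = r then poly_of (keys (v q)) (lookup (v q)) else 0)"
        unfolding sum_fun_apply
        by (rule sum.cong[OF refl]) (simp add: sc_def vscale_apply unit_fun_def poly_of_def
            mult_single)
      also have "\<dots> = v r"
        using v by (simp add: poly_of_keys gvec_def fvec_def)
      finally show "v r = ?s r" by simp
    qed
    moreover have "unit_fun q (single t 1) \<in> T"
      if "q < length rs" "t \<in> keys (v q)" for q t
    proof -
      have "int (mdegree t) = d - rs ! q"
        using that v by (simp add: gvec_def homogeneous_def)
      then have "(q, t) \<in> (SIGMA q:{..<length rs}. {t. mdegree t \<le> nat (d - rs ! q)})"
        using that by auto
      then show ?thesis unfolding T_def by (rule rev_image_eqI) simp
    qed
    ultimately show ?thesis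
      by (metis (no_types, lifting) kv.span_sum kv.span_scale kv.span_base lessThan_iff)
  qed
  then have T: "V \<inter> gvec rs d \<subseteq> kv.span T" by blast
  obtain B where B: "B \<subseteq> V \<inter> gvec rs d" "kv.independent B" "V \<inter> gvec rs d \<subseteq> kv.span B"
    by (rule kv.maximal_independent_subset)
  have "finite B"
    using kv.independent_span_bound[OF \<open>finite T\<close> B(2)] B(1) T by blast
  moreover have "kv.span B \<subseteq> pv.span B"
  proof (rule kv.span_minimal[OF pv.span_superset])
    show "kv.subspace (pv.span B)"
      unfolding kv.subspace_def sc_def by (auto intro: pv.span_zero pv.span_add pv.span_scale)
  qed
  ultimately show ?thesis using B by blast
qed

definition chain0 :: "('n::finite, 'k::field) pvec \<Rightarrow> 'n set \<Rightarrow> ('n, 'k) pvec" where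
  "chain0 v S = (if S = {} then v else 0)"

lemma kd_chain0 [simp]: "kd (chain0 v) S = 0"
  by (simp add: kd_def chain0_def koszul_d_def fun_eq_iff)

lemma chain0_kchains: "chain0 v \<in> kchains cs V 0 j
  \<longleftrightarrow> v \<in> V \<and> v \<in> gvec cs j \<and> (0 :: ('n::finite, 'k::field) pvec) \<in> V"
  if "pv.subspace (V :: ('n, 'k) pvec set)"
proof -
  have "(\<exists>S :: 'n set. S \<noteq> {}) \<and> 0 \<in> V" using pv.subspace_0[OF that] by blast
  then show ?thesis by (auto simp: chain0_def kchains_def dest: spec[of _ "{}"])
qed

lemma subspace_im: "pv.subspace (im_map cs A)"
proof (rule pv.subspaceI)
  show "0 \<in> im_map cs A"
    unfolding im_map_def by (rule image_eqI[of _ _ 0]) (simp_all add: fvec_def)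
next
  fix x y assume "x \<in> im_map cs A" "y \<in> im_map cs A"
  then obtain u v where "x = mapply A u" "y = mapply A v" "u \<in> fvec cs" "v \<in> fvec cs"
    by (auto simp: im_map_def)
  then show "x + y \<in> im_map cs A"
    unfolding im_map_def by (intro image_eqI[of _ _ "u + v"] pv.subspace_add) (simp_all add:
        mapply_add)
next
  fix c x assume "x \<in> im_map cs A"
  then obtain u where "x = mapply A u" "u \<in> fvec cs"
    by (auto simp: im_map_def)
  then show "vscale c x \<in> im_map cs A"
    unfolding im_map_def
    by (intro image_eqI[of _ _ "vscale c u"] pv.subspace_scale) (simp_all add: mapply_vscale)
qed

lemma gvec_low_degree:
  assumes "v \<in> gvec rs d" "\<And>r. r \<in> set rs \<Longrightarrow> d < r" shows "v = 0"
proof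
  fix q
  show "v q = 0 q"
  proof (cases "q < length rs")
    case True
    then have "homogeneous (d - rs ! q) (v q)" "d - rs ! q < 0"
      using assms by (auto simp: gvec_def)
    then show ?thesis by (simp add: homogeneous_neg)
  next
    case False
    with assms(1) show ?thesis by (simp add: gvec_def fvec_def)
  qed
qed

text \<open>A vector of degree \<open>d\<close> is a Koszul cycle of size zero; writing it as a
  boundary expresses it by elements of degree \<open>d - 1\<close>. Hence degree \<open>d\<close>
  needs no new generators.\<close>

lemma kvanish_0D:
  assumes "kvanish rs V 0 d" "pv.subspace V" "v \<in> V" "v \<in> gvec rs d"
  obtains u where "\<And>i. u i \<in> V \<inter> gvec rs (d - 1)" "v = (\<Sum>i\<in>UNIV. vscale (mvar i) (u i))"
proof -
  have "chain0 v \<in> kchains rs V 0 d"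
    using assms pv.subspace_0 by (simp add: chain0_kchains)
  with assms(1) obtain y where y: "y \<in> kchains rs V (Suc 0) d" "\<And>S. kd y S = chain0 v S"
    by (rule kvanishD) auto
  have "v = kd y {}" by (simp add: y(2) chain0_def)
  also have "\<dots> = (\<Sum>i\<in>UNIV. vscale (mvar i) (y {i}))"
    by (simp add: kd_altdef ksgn_def)
  finally show ?thesis using y(1) by (intro that[of "\<lambda>i. y {i}"]) (auto simp: kchains_def)
qed

text \<open>Above \<open>D\<close> every element comes from one degree lower, and below all shifts
  the pieces are zero, so bases of the finitely many pieces in between generate.\<close>

lemma finite_homogeneous_gens:
  fixes V :: "('n::finite, 'k::field) pvec set"
  assumes V: "graded_submodule rs V" and van: "\<And>j. j > D \<Longrightarrow> kvanish rs V 0 j"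
  shows "\<exists>G. finite G \<and> G \<subseteq> V \<and> (\<forall>g\<in>G. \<exists>d. g \<in> gvec rs d) \<and> V \<subseteq> pv.span G"
proof -
  have sub: "pv.subspace V" using V by (simp add: graded_submodule_def)
  obtain H where H: "\<And>d. finite (H d)" "\<And>d. H d \<subseteq> V \<inter> gvec rs d" "\<And>d. V \<inter> gvec rs d \<subseteq> pv.span (H d)"
    using finite_gens_graded_piece[of V rs] by metis
  define m where "m = Min (insert 0 (set rs))"
  define G where "G = (\<Union>d\<in>{m..D}. H d)"
  have low: "V \<inter> gvec rs d \<subseteq> pv.span G" if "d \<le> D" for d
  proof (cases "m \<le> d")
    case True
    then have "H d \<subseteq> G" using that by (auto simp: G_def)
    then show ?thesis using H(3)[of d] pv.span_mono by blast
  next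
    case False
    have "m \<le> r" if "r \<in> set rs" for r
      using that by (simp add: m_def)
    then have "v = 0" if "v \<in> gvec rs d" for v :: "('n, 'k) pvec"
      using gvec_low_degree[OF that] False by force
    then show ?thesis using pv.span_zero by blast
  qed
  have high: "V \<inter> gvec rs (D + int n) \<subseteq> pv.span G" for n
  proof (induction n)
    case 0
    then show ?case using low[of D] by (metis add.right_neutral of_nat_0 order_refl)
  next
    case (Suc n)
    show ?case
    proof
      fix v assume "v \<in> V \<inter> gvec rs (D + int (Suc n))"
      then have v: "v \<in> V" "v \<in> gvec rs (D + int (Suc n))" by blast+
      have "kvanish rs V 0 (D + int (Suc n))" by (rule van) simp
      from kvanish_0D[OF this sub v] obtain u
        where u: "\<And>i. u i \<in> V \<inter> gvec rs (D + int (Suc n) - 1)"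
          "v = (\<Sum>i\<in>UNIV. vscale (mvar i) (u i))"
        by blast
      have "D + int (Suc n) - 1 = D + int n" by simp
      then have "u i \<in> pv.span G" for i
        using Suc.IH u(1)[of i] by auto
      then show "v \<in> pv.span G"
        unfolding u(2) by (intro pv.span_sum pv.span_scale)
    qed
  qed
  have all: "V \<inter> gvec rs d \<subseteq> pv.span G" for d
    using low[of d] high[of "nat (d - D)"] by (cases "d \<le> D") auto
  have "v \<in> pv.span G" if v: "v \<in> V" for v
  proof -
    from v V have "v \<in> fvec rs" by (auto simp: graded_submodule_def)
    then obtain E where "(\<Sum>d\<in>E. vcomp rs d v) = v" by (rule vcomp_sum_eq)
    moreover have "(\<Sum>d\<in>E. vcomp rs d v) \<in> pv.span G"
    proof (rule pv.span_sum)
      fix d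
      have "vcomp rs d v \<in> V \<inter> gvec rs d" using v V by (simp add: graded_submodule_def)
      then show "vcomp rs d v \<in> pv.span G" using all by blast
    qed
    ultimately show ?thesis by simp
  qed
  moreover have "finite G" "G \<subseteq> V"
    using H(1,2) by (auto simp: G_def)
  moreover have "\<forall>g\<in>G. \<exists>d. g \<in> gvec rs d"
    using H(2) unfolding G_def by blast
  ultimately show ?thesis by blast
qed

text \<open>Choose homogeneous generators in least number. A relation with a nonzero constant
  coefficient would express one generator through the others.\<close>

lemma minimal_cover:
  fixes V :: "('n::finite, 'k::field) pvec set"
  assumes V: "graded_submodule rs V" and van: "\<And>j. j > D \<Longrightarrow> kvanish rs V 0 j"
  shows "\<exists>cs A. graded_map cs rs A \<and> im_map cs A = V \<and> (\<forall>v\<in>ker_map cs A. const_free v)"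
proof -
  define gens where "gens G \<longleftrightarrow>
      finite G \<and> G \<subseteq> V \<and> (\<forall>g\<in>G. \<exists>d. g \<in> gvec rs d) \<and> V \<subseteq> pv.span G" for G
  have "\<exists>G. gens G" unfolding gens_def by (rule finite_homogeneous_gens[OF V van])
  then obtain G where G: "gens G" and min: "\<And>H. gens H \<Longrightarrow> card G \<le> card H"
    using ex_has_least_nat[of gens _ card] by blast
  then have "finite G" by (simp add: gens_def)
  from finite_distinct_list[OF this] obtain gs where gs: "set gs = G" "distinct gs" by blast
  obtain dg where dg: "\<And>g. g \<in> G \<Longrightarrow> g \<in> gvec rs (dg g)"
    using G unfolding gens_def by metis
  define cs where "cs = map dg gs"
  define A where "A = mat (length rs) (length gs) (\<lambda>(p, q). (gs ! q) p)"
  have dim: "dim_row A = length rs" "dim_col A = length gs" by (simp_all add: A_def)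
  have gr: "graded_map cs rs A"
    using dg gs(1) by (auto simp: graded_map_def cs_def A_def gvec_def)
  have ap: "mapply A v = (\<Sum>q<length gs. vscale (v q) (gs ! q))" for v
  proof
    fix p
    show "mapply A v p = (\<Sum>q<length gs. vscale (v q) (gs ! q)) p"
    proof (cases "p < length rs")
      case True
      then show ?thesis by (simp add: mapply_def dim sum_fun_apply vscale_apply) (simp add: A_def
          mult.commute)
    next
      case False
      then have "(gs ! q) p = 0" if "q < length gs" for q
        using dg[of "gs ! q"] gs(1) that by (auto simp: gvec_def fvec_def)
      then show ?thesis using False by (simp add: mapply_def dim sum_fun_apply vscale_apply)
    qed
  qed
  have "im_map cs A = pv.span G"
  proof
    show "im_map cs A \<subseteq> pv.span G"
    proof
      fix x assume "x \<in> im_map cs A"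
      then obtain v where x: "x = (\<Sum>q<length gs. vscale (v q) (gs ! q))"
        by (auto simp: im_map_def ap)
      show "x \<in> pv.span G"
        unfolding x using gs(1) by (intro pv.span_sum pv.span_scale pv.span_base) auto
    qed
    show "pv.span G \<subseteq> im_map cs A"
    proof
      fix x assume "x \<in> pv.span G"
      then obtain u where x: "x = (\<Sum>g\<in>G. vscale (u g) g)"
        using G pv.span_finite[of G] by (auto simp: gens_def)
      define v where "v = (\<lambda>q. if q < length gs then u (gs ! q) else 0)"
      have "x = (\<Sum>q<length gs. vscale (u (gs ! q)) (gs ! q))"
        unfolding x using bij_betw_nth[OF gs(2) refl gs(1)[symmetric]]
        by (rule sum.reindex_bij_betw[symmetric])
      also have "\<dots> = mapply A v"
        unfolding ap by (rule sum.cong) (simp_all add: v_def)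
      finally show "x \<in> im_map cs A"
        by (auto simp: im_map_def fvec_def cs_def v_def)
    qed
  qed
  moreover have "pv.span G = V"
    using G V pv.span_minimal[of G V] by (auto simp: gens_def graded_submodule_def)
  moreover have "const_free v" if v: "v \<in> ker_map cs A" for v
  proof (rule ccontr)
    assume "\<not> const_free v"
    then obtain q where q: "lookup (v q) 0 \<noteq> 0" by (auto simp: const_free_def)
    have ql: "q < length gs"
      using v q by (auto simp: ker_map_def fvec_def cs_def not_le[symmetric])
    define c where "c = lookup (v q) 0"
    \<comment> \<open>The component of the relation in the degree of generator \<open>q\<close> is
      again a relation, and its coefficient at \<open>q\<close> is the bare constant
      \<open>c\<close>, which is invertible.\<close>
    define u where "u = vcomp cs (cs ! q) v"
    have "u \<in> ker_map cs A"
      using graded_submodule_ker[OF gr] v by (auto simp: graded_submodule_def u_def)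
    then have s0: "(\<Sum>r<length gs. vscale (u r) (gs ! r)) = 0"
      by (simp add: ker_map_def ap)
    have "u q = single 0 c"
      using ql homogeneous_deg_0[OF homogeneous_hcomp, of "v q"]
      by (simp add: u_def vcomp_def cs_def lookup_hcomp c_def)
    then have "vscale (single 0 c) (gs ! q)
        = - (\<Sum>r\<in>{..<length gs} - {q}. vscale (u r) (gs ! r))"
      using s0 ql by (simp add: sum.remove[of "{..<length gs}" q] eq_neg_iff_add_eq_0)
    moreover have "\<dots> \<in> pv.span (G - {gs ! q})"
      using gs ql by (intro pv.span_neg pv.span_sum pv.span_scale pv.span_base)
        (auto simp: nth_eq_iff_index_eq)
    ultimately have "vscale (single 0 c) (gs ! q) \<in> pv.span (G - {gs ! q})" by simp
    then have "vscale (single 0 (inverse c)) (vscale (single 0 c) (gs ! q))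
        \<in> pv.span (G - {gs ! q})"
      by (rule pv.span_scale)
    then have "gs ! q \<in> pv.span (G - {gs ! q})"
      using q by (simp add: c_def mult_single)
    moreover have "g \<in> pv.span (G - {gs ! q})" if "g \<in> G" "g \<noteq> gs ! q" for g
      using that by (intro pv.span_base) simp
    ultimately have "G \<subseteq> pv.span (G - {gs ! q})" by blast
    then have "pv.span G \<subseteq> pv.span (G - {gs ! q})"
      by (rule pv.span_minimal) simp
    then have "gens (G - {gs ! q})"
      using G by (auto simp: gens_def)
    from min[OF this] have "card G \<le> card (G - {gs ! q})" .
    moreover have "gs ! q \<in> G" "finite G" using gs(1) ql by auto
    ultimately show False by (metis card_Diff1_less not_le)
  qed
  ultimately show ?thesis using gr by blast
qed

text \<open>If no generator has degree \<open>j\<close>, a lift of an element of that degree has no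
  constant coefficients and is a boundary in the free module. Conversely, if the image of a unit
  vector were a combination of multiples of the variables, the difference of the lifts would be a
  relation with constant coefficient 1.\<close>

lemma kvanish_0_iff:
  fixes A :: "('n::finite, 'k::field) mpoly mat"
  assumes A: "graded_map cs rs A" and min: "\<forall>v\<in>ker_map cs A. const_free v"
  shows "kvanish rs (im_map cs A) 0 j \<longleftrightarrow> j \<notin> set cs"
proof
  assume j: "j \<notin> set cs"
  show "kvanish rs (im_map cs A) 0 j"
    unfolding kvanish_def
  proof (intro ballI impI)
    fix z assume z: "z \<in> kchains rs (im_map cs A) 0 j"
    have "z {} \<in> im_map cs A" "z {} \<in> gvec rs j" using z by (simp_all add: kchains_def)
    from im_map_lift[OF A this] obtain u where u: "u \<in> gvec cs j" "mapply A u = z {}" .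
    have "lookup (u q) 0 = 0" for q
    proof (rule ccontr)
      assume n: "lookup (u q) 0 \<noteq> 0"
      then have "q < length cs" using u(1) by (auto simp: gvec_def fvec_def not_le[symmetric])
      with u(1) have "homogeneous (j - cs ! q) (u q)" by (simp add: gvec_def)
      from homogeneousD[OF this n] \<open>q < length cs\<close> j show False by auto
    qed
    moreover have "chain0 u \<in> kchains cs (fvec cs) 0 j"
      using u(1) by (simp add: chain0_kchains gvec_fvec pv.subspace_0)
    ultimately obtain y where y: "y \<in> kchains cs (fvec cs) (Suc 0) j" "\<And>S. kd y S = chain0 u S"
      using free_acyclic[of "chain0 u" cs 0 j] by (auto simp: chain0_def)
    have "kd (\<lambda>S. mapply A (y S)) S = z S" for S
      using z u(2) by (auto simp: kd_mapply y(2) chain0_def kchains_def)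
    with mapply_kchains[OF A y(1)]
    show "\<exists>y\<in>kchains rs (im_map cs A) (Suc 0) j. \<forall>S. kd y S = z S" by blast
  qed
next
  assume van: "kvanish rs (im_map cs A) 0 j"
  show "j \<notin> set cs"
  proof
    assume "j \<in> set cs"
    then obtain q where q: "q < length cs" "cs ! q = j" by (auto simp: in_set_conv_nth)
    define e :: "('n, 'k) pvec" where "e = unit_fun q 1"
    have e: "e \<in> gvec cs j"
      using q by (auto simp: e_def unit_fun_def gvec_def fvec_def)
    have "mapply A e \<in> im_map cs A" "mapply A e \<in> gvec rs j"
      using mapply_gvec[OF A e] gvec_fvec[OF e] by (auto simp: im_map_def)
    from kvanish_0D[OF van subspace_im this] obtain u where
      u: "\<And>i. u i \<in> im_map cs A \<inter> gvec rs (j - 1)" "mapply A e = (\<Sum>i\<in>UNIV. vscale (mvar i) (u i))"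
      by blast
    have "\<exists>w. w \<in> fvec cs \<and> mapply A w = u i" for i
      using u(1)[of i] by (auto simp: im_map_def)
    then obtain w where w: "\<And>i. w i \<in> fvec cs" "\<And>i. mapply A (w i) = u i" by metis
    define f where "f = e - (\<Sum>i\<in>UNIV. vscale (mvar i) (w i))"
    have "mapply A f = 0"
      by (simp add: f_def mapply_diff mapply_sum mapply_vscale w(2) u(2))
    moreover have "f \<in> fvec cs"
      unfolding f_def using w(1) gvec_fvec[OF e]
      by (intro pv.subspace_diff pv.subspace_sum pv.subspace_scale subspace_fvec)
    ultimately have "const_free f" using min by (simp add: ker_map_def)
    moreover have "lookup (f q) 0 = 1"
      by (simp add: f_def e_def unit_fun_def sum_fun_apply vscale_apply lookup_minus lookup_sum
          lookup_mult_zero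
          lookup_one mvar_def lookup_single)
        (simp add: when_def poly_mapping_eq_iff fun_eq_iff lookup_single)
    ultimately show False by (simp add: const_free_def)
  qed
qed

section \<open>Minimal resolutions\<close>

definition target :: "(nat \<Rightarrow> int list) \<Rightarrow> nat \<Rightarrow> int list" where
  "target F i = (case i of 0 \<Rightarrow> [0] | Suc i' \<Rightarrow> F i')"

text \<open>Minimality as a condition on kernels is the form in which \<open>minimal_cover\<close>
  delivers it; \<open>target\<close> lets the augmentation be treated like the
  differentials.\<close>

definition min_res :: "('n::finite, 'k::field) pvec set \<Rightarrow> (nat \<Rightarrow> int list) \<Rightarrow> (nat
  \<Rightarrow> ('n, 'k) mpoly mat) \<Rightarrow> bool" where
  "min_res V F \<phi> \<longleftrightarrow> (\<forall>i. graded_map (F i) (target F i) (\<phi> i)) \<and> im_map (F 0) (\<phi> 0) = V \<and>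
     (\<forall>i. ker_map (F i) (\<phi> i) = im_map (F (Suc i)) (\<phi> (Suc i)) \<and>
       (\<forall>v\<in>ker_map (F i) (\<phi> i). const_free v))"

lemma min_res_exists:
  fixes V :: "('n::finite, 'k::field) pvec set"
  assumes V: "graded_submodule [0] V" and van: "\<And>p j. j - int p > R \<Longrightarrow> kvanish [0] V p j"
  shows "\<exists>F \<phi>. min_res V F \<phi>"
proof -
  \<comment> \<open>The bound is \<open>R + int i\<close> at stage \<open>i\<close>: passing to the
    kernel lowers the homological degree by one and keeps \<open>j\<close>, so
    \<open>j - int p\<close> grows by one.\<close>
  define P where "P i x = (case x of (cs, rs, A :: ('n, 'k) mpoly mat) \<Rightarrow>
      graded_map cs rs A \<and> (\<forall>v\<in>ker_map cs A. const_free v) \<and>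
      (\<forall>p j. j - int p > R + int i \<longrightarrow> kvanish rs (im_map cs A) p j) \<and>
      (i = 0 \<longrightarrow> rs = [0] \<and> im_map cs A = V))" for i x
  define Q :: "int list \<times> int list \<times> ('n, 'k) mpoly mat \<Rightarrow> int list \<times> int list \<times> ('n, 'k) mpoly mat
      \<Rightarrow> bool"
    where "Q x y = (case x of (cs, rs, A) \<Rightarrow>
      case y of (cs', rs', A') \<Rightarrow> rs' = cs \<and> im_map cs' A' = ker_map cs A)" for x y
  obtain cs A where "graded_map cs [0] A" "im_map cs A = V" "\<forall>v\<in>ker_map cs A. const_free v"
    using minimal_cover[OF V, of R] van by fastforce
  then have "P 0 (cs, [0], A)" using van by (auto simp: P_def)
  moreover have "\<exists>y. P (Suc i) y \<and> Q x y" if "P i x" for i x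
  proof -
    obtain cs rs A where x: "x = (cs, rs, A)" by (cases x)
    from that x have p: "graded_map cs rs A" "\<forall>v\<in>ker_map cs A. const_free v"
      "\<And>p j. j - int p > R + int i \<Longrightarrow> kvanish rs (im_map cs A) p j"
      by (auto simp: P_def)
    have kv: "kvanish cs (ker_map cs A) p j" if "j - int p > R + int (Suc i)" for p j
      using p that by (intro kvanish_ker[OF p(1)]) (auto simp: const_free_def)
    then obtain cs' A' where "graded_map cs' cs A'" "im_map cs' A' = ker_map cs A"
      "\<forall>v\<in>ker_map cs' A'. const_free v"
      using minimal_cover[OF graded_submodule_ker[OF p(1)], of "R + int (Suc i)"] by fastforce
    with kv show ?thesis by (intro exI[of _ "(cs', cs, A')"]) (simp add: P_def Q_def x)
  qed
  ultimately obtain f where f: "\<And>i. P i (f i)" "\<And>i. Q (f i) (f (Suc i))"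
    using dependent_nat_choice[of P "\<lambda>_. Q"] by blast
  define F where "F i = fst (f i)" for i
  define \<phi> where "\<phi> i = snd (snd (f i))" for i
  have t: "fst (snd (f i)) = target F i" for i
    using f(1)[of 0] f(2)[of "i - 1"]
    by (cases i) (auto simp: P_def Q_def target_def F_def split: prod.splits)
  have fi: "f i = (F i, target F i, \<phi> i)" for i
    by (simp add: F_def \<phi>_def t[symmetric])
  have "min_res V F \<phi>"
    unfolding min_res_def
  proof (intro conjI allI)
    fix i
    show "graded_map (F i) (target F i) (\<phi> i)" "\<forall>v\<in>ker_map (F i) (\<phi> i). const_free v"
      using f(1)[of i] unfolding fi P_def by simp_all
    show "ker_map (F i) (\<phi> i) = im_map (F (Suc i)) (\<phi> (Suc i))"
      using f(2)[of i] unfolding fi Q_def by simp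
    show "im_map (F 0) (\<phi> 0) = V"
      using f(1)[of 0] unfolding fi P_def by simp
  qed
  then show ?thesis by blast
qed

text \<open>Every map of the resolution trades one homological degree for one syzygy, in both
  directions.\<close>

lemma min_res_kvanish:
  assumes "min_res V F \<phi>"
  shows "kvanish [0] V (i + p) j \<longleftrightarrow> kvanish (target F i) (im_map (F i) (\<phi> i)) p j"
proof (induction i arbitrary: p)
  case 0
  then show ?case using assms by (simp add: min_res_def target_def)
next
  case (Suc i)
  have m: "graded_map (F i) (target F i) (\<phi> i)" "\<forall>v\<in>ker_map (F i) (\<phi> i). const_free v"
    "ker_map (F i) (\<phi> i) = im_map (F (Suc i)) (\<phi> (Suc i))"
    using assms by (auto simp: min_res_def)
  have "kvanish [0] V (Suc i + p) j \<longleftrightarrow> kvanish (target F i) (im_map (F i) (\<phi> i)) (Suc p) j"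
    using Suc.IH[of "Suc p"] by simp
  also have "\<dots> \<longleftrightarrow> kvanish (F i) (ker_map (F i) (\<phi> i)) p j"
    using kvanish_im[OF m(1)] kvanish_ker[OF m(1)] m(2) by (auto simp: const_free_def)
  finally show ?case by (simp add: m(3) target_def)
qed

lemma min_res_degrees:
  assumes "min_res V F \<phi>"
  shows "j \<in> set (F i) \<longleftrightarrow> \<not> kvanish [0] V i j"
  using min_res_kvanish[OF assms, of i 0 j] kvanish_0_iff[of "F i" "target F i" "\<phi> i" j] assms
  by (simp add: min_res_def)

section \<open>Uniqueness of minimal resolutions\<close>

lemma mapply_unit_fun:
  "mapply A (unit_fun q 1) = (\<lambda>p. if p < dim_row A \<and> q < dim_col A then A $$ (p, q) else 0)"
proof
  fix p
  have "(\<Sum>r<dim_col A. A $$ (p, r) * unit_fun q 1 r)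
      = (\<Sum>r<dim_col A. if r = q then A $$ (p, r) else 0)"
    by (rule sum.cong) (auto simp: unit_fun_def)
  then show "mapply A (unit_fun q 1) p = (if p < dim_row A \<and> q < dim_col A then A $$ (p, q) else 0)"
    by (simp add: mapply_def)
qed

lemma unit_fun_fvec: "unit_fun q a \<in> fvec cs \<longleftrightarrow> q < length cs \<or> a = 0"
  by (auto simp: unit_fun_def fvec_def)

lemma index_mult_mat_sum:
  assumes "p < dim_row A" "q < dim_col B" "dim_col A = dim_row B"
  shows "(A * B) $$ (p, q) = (\<Sum>r<dim_row B. A $$ (p, r) * B $$ (r, q))"
  using assms by (simp add: scalar_prod_def atLeast0LessThan)

lemma mapply_mult:
  assumes "dim_col A = dim_row B"
  shows "mapply (A * B) v = mapply A (mapply B v)"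
proof
  fix p
  have "(\<Sum>q<dim_col B. (\<Sum>r<dim_row B. A $$ (p, r) * B $$ (r, q)) * v q)
      = (\<Sum>r<dim_row B. A $$ (p, r) * (\<Sum>q<dim_col B. B $$ (r, q) * v q))"
    unfolding sum_distrib_left sum_distrib_right by (subst sum.swap) (simp add: mult.assoc)
  then show "mapply (A * B) v p = mapply A (mapply B v) p"
    using assms by (simp add: mapply_def index_mult_mat_sum del: index_mult_mat(1))
qed

lemma mapply_one: "v \<in> fvec cs \<Longrightarrow> mapply (1\<^sub>m (length cs)) v = v"
proof
  fix p assume v: "v \<in> fvec cs"
  have "(\<Sum>q<length cs. 1\<^sub>m (length cs) $$ (p, q) * v q) = (\<Sum>q<length cs. if q = p then v q else 0)"
    if "p < length cs"
    using that by (intro sum.cong) auto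
  then show "mapply (1\<^sub>m (length cs)) v p = v p"
    using v by (simp add: mapply_def fvec_def)
qed

lemma graded_map_carrier: "graded_map cs rs A \<Longrightarrow> A \<in> carrier_mat (length rs) (length cs)"
  by (simp add: graded_map_def)

lemma graded_mapD:
  "graded_map cs rs A \<Longrightarrow> p < length rs \<Longrightarrow> q < length cs \<Longrightarrow> homogeneous (cs ! q - rs ! p) (A $$ (p, q))"
  by (simp add: graded_map_def)

lemma graded_map_mult:
  assumes A: "graded_map cs rs A" and B: "graded_map bs cs B"
  shows "graded_map bs rs (A * B)"
  unfolding graded_map_def
proof (intro conjI allI impI)
  fix p q assume p: "p < length rs" and q: "q < length bs"
  have "homogeneous ((cs ! r - rs ! p) + (bs ! q - cs ! r)) (A $$ (p, r) * B $$ (r, q))"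
      if "r < length cs" for r
    using p q that by (intro homogeneous_mult graded_mapD[OF A] graded_mapD[OF B])
  then show "homogeneous (bs ! q - rs ! p) ((A * B) $$ (p, q))"
    using p q graded_map_carrier[OF A] graded_map_carrier[OF B]
    by (subst index_mult_mat_sum) (auto intro!: homogeneous_sum)
qed (use graded_map_carrier[OF A] graded_map_carrier[OF B] in auto)

lemma graded_map_one: "graded_map cs cs (1\<^sub>m (length cs))"
  by (auto simp: graded_map_def)

lemma graded_map_add: "graded_map cs rs A \<Longrightarrow> graded_map cs rs B \<Longrightarrow> graded_map cs rs (A + B)"
  by (auto simp: graded_map_def intro!: homogeneous_add)

lemma graded_map_minus: "graded_map cs rs A \<Longrightarrow> graded_map cs rs B \<Longrightarrow> graded_map cs rs (A - B)"
  by (auto simp: graded_map_def intro!: homogeneous_diff)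

definition radical_mat :: "('n::finite, 'k::field) mpoly mat \<Rightarrow> bool" where
  "radical_mat N \<longleftrightarrow> (\<forall>p<dim_row N. \<forall>q<dim_col N. lookup (N $$ (p, q)) 0 = 0)"

lemma radical_mat_iff:
  assumes "N \<in> carrier_mat n (length cs)"
  shows "radical_mat N \<longleftrightarrow> (\<forall>v\<in>fvec cs. const_free (mapply N v))"
proof
  assume "radical_mat N"
  then show "\<forall>v\<in>fvec cs. const_free (mapply N v)"
    by (auto simp: const_free_def mapply_def radical_mat_def lookup_sum lookup_mult_zero)
next
  assume cf: "\<forall>v\<in>fvec cs. const_free (mapply N v)"
  show "radical_mat N"
    unfolding radical_mat_def
  proof (intro allI impI)
    fix p q assume "p < dim_row N" "q < dim_col N"
    then show "lookup (N $$ (p, q)) 0 = 0"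
      using cf[rule_format, of "unit_fun q 1"] assms
      by (auto simp: unit_fun_fvec mapply_unit_fun const_free_def dest: spec[of _ p])
  qed
qed

text \<open>
  A unipotent graded matrix \<open>1 + N\<close> is inverted by repeated squaring of \<open>N\<close>: an entry of the
  \<open>2^m\<close>-th power is nonzero only if the degrees of its column and row differ by at least \<open>2^m\<close>.
\<close>

definition deep :: "int \<Rightarrow> int list \<Rightarrow> ('n::finite, 'k::field) mpoly mat \<Rightarrow> bool" where
  "deep k cs N \<longleftrightarrow> (\<forall>p<length cs. \<forall>q<length cs. N $$ (p, q) \<noteq> 0 \<longrightarrow> k \<le> cs ! q - cs ! p)"

lemma deep_mult:
  assumes "M \<in> carrier_mat (length cs) (length cs)" "N \<in> carrier_mat (length cs) (length cs)"
    and "deep a cs M" "deep b cs N"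
  shows "deep (a + b) cs (M * N)"
  unfolding deep_def
proof (intro allI impI)
  fix p q assume pq: "p < length cs" "q < length cs" "(M * N) $$ (p, q) \<noteq> 0"
  then have "(\<Sum>r<length cs. M $$ (p, r) * N $$ (r, q)) \<noteq> 0"
    using assms(1,2) by (subst (asm) index_mult_mat_sum) auto
  then obtain r where "r < length cs" "M $$ (p, r) * N $$ (r, q) \<noteq> 0"
    by (metis (no_types, lifting) lessThan_iff sum.neutral)
  then have "a \<le> cs ! r - cs ! p" "b \<le> cs ! q - cs ! r"
    using assms(3,4) pq(1,2) unfolding deep_def by force+
  then show "a + b \<le> cs ! q - cs ! p" by simp
qed

lemma deep_radical:
  assumes "graded_map cs cs N" "radical_mat N"
  shows "deep 1 cs N"
  unfolding deep_def
proof (intro allI impI)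
  fix p q assume pq: "p < length cs" "q < length cs" "N $$ (p, q) \<noteq> 0"
  have h: "homogeneous (cs ! q - cs ! p) (N $$ (p, q))"
    using assms(1) pq by (intro graded_mapD)
  from pq(3) obtain t where t: "lookup (N $$ (p, q)) t \<noteq> 0"
    by (auto simp: poly_mapping_eq_iff fun_eq_iff)
  with assms pq have "t \<noteq> 0"
    by (auto simp: radical_mat_def graded_map_def)
  then have "mdegree t \<noteq> 0" by simp
  with homogeneousD[OF h t] show "1 \<le> cs ! q - cs ! p" by linarith
qed

lemma unipotent_right_inverse:
  assumes N: "graded_map cs cs N" "radical_mat N"
  obtains U where "graded_map cs cs U" "(1\<^sub>m (length cs) + N) * U = 1\<^sub>m (length cs)"
proof -
  let ?n = "length cs"
  note c = graded_map_carrier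
  \<comment> \<open>Squaring step: (1 - M)(1 + M) = 1 - M * M, so the approximate inverse is
    multiplied by 1 + M and the depth of the error doubles.\<close>
  have "\<exists>U M. graded_map cs cs U \<and> graded_map cs cs M \<and> (1\<^sub>m ?n + N) * U
      = 1\<^sub>m ?n - M \<and> deep (2 ^ k) cs M" for k
  proof (induction k)
    case 0
    have "deep 1 cs (0\<^sub>m ?n ?n - N)"
      using deep_radical[OF N] c[OF N(1)] by (auto simp: deep_def)
    moreover have "graded_map cs cs (0\<^sub>m ?n ?n - N)"
      using N(1) by (intro graded_map_minus) (auto simp: graded_map_def)
    moreover have "(1\<^sub>m ?n + N) * 1\<^sub>m ?n = 1\<^sub>m ?n - (0\<^sub>m ?n ?n - N)"
      using c[OF N(1)] by (auto intro!: eq_matI)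
    ultimately show ?case using graded_map_one by (metis power_0)
  next
    case (Suc k)
    then obtain U M where UM: "graded_map cs cs U" "graded_map cs cs M"
      "(1\<^sub>m ?n + N) * U = 1\<^sub>m ?n - M" "deep (2 ^ k) cs M"
      by blast
    note cc = c[OF UM(1)] c[OF UM(2)] c[OF N(1)]
    have "(1\<^sub>m ?n + N) * (U * (1\<^sub>m ?n + M)) = ((1\<^sub>m ?n + N) * U) * (1\<^sub>m ?n + M)"
      by (rule assoc_mult_mat[symmetric]) (use cc in auto)
    also have "(1\<^sub>m ?n + N) * U = 1\<^sub>m ?n - M" by (rule UM(3))
    also have "(1\<^sub>m ?n - M) * (1\<^sub>m ?n + M) = (1\<^sub>m ?n - M) * 1\<^sub>m ?n + (1\<^sub>m ?n - M) * M"
      by (rule mult_add_distrib_mat) (use cc in auto)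
    also have "(1\<^sub>m ?n - M) * M = 1\<^sub>m ?n * M - M * M"
      by (rule minus_mult_distrib_mat) (use cc in auto)
    also have "(1\<^sub>m ?n - M) * 1\<^sub>m ?n + (1\<^sub>m ?n * M - M * M) = 1\<^sub>m ?n - M * M"
      using cc by (auto intro!: eq_matI)
    finally have "(1\<^sub>m ?n + N) * (U * (1\<^sub>m ?n + M)) = 1\<^sub>m ?n - M * M" .
    moreover have "deep (2 ^ Suc k) cs (M * M)"
      using deep_mult[OF cc(2) cc(2) UM(4) UM(4)] by simp
    moreover have "graded_map cs cs (U * (1\<^sub>m ?n + M))" "graded_map cs cs (M * M)"
      by (rule graded_map_mult[OF UM(1) graded_map_add[OF graded_map_one UM(2)]],
          rule graded_map_mult[OF UM(2) UM(2)])
    ultimately show ?case by blast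
  qed
  \<comment> \<open>The exponent makes the depth exceed every difference of two degrees in
    \<open>cs\<close>, which forces the error to vanish.\<close>
  then obtain U M where UM: "graded_map cs cs U" "graded_map cs cs M"
      "(1\<^sub>m ?n + N) * U = 1\<^sub>m ?n - M" "deep (2 ^ nat (Max (set cs) - Min (set cs) + 1)) cs M"
    by blast
  have "M = 0\<^sub>m ?n ?n"
  proof (rule eq_matI)
    fix p q assume "p < dim_row (0\<^sub>m ?n ?n)" "q < dim_col (0\<^sub>m ?n ?n :: ('a, 'b) mpoly mat)"
    then have pq: "p < ?n" "q < ?n" by auto
    then have "cs ! q \<le> Max (set cs)" "Min (set cs) \<le> cs ! p" by auto
    then have "cs ! q - cs ! p < int (nat (Max (set cs) - Min (set cs) + 1))" by simp
    also have "\<dots> < 2 ^ nat (Max (set cs) - Min (set cs) + 1)"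
        by (metis less_exp of_nat_less_iff of_nat_numeral of_nat_power)
    finally show "M $$ (p, q) = 0\<^sub>m ?n ?n $$ (p, q)"
      using UM(4) pq by (force simp: deep_def)
  qed (use c[OF UM(2)] in auto)
  moreover have "1\<^sub>m ?n - 0\<^sub>m ?n ?n = (1\<^sub>m ?n :: ('a, 'b) mpoly mat)"
    by (rule eq_matI) auto
  ultimately have "(1\<^sub>m ?n + N) * U = 1\<^sub>m ?n" using UM(3) by simp
  with UM(1) show ?thesis by (rule that)
qed

text \<open>A right inverse of a unipotent graded matrix is unipotent, so it has a right inverse
  \<open>W\<close> in turn, and \<open>W\<close> equals \<open>X\<close> by associativity.\<close>

lemma unipotent_inverse:
  fixes X :: "('n::finite, 'k::field) mpoly mat"
  assumes X: "graded_map cs cs X" "radical_mat (X - 1\<^sub>m (length cs))"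
  obtains U where "graded_map cs cs U" "X * U = 1\<^sub>m (length cs)" "U * X = 1\<^sub>m (length cs)"
proof -
  let ?n = "length cs"
  have right: "\<exists>U. graded_map cs cs U \<and> X * U = 1\<^sub>m ?n \<and> radical_mat (U - 1\<^sub>m ?n)"
    if X: "graded_map cs cs X" "radical_mat (X - 1\<^sub>m ?n)" for X :: "('n, 'k) mpoly mat"
  proof -
    define N where "N = X - 1\<^sub>m ?n"
    have N: "graded_map cs cs N" "radical_mat N"
      using X graded_map_minus[OF X(1) graded_map_one] by (simp_all add: N_def)
    note c = graded_map_carrier[OF X(1)] graded_map_carrier[OF N(1)]
    have X_eq: "1\<^sub>m ?n + N = X"
      using c by (auto simp: N_def intro!: eq_matI)
    from unipotent_right_inverse[OF N] obtain U
      where U: "graded_map cs cs U" "X * U = 1\<^sub>m ?n"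
      unfolding X_eq by blast
    note cU = graded_map_carrier[OF U(1)]
    have "1\<^sub>m ?n * U + N * U = 1\<^sub>m ?n"
      using U(2) add_mult_distrib_mat[of "1\<^sub>m ?n" ?n ?n N U ?n] c cU unfolding X_eq by simp
    then have eq: "U + N * U = 1\<^sub>m ?n" using cU by simp
    have "radical_mat (U - 1\<^sub>m ?n)"
      unfolding radical_mat_def
    proof (intro allI impI)
      fix p q assume "p < dim_row (U - 1\<^sub>m ?n)" "q < dim_col (U - 1\<^sub>m ?n)"
      then have pq: "p < ?n" "q < ?n" by simp_all
      have "(U + N * U) $$ (p, q) = U $$ (p, q) + (N * U) $$ (p, q)"
        using pq cU c by (intro index_add_mat) auto
      then have "(U - 1\<^sub>m ?n) $$ (p, q) = - (N * U) $$ (p, q)"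
        using pq cU unfolding eq by (simp add: algebra_simps del: index_mult_mat)
      moreover have "lookup ((N * U) $$ (p, q)) 0 = 0"
        using N(2) pq c cU
        by (subst index_mult_mat_sum) (auto simp: lookup_sum lookup_mult_zero radical_mat_def)
      ultimately show "lookup ((U - 1\<^sub>m ?n) $$ (p, q)) 0 = 0" by simp
    qed
    with U show ?thesis by blast
  qed
  from right[OF X] obtain U where U: "graded_map cs cs U" "X * U = 1\<^sub>m ?n" "radical_mat (U - 1\<^sub>m ?n)"
    by blast
  from right[OF U(1,3)] obtain W where W: "graded_map cs cs W" "U * W = 1\<^sub>m ?n" by blast
  note c = graded_map_carrier[OF X(1)] graded_map_carrier[OF U(1)] graded_map_carrier[OF W(1)]
  have "W = (X * U) * W" using c U(2) by simp
  also have "\<dots> = X * (U * W)" using c by simp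
  also have "\<dots> = X" using c W(2) by simp
  finally show ?thesis using that U W by simp
qed

section \<open>Comparison of minimal covers\<close>

definition graded_iso :: "int list \<Rightarrow> int list \<Rightarrow> ('n::finite, 'k::field) mpoly mat
  \<Rightarrow> ('n, 'k) mpoly mat \<Rightarrow> bool" where
  "graded_iso cs cs' A B \<longleftrightarrow> graded_map cs cs' A \<and> graded_map cs' cs B \<and>
     A * B = 1\<^sub>m (length cs') \<and> B * A = 1\<^sub>m (length cs)"

lemma graded_iso_sym: "graded_iso cs cs' A B \<Longrightarrow> graded_iso cs' cs B A"
  by (auto simp: graded_iso_def)

lemma graded_iso_mapply:
  assumes "graded_iso cs cs' A B" "v \<in> fvec cs"
  shows "mapply B (mapply A v) = v"
proof -
  have "dim_col B = dim_row A"
    using assms graded_map_carrier[of cs cs' A] graded_map_carrier[of cs' cs B]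
        by (auto simp: graded_iso_def)
  then have "mapply B (mapply A v) = mapply (B * A) v" by (rule mapply_mult[symmetric])
  with assms show ?thesis by (simp add: graded_iso_def mapply_one)
qed

text \<open>Free modules are projective: the images of the unit vectors are lifted one by one, in
  their degrees.\<close>

lemma mat_lift:
  assumes P: "graded_map cs rs P" and M: "graded_map cs' rs M"
    and im: "\<And>v. v \<in> fvec cs' \<Longrightarrow> mapply M v \<in> im_map cs P"
  obtains C where "graded_map cs' cs C" "P * C = M"
proof -
  note cP = graded_map_carrier[OF P] and cM = graded_map_carrier[OF M]
  have "\<exists>u. u \<in> gvec cs (cs' ! q) \<and> mapply P u = mapply M (unit_fun q 1)" if q: "q < length cs'"
      for q
  proof -
    have "unit_fun q 1 \<in> gvec cs' (cs' ! q)"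
      using q by (auto simp: unit_fun_def gvec_def fvec_def)
    then have "mapply M (unit_fun q 1) \<in> gvec rs (cs' ! q)" by (rule mapply_gvec[OF M])
    with im_map_lift[OF P im[of "unit_fun q 1"]] q show ?thesis
      by (metis unit_fun_fvec)
  qed
  then obtain u where u: "\<And>q. q < length cs' \<Longrightarrow> u q \<in> gvec cs (cs' ! q)"
    "\<And>q. q < length cs' \<Longrightarrow> mapply P (u q) = mapply M (unit_fun q 1)"
    by metis
  define C where "C = mat (length cs) (length cs') (\<lambda>(p, q). u q p)"
  have "graded_map cs' cs C"
    using u(1) by (auto simp: graded_map_def C_def gvec_def)
  moreover have "P * C = M"
  proof (rule eq_matI)
    fix p q assume "p < dim_row M" "q < dim_col M"
    then have pq: "p < length rs" "q < length cs'" using cM by auto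
    have "(P * C) $$ (p, q) = mapply P (u q) p"
      using pq cP by (subst index_mult_mat_sum) (auto simp: C_def mapply_def intro!: sum.cong)
    also have "\<dots> = M $$ (p, q)"
      unfolding u(2)[OF pq(2)] using pq cM by (simp add: mapply_unit_fun)
    finally show "(P * C) $$ (p, q) = M $$ (p, q)" .
  qed (use cP cM in \<open>auto simp: C_def\<close>)
  ultimately show ?thesis by (rule that)
qed

text \<open>\<open>S\<close> and \<open>T\<close> lift to maps \<open>C\<close> and \<open>D\<close>
  of the covers. \<open>D * C\<close> moves a vector only by an element of the kernel, which has no
  constant coefficients, so it is unipotent and invertible; likewise \<open>C * D\<close>.\<close>

lemma graded_iso_lift:
  fixes P P' :: "('n::finite, 'k::field) mpoly mat"
  assumes P: "graded_map cs rs P" and P': "graded_map cs' rs' P'" and ST: "graded_iso rs rs' S T"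
    and im: "mapply S ` im_map cs P = im_map cs' P'"
    and min: "\<forall>v\<in>ker_map cs P. const_free v" and min': "\<forall>v\<in>ker_map cs' P'. const_free v"
  obtains A B where "graded_iso cs cs' A B" "mapply A ` ker_map cs P = ker_map cs' P'"
proof -
  have S: "graded_map rs rs' S" and T: "graded_map rs' rs T" and TS: "T * S = 1\<^sub>m (length rs)"
    using ST by (auto simp: graded_iso_def)
  have lift: "\<exists>C. graded_map cs cs' C \<and> (\<forall>v. mapply P' (mapply C v) = mapply S (mapply P v))"
    if P: "graded_map cs rs P" and P': "graded_map cs' rs' P'" and S: "graded_map rs rs' S"
      and sub: "mapply S ` im_map cs P \<subseteq> im_map cs' P'"
          for cs cs' rs rs' P P' and S :: "('n, 'k) mpoly mat"
  proof -
    have dim: "dim_col S = dim_row P"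
      using P S by (auto simp: graded_map_def)
    have "mapply (S * P) v \<in> im_map cs' P'" if "v \<in> fvec cs" for v
      using sub that by (auto simp: mapply_mult[OF dim] im_map_def)
    then obtain C where C: "graded_map cs cs' C" "P' * C = S * P"
      using mat_lift[OF P' graded_map_mult[OF S P]] by blast
    have "dim_col P' = dim_row C"
      using P' C(1) by (auto simp: graded_map_def)
    then have "mapply P' (mapply C v) = mapply S (mapply P v)" for v
      using mapply_mult[of P' C v] mapply_mult[OF dim, of v] C(2) by simp
    with C(1) show ?thesis by blast
  qed
  from lift[OF P P' S] im obtain C where C: "graded_map cs cs' C"
    "\<And>v. mapply P' (mapply C v) = mapply S (mapply P v)" by auto
  have "im_map cs P \<subseteq> fvec rs" using mapply_fvec[OF P] by (auto simp: im_map_def)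
  then have "mapply T ` im_map cs' P' = im_map cs P"
    unfolding im[symmetric] image_image using graded_iso_mapply[OF ST] by (simp add: subset_iff)
  with lift[OF P' P T] obtain D where D: "graded_map cs' cs D"
    "\<And>v. mapply P (mapply D v) = mapply T (mapply P' v)" by auto
  have unip: "radical_mat (Y * X - 1\<^sub>m (length cs))"
    if X: "graded_map cs cs' X" and Y: "graded_map cs' cs Y" and P: "graded_map cs rs P"
      and min: "\<forall>v\<in>ker_map cs P. const_free v"
      and eq: "\<And>v. v \<in> fvec cs \<Longrightarrow> mapply P (mapply Y (mapply X v)) = mapply P v"
    for cs cs' rs P and X Y :: "('n, 'k) mpoly mat"
  proof -
    have YX: "graded_map cs cs (Y * X - 1\<^sub>m (length cs))"
      by (intro graded_map_minus graded_map_mult[OF Y X] graded_map_one)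
    have dim: "dim_col Y = dim_row X" "dim_row Y = length cs" "dim_col X = length cs"
      using X Y by (auto simp: graded_map_def)
    have "const_free (mapply (Y * X - 1\<^sub>m (length cs)) v)" if v: "v \<in> fvec cs" for v
    proof -
      have "mapply (Y * X - 1\<^sub>m (length cs)) v = mapply (Y * X) v - mapply (1\<^sub>m (length cs)) v"
        by (simp add: mapply_def fun_eq_iff dim algebra_simps sum_subtractf del: index_mult_mat(1)
            index_one_mat(1))
      then have e: "mapply (Y * X - 1\<^sub>m (length cs)) v = mapply Y (mapply X v) - v"
        using v by (simp add: mapply_mult[OF dim(1)] mapply_one)
      have "mapply Y (mapply X v) \<in> fvec cs" by (rule mapply_fvec[OF Y])
      then have "mapply Y (mapply X v) - v \<in> ker_map cs P"
        using v pv.subspace_diff[OF subspace_fvec] by (simp add: ker_map_def mapply_diff eq)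
      with min show ?thesis unfolding e by blast
    qed
    then show ?thesis
      using radical_mat_iff[OF graded_map_carrier[OF YX]] by blast
  qed
  have "mapply P (mapply D (mapply C v)) = mapply P v" if "v \<in> fvec cs" for v
    unfolding D(2) C(2) using graded_iso_mapply[OF ST] mapply_fvec[OF P] by simp
  then have "radical_mat (D * C - 1\<^sub>m (length cs))"
    by (rule unip[OF C(1) D(1) P min])
  from unipotent_inverse[OF graded_map_mult[OF D(1) C(1)] this] obtain U
    where U: "graded_map cs cs U" "U * (D * C) = 1\<^sub>m (length cs)" by blast
  have "mapply P' (mapply C (mapply D v)) = mapply P' v" if "v \<in> fvec cs'" for v
    unfolding D(2) C(2) using graded_iso_mapply[OF graded_iso_sym[OF ST]] mapply_fvec[OF P'] by simp
  then have "radical_mat (C * D - 1\<^sub>m (length cs'))"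
    by (rule unip[OF D(1) C(1) P' min'])
  from unipotent_inverse[OF graded_map_mult[OF C(1) D(1)] this] obtain U'
    where U': "graded_map cs' cs' U'" "(C * D) * U' = 1\<^sub>m (length cs')" by blast
  note c = graded_map_carrier[OF C(1)] graded_map_carrier[OF D(1)] graded_map_carrier[OF U(1)]
    graded_map_carrier[OF U'(1)]
  define B where "B = D * U'"
  have B: "graded_map cs' cs B" unfolding B_def by (rule graded_map_mult[OF D(1) U'(1)])
  note cB = graded_map_carrier[OF B]
  have CB: "C * B = 1\<^sub>m (length cs')"
    unfolding B_def using U'(2) assoc_mult_mat[OF c(1,2,4)] by simp
  have UDC: "(U * D) * C = 1\<^sub>m (length cs)"
    using U(2) assoc_mult_mat[OF c(3,2,1)] by simp
  \<comment> \<open>\<open>C\<close> has the left inverse \<open>U * D\<close> and the right inverse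
    \<open>B\<close>, and these must coincide.\<close>
  have "U * D = (U * D) * (C * B)" using c CB by simp
  also have "\<dots> = ((U * D) * C) * B" by (rule assoc_mult_mat[symmetric]) (use c cB in auto)
  also have "\<dots> = B" using cB by (simp add: UDC)
  finally have BC: "B * C = 1\<^sub>m (length cs)" using UDC by simp
  have iso: "graded_iso cs cs' C B"
    using C(1) B CB BC by (simp add: graded_iso_def)
  moreover have "mapply C ` ker_map cs P = ker_map cs' P'"
  proof (intro subset_antisym subsetI)
    fix x assume "x \<in> mapply C ` ker_map cs P"
    then show "x \<in> ker_map cs' P'"
      using C(2) mapply_fvec[OF C(1)] by (auto simp: ker_map_def)
  next
    fix x assume x: "x \<in> ker_map cs' P'"
    define y where "y = mapply B x"
    have Cy: "mapply C y = x"
      using x graded_iso_mapply[OF graded_iso_sym[OF iso]] by (simp add: y_def ker_map_def)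
    have "mapply S (mapply P y) = 0"
      using x unfolding C(2)[symmetric] Cy by (simp add: ker_map_def)
    then have "mapply P y = 0"
      using graded_iso_mapply[OF ST mapply_fvec[OF P, of y]] by simp
    then have "y \<in> ker_map cs P"
      using mapply_fvec[OF B] by (simp add: ker_map_def y_def)
    with Cy show "x \<in> mapply C ` ker_map cs P" by blast
  qed
  ultimately show ?thesis by (rule that)
qed

text \<open>Both families are padded with zeros to square matrices of size \<open>card I\<close>. If
  \<open>J\<close> were smaller, \<open>B * A = 1\<close> would give \<open>A * B = 1\<close>,
  although row \<open>m\<close> of \<open>A\<close> is zero.\<close>

lemma card_le_left_inverse:
  fixes a b :: "nat \<Rightarrow> nat \<Rightarrow> 'a::field"
  assumes fin: "finite I" "finite J"
    and inv: "\<And>p q. p \<in> I \<Longrightarrow> q \<in> I \<Longrightarrow> (\<Sum>r\<in>J. b p r * a r q) = (if p = q then 1 else 0)"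
  shows "card I \<le> card J"
proof (rule ccontr)
  assume less: "\<not> card I \<le> card J"
  define n m where "n = card I" and "m = card J"
  obtain f where f: "bij_betw f {..<n} I"
    using ex_bij_betw_nat_finite[OF fin(1)] by (auto simp: n_def atLeast0LessThan)
  obtain g where g: "bij_betw g {..<m} J"
    using ex_bij_betw_nat_finite[OF fin(2)] by (auto simp: m_def atLeast0LessThan)
  have mn: "m < n" using less by (simp add: n_def m_def)
  define B where "B = mat n n (\<lambda>(p, r). if r < m then b (f p) (g r) else 0)"
  define A where "A = mat n n (\<lambda>(r, q). if r < m then a (g r) (f q) else 0)"
  have AB: "A \<in> carrier_mat n n" "B \<in> carrier_mat n n" by (simp_all add: A_def B_def)
  have "B * A = 1\<^sub>m n"
  proof (rule eq_matI)
    fix p q assume "p < dim_row (1\<^sub>m n :: 'a mat)" "q < dim_col (1\<^sub>m n :: 'a mat)"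
    then have pq: "p < n" "q < n" by auto
    have "(B * A) $$ (p, q) = (\<Sum>r<n. if r < m then b (f p) (g r) * a (g r) (f q) else 0)"
      using pq by (subst index_mult_mat_sum) (auto simp: A_def B_def intro!: sum.cong)
    also have "\<dots> = (\<Sum>r<m. b (f p) (g r) * a (g r) (f q))"
      using mn by (intro sum.mono_neutral_cong_right) auto
    also have "\<dots> = (\<Sum>r\<in>J. b (f p) r * a r (f q))"
      by (rule sum.reindex_bij_betw[OF g])
    also have "\<dots> = (if f p = f q then 1 else 0)"
      using pq f by (intro inv) (auto simp: bij_betw_def)
    also have "f p = f q \<longleftrightarrow> p = q"
      using pq f by (auto simp: bij_betw_def inj_on_def)
    finally show "(B * A) $$ (p, q) = 1\<^sub>m n $$ (p, q)" using pq by simp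
  qed (simp_all add: A_def B_def)
  then have "A * B = 1\<^sub>m n" by (rule mat_mult_left_right_inverse[OF AB(2,1)])
  then have "(A * B) $$ (m, m) = 1" using mn by simp
  moreover have "(A * B) $$ (m, m) = 0"
    using mn by (subst index_mult_mat_sum) (auto simp: A_def B_def)
  ultimately show False by simp
qed

lemma count_list_card: "count_list xs y = card {i. i < length xs \<and> xs ! i = y}"
  by (simp add: count_list_eq_length_filter length_filter_conv_card eq_commute[of y])

text \<open>Modulo the variables an entry survives only between basis elements of equal degree, so
  the blocks of degree \<open>j\<close> alone satisfy the equation for a left inverse.\<close>

lemma graded_iso_count_le:
  assumes "graded_iso cs cs' A B"
  shows "count_list cs j \<le> count_list cs' j"
proof -
  have A: "graded_map cs cs' A" and B: "graded_map cs' cs B" and BA: "B * A = 1\<^sub>m (length cs)"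
    using assms by (auto simp: graded_iso_def)
  define I where "I = {i. i < length cs \<and> cs ! i = j}"
  define J where "J = {i. i < length cs' \<and> cs' ! i = j}"
  have "card I \<le> card J"
  proof (rule card_le_left_inverse)
    fix p q assume p: "p \<in> I" and q: "q \<in> I"
    have "lookup ((B * A) $$ (p, q)) 0 = (if p = q then 1 else 0)"
      using p q unfolding BA by (auto simp: I_def)
    also have "(B * A) $$ (p, q) = (\<Sum>r<length cs'. B $$ (p, r) * A $$ (r, q))"
      using p q graded_map_carrier[OF A] graded_map_carrier[OF B]
      by (subst index_mult_mat_sum) (auto simp: I_def)
    also have "lookup \<dots> 0
        = (\<Sum>r<length cs'. lookup (B $$ (p, r)) 0 * lookup (A $$ (r, q)) 0)"
      by (simp add: lookup_sum lookup_mult_zero)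
    also have "\<dots> = (\<Sum>r\<in>J. lookup (B $$ (p, r)) 0 * lookup (A $$ (r, q)) 0)"
    proof (rule sum.mono_neutral_right)
      have "lookup (A $$ (r, q)) 0 = 0" if "r < length cs'" "r \<notin> J" for r
      proof (rule ccontr)
        assume n: "lookup (A $$ (r, q)) 0 \<noteq> 0"
        have "homogeneous (cs ! q - cs' ! r) (A $$ (r, q))"
          using q that by (intro graded_mapD[OF A]) (auto simp: I_def)
        from homogeneousD[OF this n] q that show False by (simp add: I_def J_def)
      qed
      then show "\<forall>r\<in>{..<length cs'} - J. lookup (B $$ (p, r)) 0 * lookup (A $$ (r, q)) 0 = 0"
        by simp
    qed (auto simp: J_def)
    finally show "(\<Sum>r\<in>J. lookup (B $$ (p, r)) 0 * lookup (A $$ (r, q)) 0)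
        = (if p = q then 1 else 0)" .
  qed (auto simp: I_def J_def)
  then show ?thesis by (simp add: count_list_card I_def J_def)
qed

lemma min_res_unique:
  fixes V :: "('n::finite, 'k::field) pvec set"
  assumes F: "min_res V F \<phi>" and G: "min_res V G \<psi>"
  shows "count_list (F i) j = count_list (G i) j"
proof -
  have step: "\<exists>A B. graded_iso (F i) (G i) A B \<and> mapply A ` ker_map (F i) (\<phi> i)
      = ker_map (G i) (\<psi> i)"
    if "graded_iso (target F i) (target G i) S T"
      "mapply S ` im_map (F i) (\<phi> i) = im_map (G i) (\<psi> i)" for i S T
  proof -
    have "graded_map (F i) (target F i) (\<phi> i)" "graded_map (G i) (target G i) (\<psi> i)"
      "\<forall>v\<in>ker_map (F i) (\<phi> i). const_free v" "\<forall>v\<in>ker_map (G i) (\<psi> i). const_free v"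
      using F G by (auto simp: min_res_def)
    from graded_iso_lift[OF this(1,2) that this(3,4)] obtain A B
      where "graded_iso (F i) (G i) A B" "mapply A ` ker_map (F i) (\<phi> i) = ker_map (G i) (\<psi> i)" .
    then show ?thesis by (intro exI conjI)
  qed
  have "\<exists>A B. graded_iso (F i) (G i) A B \<and> mapply A ` ker_map (F i) (\<phi> i) = ker_map (G i) (\<psi> i)"
  proof (induction i)
    case 0
    have "mapply (1\<^sub>m (length [0 :: int])) ` V = V"
    proof -
      have "graded_map (F 0) (target F 0) (\<phi> 0)" "im_map (F 0) (\<phi> 0) = V"
        using F by (simp_all add: min_res_def)
      then have "V \<subseteq> fvec [0]"
        using mapply_fvec[of "F 0" "[0]" "\<phi> 0"] by (auto simp: target_def im_map_def)
      then have "mapply (1\<^sub>m (length [0 :: int])) v = v" if "v \<in> V" for v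
        using that by (intro mapply_one) auto
      then show ?thesis by (auto simp: image_iff)
    qed
    then have "mapply (1\<^sub>m (length [0 :: int])) ` im_map (F 0) (\<phi> 0) = im_map (G 0) (\<psi> 0)"
      using F G unfolding min_res_def by simp
    moreover have "graded_iso (target F 0) (target G 0) (1\<^sub>m (length [0 :: int])) (1\<^sub>m (length [0 ::
        int]))"
      using graded_map_one[of "[0]"] by (simp add: graded_iso_def target_def)
    ultimately show ?case by (intro step)
  next
    case (Suc i)
    then obtain A B where "graded_iso (F i) (G i) A B" "mapply A ` ker_map (F i) (\<phi> i)
        = ker_map (G i) (\<psi> i)"
      by blast
    then show ?case using F G by (intro step[of _ A B]) (auto simp: min_res_def target_def)
  qed
  then obtain A B :: "('n, 'k) mpoly mat" where iso: "graded_iso (F i) (G i) A B" by blast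
  show ?thesis
    using graded_iso_count_le[OF iso] graded_iso_count_le[OF graded_iso_sym[OF iso]]
        by (rule antisym)
qed

section \<open>Betti numbers and regularity\<close>

definition vec_fun :: "'a::zero vec \<Rightarrow> nat \<Rightarrow> 'a" where
  "vec_fun v = (\<lambda>q. if q < dim_vec v then v $ q else 0)"

definition vec_set :: "int list \<Rightarrow> (nat \<Rightarrow> 'a::zero) set \<Rightarrow> 'a vec set" where
  "vec_set cs W = {v \<in> carrier_vec (length cs). vec_fun v \<in> W}"

lemma vec_fun_vec: "f \<in> fvec cs \<Longrightarrow> vec_fun (vec (length cs) f) = f"
  by (auto simp: vec_fun_def fvec_def)

lemma vec_fun_fvec: "v \<in> carrier_vec (length cs) \<Longrightarrow> vec_fun v \<in> fvec cs"
  by (auto simp: vec_fun_def fvec_def)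

lemma vec_set_inj:
  assumes "W \<subseteq> fvec cs" "W' \<subseteq> fvec cs"
  shows "vec_set cs W = vec_set cs W' \<longleftrightarrow> W = W'"
proof -
  have "W = {f \<in> fvec cs. vec (length cs) f \<in> vec_set cs W}" if "W \<subseteq> fvec cs"
      for W :: "(nat \<Rightarrow> 'a) set"
    using that by (auto simp: vec_set_def vec_fun_vec)
  then show ?thesis using assms by metis
qed

lemma mapply_vec_fun:
  assumes "v \<in> carrier_vec (dim_col A)" shows "mapply A (vec_fun v) = vec_fun (A *\<^sub>v v)"
  using assms by (auto simp: mapply_def vec_fun_def fun_eq_iff scalar_prod_def atLeast0LessThan
      intro!: sum.cong)

lemma vec_fun_inj: "v \<in> carrier_vec n \<Longrightarrow> w \<in> carrier_vec n \<Longrightarrow> vec_fun v = vec_fun w \<longleftrightarrow> v = w"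
  by (auto simp: vec_fun_def fun_eq_iff intro!: eq_vecI split: if_splits)

lemma mat_image_vec_set:
  assumes "graded_map cs rs A"
  shows "mat_image A = vec_set rs (im_map cs A)"
proof -
  have c: "A \<in> carrier_mat (length rs) (length cs)" using assms by (rule graded_map_carrier)
  show ?thesis
  proof (intro subset_antisym subsetI)
    fix x assume "x \<in> mat_image A"
    then obtain v where "x = A *\<^sub>v v" "v \<in> carrier_vec (length cs)"
      using c by (auto simp: mat_image_def)
    then show "x \<in> vec_set rs (im_map cs A)"
      using c mapply_vec_fun[of v A] vec_fun_fvec[of v cs]
      by (auto simp: vec_set_def im_map_def intro!: image_eqI[of _ _ "vec_fun v"])
  next
    fix x assume "x \<in> vec_set rs (im_map cs A)"
    then obtain f where f: "x \<in> carrier_vec (length rs)" "vec_fun x = mapply A f" "f \<in> fvec cs"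
      by (auto simp: vec_set_def im_map_def)
    have "mapply A f = vec_fun (A *\<^sub>v vec (length cs) f)"
      using f(3) mapply_vec_fun[of "vec (length cs) f" A] c by (simp add: vec_fun_vec)
    then have "x = A *\<^sub>v vec (length cs) f"
      using f(1,2) c vec_fun_inj[of x "length rs" "A *\<^sub>v vec (length cs) f"] by auto
    then show "x \<in> mat_image A" using c by (auto simp: mat_image_def)
  qed
qed

lemma mat_kernel_vec_set:
  assumes "graded_map cs rs A"
  shows "mat_kernel A = vec_set cs (ker_map cs A)"
proof -
  have c: "A \<in> carrier_mat (length rs) (length cs)" using assms by (rule graded_map_carrier)
  have "A *\<^sub>v v = 0\<^sub>v (length rs) \<longleftrightarrow> mapply A (vec_fun v) = 0" if "v \<in> carrier_vec (length cs)" for v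
  proof -
    have "vec_fun (0\<^sub>v (length rs)) = (0 :: nat \<Rightarrow> ('a, 'b) mpoly)"
      by (auto simp: vec_fun_def)
    then show ?thesis
      using that c mapply_vec_fun[of v A] vec_fun_inj[of "A *\<^sub>v v" "length rs" "0\<^sub>v (length rs)"]
          by auto
  qed
  then show ?thesis
    using c vec_fun_fvec[of _ cs] by (auto simp: mat_kernel[OF c] vec_set_def ker_map_def)
qed

lemma ideal_vec_set: "{vec 1 (\<lambda>_. f) | f. f \<in> I} = vec_set [0] (ideal_vec I)"
proof (intro subset_antisym subsetI)
  fix x assume "x \<in> {vec 1 (\<lambda>_. f) | f. f \<in> I}"
  then obtain f where "x = vec 1 (\<lambda>_. f)" "f \<in> I" by blast
  then show "x \<in> vec_set [0] (ideal_vec I)"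
    by (simp add: vec_set_def ideal_vec_def fvec_def vec_fun_def)
next
  fix x assume "x \<in> vec_set [0] (ideal_vec I)"
  then have x: "x \<in> carrier_vec 1" "vec_fun x 0 \<in> I"
    by (auto simp: vec_set_def ideal_vec_def)
  then have "x = vec 1 (\<lambda>_. vec_fun x 0)"
    by (intro eq_vecI) (auto simp: vec_fun_def)
  with x(2) show "x \<in> {vec 1 (\<lambda>_. f) | f. f \<in> I}" by blast
qed

lemma radical_mat_elements:
  "radical_mat A \<longleftrightarrow> elements_mat A \<subseteq> ideal_of (Set.range mvar)"
proof -
  have "elements_mat A = {A $$ (p, q) | p q. p < dim_row A \<and> q < dim_col A}"
    by (auto simp: elements_mat_def) blast
  then show ?thesis unfolding ideal_of_range_mvar radical_mat_def by blast
qed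

lemma minimal_resolution_iff:
  "minimal_graded_free_resolution I F \<phi> \<longleftrightarrow> min_res (ideal_vec I) F \<phi>"
proof -
  have gm: "(graded_map (F 0) [0] (\<phi> 0) \<and> (\<forall>i. graded_map (F (Suc i)) (F i) (\<phi> (Suc i))))
      \<longleftrightarrow> (\<forall>i. graded_map (F i) (target F i) (\<phi> i))" (is "?L \<longleftrightarrow> ?R")
  proof
    assume ?L
    then show ?R by (auto simp: target_def split: nat.split)
  next
    assume R: ?R
    show ?L using R[rule_format, of 0] R[rule_format, of "Suc _"] by (simp add: target_def)
  qed
  show ?thesis
  proof (cases "\<forall>i. graded_map (F i) (target F i) (\<phi> i)")
    case False
    then show ?thesis
      using gm by (auto simp: minimal_graded_free_resolution_def graded_free_resolution_def
          min_res_def)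
  next
    case True
    note g = True[rule_format]
    have ts: "target F (Suc i) = F i" "target F 0 = [0]" for i by (simp_all add: target_def)
    have 1: "mat_image (\<phi> 0) = {vec 1 (\<lambda>_. f) | f. f \<in> I} \<longleftrightarrow> im_map (F 0) (\<phi> 0) = ideal_vec I"
      unfolding ideal_vec_set mat_image_vec_set[OF g] ts
      by (rule vec_set_inj) (use mapply_fvec[OF g[of 0]] in \<open>auto simp: im_map_def ideal_vec_def
          ts\<close>)
    have 2: "mat_kernel (\<phi> i) = mat_image (\<phi> (Suc i)) \<longleftrightarrow> ker_map (F i) (\<phi> i)
        = im_map (F (Suc i)) (\<phi> (Suc i))" for i
      unfolding mat_kernel_vec_set[OF g] mat_image_vec_set[OF g] ts
      by (rule vec_set_inj) (use mapply_fvec[OF g[of "Suc i"]] in \<open>auto simp: im_map_def ker_map_def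
          ts\<close>)
    \<comment> \<open>The entries have no constant coefficients iff the values of the map have none;
      by exactness these values form the kernel of the preceding map.\<close>
    have 3: "elements_mat (\<phi> (Suc i)) \<subseteq> ideal_of (Set.range mvar)
        \<longleftrightarrow> (\<forall>v\<in>im_map (F (Suc i)) (\<phi> (Suc i)). const_free v)" for i
      unfolding radical_mat_elements[symmetric]
      by (subst radical_mat_iff[OF graded_map_carrier[OF g]]) (auto simp: im_map_def)
    show ?thesis
      unfolding minimal_graded_free_resolution_def graded_free_resolution_def min_res_def 1 2 3
      using gm True by auto
  qed
qed

lemma betti_eq:
  assumes "min_res (ideal_vec I) F \<phi>"
  shows "betti I i j = count_list (F i) j"
  unfolding betti_def minimal_resolution_iff
proof (rule the_equality)
  show "\<exists>F' \<phi>'. min_res (ideal_vec I) F' \<phi>' \<and> count_list (F i) j = count_list (F' i) j"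
    using assms by blast
next
  fix b assume "\<exists>F' \<phi>'. min_res (ideal_vec I) F' \<phi>' \<and> b = count_list (F' i) j"
  then show "b = count_list (F i) j"
    using min_res_unique[OF assms] by metis
qed

text \<open>Betti numbers are nonzero exactly where \<open>pvanish\<close> fails. Homogeneous
  polynomials of negative degree are zero, so nothing occurs for \<open>j < int p\<close>; with the
  upper bound this makes the set of differences finite and its \<open>Max\<close>
  meaningful.\<close>

lemma reg_monideal:
  fixes L :: "('n::finite \<Rightarrow>\<^sub>0 nat) set"
  assumes L: "upset L"
    and van: "\<And>p j. j - int p > R \<Longrightarrow> pvanish TYPE('k::field) L p j"
    and nonvan: "j0 - int p0 = R" "\<not> pvanish TYPE('k) L p0 j0"
  shows "reg (monideal L :: ('n, 'k) mpoly set) = R"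
proof -
  define V where "V = ideal_vec (monideal L :: ('n, 'k) mpoly set)"
  have "graded_submodule [0] V"
    unfolding graded_submodule_def
  proof (intro conjI ballI allI)
    have id: "is_ideal (monideal L :: ('n, 'k) mpoly set)" by (rule is_ideal_monideal[OF L])
    show "pv.subspace V"
      using poly_ideal.subspace_add[OF id] poly_ideal.subspace_scale[OF id]
      by (auto simp: pv.subspace_def V_def ideal_vec_def fvec_def vscale_apply)
    show "V \<subseteq> fvec [0]" by (auto simp: V_def ideal_vec_def)
    fix v d assume "v \<in> V"
    then show "vcomp [0] d v \<in> V"
      by (auto simp: V_def ideal_vec_def vcomp_def fvec_def mem_monideal_iff lookup_hcomp)
  qed
  moreover have "kvanish [0] V p j" if "j - int p > R" for p j
    unfolding V_def kvanish_ideal_vec by (rule van[OF that])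
  ultimately obtain F \<phi> where res: "min_res V F \<phi>"
    using min_res_exists by blast
  have betti: "betti (monideal L :: ('n, 'k) mpoly set) i j \<noteq> 0 \<longleftrightarrow> \<not> pvanish TYPE('k) L i j" for i j
    using min_res_degrees[OF res, of j i] betti_eq[OF res[unfolded V_def], of i j]
    by (simp add: count_list_0_iff V_def kvanish_ideal_vec)
  have low: "pvanish TYPE('k) L p j" if "j < int p" for p j
    unfolding pvanish_def
  proof (intro ballI impI)
    fix z :: "'n set \<Rightarrow> ('n, 'k) mpoly"
    assume "z \<in> pchains L p j"
    then have "z S = 0" for S
      using that homogeneous_neg[of "j - int p" "z S"] by (auto simp: pchains_def)
    then show "\<exists>y\<in>pchains L (Suc p) j. koszul_d mvar y = z"
      by (intro bexI[of _ "\<lambda>S. 0"]) (auto simp: pchains_def fun_eq_iff)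
  qed
  let ?B = "{j - int i | i j. betti (monideal L :: ('n, 'k) mpoly set) i j \<noteq> 0}"
  have "?B \<subseteq> {0..R}"
    unfolding betti using van low by (auto simp: not_less[symmetric])
  then have "finite ?B" by (rule finite_subset) simp
  moreover have "R \<in> ?B"
    unfolding betti using nonvan by blast
  moreover have "y \<le> R" if "y \<in> ?B" for y
    using \<open>?B \<subseteq> {0..R}\<close> that by (meson atLeastAtMost_iff subsetD)
  ultimately show ?thesis
    unfolding reg_def by (intro Max_eqI)
qed

section \<open>Monomial ideals of dimension at most one\<close>

lemma diff_ind_insert:
  assumes "insert l T \<subseteq> vars_of c" "l \<notin> T"
  shows "c - ind (insert l T) + expo l = c - ind T"
proof -
  have "0 < lookup c l" using assms by (auto simp: in_keys_iff)
  then show ?thesis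
    using assms by (intro poly_mapping_eqI) (auto simp: lookup_add lookup_minus lookup_single
        when_def)
qed

lemma not_upset_diff_ind:
  assumes "upset M" "insert l T \<subseteq> vars_of c" "l \<notin> T" "c - ind T \<notin> M"
  shows "c - ind (insert l T) \<notin> M"
  using diff_ind_insert[OF assms(2,3)] upsetD(1)[OF assms(1)] assms(4) by metis

definition top_chain :: "'n::finite set \<Rightarrow> 'n set \<Rightarrow> 'k::field" where
  "top_chain W S = of_bool (S = W)"

lemma koszul_d_top_chain:
  assumes "l \<in> W"
  shows "koszul_d x (top_chain W) (W - {l}) = ksgn l (W - {l}) * x l"
proof -
  have "koszul_d x (top_chain W) (W - {l})
      = (\<Sum>i\<in>-(W - {l}). if i = l then ksgn i (W - {l}) * x i else 0)"
    unfolding koszul_d_def using assms by (intro sum.cong) (auto simp: top_chain_def)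
  then show ?thesis by simp
qed

lemma koszul_d_top_chain_eq_0:
  assumes "\<And>l. l \<in> W \<Longrightarrow> S \<noteq> W - {l}"
  shows "koszul_d x (top_chain W) S = 0"
proof -
  have "insert i S \<noteq> W" if "i \<notin> S" for i
    using assms[of i] that by auto
  then have "koszul_d x (top_chain W) S = koszul_d x (\<lambda>S. 0) S"
    by (intro koszul_d_cong) (simp add: top_chain_def)
  then show ?thesis by simp
qed

lemma koszul_d_mchains:
  assumes "z \<in> mchains UNIV (Suc p) c" shows "koszul_d (on_vars c) z \<in> mchains UNIV p c"
  unfolding mchains_def
proof (intro CollectI allI impI)
  fix S assume n: "koszul_d (on_vars c) z S \<noteq> 0"
  then obtain i where "z (insert i S) \<noteq> 0"
    unfolding koszul_d_def by (auto elim!: sum.not_neutral_contains_not_neutral)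
  then have "S \<subseteq> vars_of c" using assms by (auto simp: mchains_def)
  moreover have "card S = p"
    using n koszul_d_card[of p z S] assms by (auto simp: mchains_def)
  ultimately show "S \<subseteq> vars_of c \<and> card S = p \<and> c - ind S \<in> UNIV" by simp
qed

lemma mchains_diff:
  assumes "y \<in> mchains UNIV p c" "z \<in> mchains UNIV p c"
  shows "(\<lambda>S. y S - z S) \<in> mchains UNIV p c"
  unfolding mchains_def
proof (intro CollectI allI impI)
  fix S assume "y S - z S \<noteq> 0"
  then have "y S \<noteq> 0 \<or> z S \<noteq> 0" by auto
  then show "S \<subseteq> vars_of c \<and> card S = p \<and> c - ind S \<in> UNIV"
    using assms by (auto simp: mchains_def)
qed

lemma mchains_restrict:
  assumes "z \<in> mchains UNIV p c"
    and "\<And>S. S \<subseteq> vars_of c \<Longrightarrow> card S = p \<Longrightarrow> c - ind S \<notin> L \<Longrightarrow> z S = 0"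
  shows "z \<in> mchains L p c"
  using assms unfolding mchains_def by blast

text \<open>The boundary of the wedge of \<open>W\<close> carries the monomials
  \<open>b + expo l\<close>, all in \<open>L\<close>. A preimage in \<open>L\<close> could only sit
  on \<open>W\<close>, whose monomial \<open>b\<close> is outside \<open>L\<close>; for this
  \<open>W\<close> must contain all variables of the multidegree.\<close>

lemma socle_nonvanish:
  fixes b :: "'n::finite \<Rightarrow>\<^sub>0 nat"
  assumes b: "b \<notin> L" "\<And>l. l \<in> W \<Longrightarrow> b + expo l \<in> L" and W: "vars_of b \<subseteq> W" "W \<noteq> {}"
  shows "\<not> mvanish TYPE('k::field) L (card W - 1) (b + ind W)"
proof
  assume van: "mvanish TYPE('k) L (card W - 1) (b + ind W)"
  let ?c = "b + ind W"
  have vars: "vars_of ?c = W"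
    using W(1) unfolding subset_eq in_keys_iff by (auto simp: in_keys_iff lookup_add)
  have cW: "?c - ind W = b" by simp
  have card: "Suc (card W - 1) = card W" using W(2) by (simp add: card_gt_0_iff)
  define E :: "'n set \<Rightarrow> 'k" where "E = top_chain W"
  define \<zeta> where "\<zeta> = koszul_d (on_vars ?c) E"
  have E: "E \<in> mchains UNIV (Suc (card W - 1)) ?c"
    unfolding card by (auto simp: E_def mchains_def top_chain_def vars)
  have val: "\<zeta> (W - {l}) \<noteq> 0" if "l \<in> W" for l
    using that koszul_d_top_chain[OF that, of "on_vars ?c :: _ \<Rightarrow> 'k"]
        by (simp add: \<zeta>_def E_def on_vars_def vars)
  have "\<zeta> \<in> mchains L (card W - 1) ?c"
  proof (rule mchains_restrict)
    show "\<zeta> \<in> mchains UNIV (card W - 1) ?c" unfolding \<zeta>_def by (rule koszul_d_mchains[OF E])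
    fix S assume "?c - ind S \<notin> L"
    have "S \<noteq> W - {l}" if l: "l \<in> W" for l
    proof
      assume S: "S = W - {l}"
      then have "?c - ind S = b + expo l"
        using diff_ind_insert[of l S ?c] l by (simp add: vars insert_absorb cW)
      with b(2)[OF l] \<open>?c - ind S \<notin> L\<close> show False by simp
    qed
    then show "\<zeta> S = 0" unfolding \<zeta>_def E_def by (rule koszul_d_top_chain_eq_0)
  qed
  moreover have "koszul_d (on_vars ?c) \<zeta> = (\<lambda>S. 0)"
    by (simp add: \<zeta>_def koszul_d_koszul_d fun_eq_iff)
  ultimately obtain \<eta> where \<eta>: "\<eta> \<in> mchains L (card W) ?c" "koszul_d (on_vars ?c) \<eta> = \<zeta>"
    using van card unfolding mvanish_def by metis
  have "\<eta> S = 0" for S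
  proof (rule ccontr)
    assume "\<eta> S \<noteq> 0"
    then have "S \<subseteq> W" "card S = card W" "?c - ind S \<in> L"
      using \<eta>(1) by (auto simp: mchains_def vars)
    then have "S = W" by (simp add: card_subset_eq)
    with \<open>?c - ind S \<in> L\<close> b(1) show False by (simp add: cW)
  qed
  then have "\<eta> = (\<lambda>S. 0)" by auto
  then have "\<zeta> S = 0" for S using \<eta>(2) by auto
  with val W(2) show False by blast
qed

text \<open>
  For a monomial ideal \<open>L\<close> of dimension at most one, \<open>Q i\<close> is its primary component at the prime
  generated by the variables other than \<open>i\<close>. The three bounds on degrees concern the local
  cohomology of the quotient in degree zero, in degree one at nonnegative multidegrees, and in
  degree one at the remaining multidegrees.
\<close>

locale line_components =
  fixes L :: "('n::finite \<Rightarrow>\<^sub>0 nat) set" and Q :: "'n \<Rightarrow> ('n \<Rightarrow>\<^sub>0 nat) set" and R :: nat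
  assumes card2: "2 \<le> CARD('n)"
    and upL: "upset L" and upQ: "\<And>i. upset (Q i)" and LQ: "\<And>i. L \<subseteq> Q i"
    and sat: "\<And>i b. b + expo i \<in> Q i \<Longrightarrow> b \<in> Q i"
    and deg_L: "\<And>b. b \<notin> L \<Longrightarrow> R < mdegree b \<Longrightarrow> \<exists>i. b \<notin> Q i"
    and deg_QQ: "\<And>i j b. i \<noteq> j \<Longrightarrow> b \<notin> Q i \<Longrightarrow> b \<notin> Q j \<Longrightarrow> mdegree b < R"
    and deg_Q: "\<And>i b. b \<notin> Q i \<Longrightarrow> lookup b i = 0 \<Longrightarrow> mdegree b \<le> R"
begin

text \<open>Over the whole ring the cycle bounds some \<open>y\<close>, which has to be moved into
  \<open>L\<close> by a boundary. A set whose monomial is outside \<open>L\<close> has it outside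
  exactly one \<open>Q j\<close>. So the part of \<open>y\<close> outside each \<open>Q i\<close> is
  contracted along \<open>i\<close>, and the boundaries of these contractions are
  subtracted.\<close>

lemma mvanish_above:
  assumes deg: "p + R + 2 \<le> mdegree c"
  shows "mvanish TYPE('k::field) L p c"
  unfolding mvanish_def
proof (intro ballI impI)
  fix \<zeta> :: "'n set \<Rightarrow> 'k"
  assume \<zeta>: "\<zeta> \<in> mchains L p c" and cyc: "koszul_d (on_vars c) \<zeta> = (\<lambda>S. 0)"
  let ?d = "koszul_d (on_vars c) :: _ \<Rightarrow> _ \<Rightarrow> 'k"
  have "\<zeta> \<in> mchains UNIV p c" using \<zeta> by (auto simp: mchains_def)
  moreover have "mvanish TYPE('k) UNIV p c" using deg by (intro mvanish_UNIV) auto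
  ultimately obtain y where y: "y \<in> mchains UNIV (Suc p) c" "?d y = \<zeta>"
    using cyc unfolding mvanish_def by blast
  define yi where "yi i S = (if c - ind S \<notin> Q i then y S else 0)" for i S
  \<comment> \<open>A set of size p + 1 leaves degree at least R + 1. A set of size p + 2 may leave
    only R, where the strictness of \<open>deg_QQ\<close> is used.\<close>
  have degS: "R < mdegree (c - ind S)" if "S \<subseteq> vars_of c" "card S = Suc p" for S
    using mdegree_diff_ind[OF that(1)] that(2) deg by simp
  have yi_chain: "yi i \<in> mchains UNIV (Suc p) c" for i
    using y(1) by (auto simp: mchains_def yi_def)
  \<comment> \<open>Contraction along \<open>i\<close> requires x_i in the multidegree. Where it is
    missing, a nonzero value would belong to a monomial free of x_i in a degree that
    \<open>deg_Q\<close> rules out.\<close>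
  have yi_0: "yi i S = 0" if "i \<notin> vars_of c" for i S
  proof (rule ccontr)
    assume "yi i S \<noteq> 0"
    then have S: "S \<subseteq> vars_of c" "card S = Suc p" "c - ind S \<notin> Q i"
      using y(1) by (auto simp: mchains_def yi_def split: if_splits)
    moreover have "lookup (c - ind S) i = 0"
      using that by (simp add: in_keys_iff lookup_minus)
    ultimately show False using deg_Q[of "c - ind S" i] degS[of S] by simp
  qed
  define Y where "Y S = (\<Sum>i\<in>UNIV. koszul_h i (yi i) S)" for S
  have hchain: "koszul_h i (yi i) \<in> mchains UNIV (Suc (Suc p)) c" for i
  proof (cases "i \<in> vars_of c")
    case True
    then show ?thesis by (rule koszul_h_mchains[OF yi_chain]) simp
  next
    case False
    then show ?thesis by (simp add: mchains_def koszul_h_def yi_0)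
  qed
  have "Y \<in> mchains UNIV (Suc (Suc p)) c"
    unfolding mchains_def
  proof (intro CollectI allI impI)
    fix S assume "Y S \<noteq> 0"
    then obtain i where "koszul_h i (yi i) S \<noteq> 0" unfolding Y_def
        by (meson sum.not_neutral_contains_not_neutral)
    with hchain[of i] show "S \<subseteq> vars_of c \<and> card S = Suc (Suc p) \<and> c - ind S \<in> UNIV"
      unfolding mchains_def by blast
  qed
  from koszul_d_mchains[OF this] have dY: "?d Y \<in> mchains UNIV (Suc p) c" .
  define \<eta> where "\<eta> S = y S - ?d Y S" for S
  have "\<eta> S = 0" if S: "S \<subseteq> vars_of c" "card S = Suc p" "c - ind S \<notin> L" for S
  proof -
    obtain j where j: "c - ind S \<notin> Q j" using deg_L[OF S(3) degS[OF S(1,2)]] by blast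
    have other: "c - ind S \<in> Q i" if "i \<noteq> j" for i
      using deg_QQ[OF that _ j] degS[OF S(1,2)] by force
    \<comment> \<open>With this the homotopy formula leaves only the boundary of the contraction,
      which then agrees with \<open>yi i\<close> at \<open>S\<close>.\<close>
    have hd: "koszul_h i (?d (yi i)) S = 0" for i
    proof (cases "i \<in> S")
      case True
      define T where "T = S - {i}"
      have T: "S = insert i T" "i \<notin> T" using True by (auto simp: T_def)
      have "?d (yi i) T = 0"
      proof (cases "i = j")
        case True
        \<comment> \<open>The monomial of \<open>T\<close> is that of \<open>S\<close> times x_i,
          hence outside \<open>Q i\<close> by saturation. So are its quotients by further variables,
          where \<open>yi i\<close> agrees with \<open>y\<close>.\<close>
        have "c - ind T \<notin> Q i"
          using j sat[of "c - ind S" i] diff_ind_insert[of i T c] S(1) T True by auto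
        have "on_vars c l * yi i (insert l T) = on_vars c l * y (insert l T)" if "l \<notin> T" for l
          using not_upset_diff_ind[OF upQ _ that \<open>c - ind T \<notin> Q i\<close>] S(1) T(1)
          by (auto simp: on_vars_def yi_def)
        then have "?d (yi i) T = ?d y T" by (rule koszul_d_cong)
        also have "\<dots> = 0"
          using y(2) \<zeta> LQ[of i] \<open>c - ind T \<notin> Q i\<close> by (auto simp: mchains_def)
        finally show ?thesis .
      next
        case False
        \<comment> \<open>A nonzero term would put the monomial of \<open>insert l S\<close> outside
          both \<open>Q i\<close> and \<open>Q j\<close>, in degree at least
          \<open>R\<close>.\<close>
        have "on_vars c l * yi i (insert l T) = on_vars c l * 0" if l: "l \<notin> T" for l
        proof (rule ccontr)
          assume "on_vars c l * yi i (insert l T) \<noteq> on_vars c l * 0"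
          then have lv: "l \<in> vars_of c" and lQ: "c - ind (insert l T) \<notin> Q i"
            by (auto simp: on_vars_def yi_def split: if_splits)
          have "l \<noteq> i" using lQ other[OF False] T(1) by auto
          have Sl: "insert l S \<subseteq> vars_of c" "l \<notin> S" using lv S(1) l \<open>l \<noteq> i\<close> T by auto
          have "c - ind (insert l S) \<notin> Q j"
            by (rule not_upset_diff_ind[OF upQ Sl j])
          moreover have "c - ind (insert i (insert l T)) \<notin> Q i"
            using Sl(1) T \<open>l \<noteq> i\<close> by (intro not_upset_diff_ind[OF upQ _ _ lQ]) auto
          moreover have "insert i (insert l T) = insert l S" using T by auto
          ultimately have "mdegree (c - ind (insert l S)) < R"
            using deg_QQ[OF False] by simp
          moreover have "card (insert l S) = p + 2" using Sl(2) S(2) by simp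
          ultimately show False using mdegree_diff_ind[OF Sl(1)] deg by simp
        qed
        then have "?d (yi i) T = ?d (\<lambda>S. 0) T" by (rule koszul_d_cong)
        then show ?thesis by simp
      qed
      with True show ?thesis by (simp add: koszul_h_def T_def)
    qed (simp add: koszul_h_def)
    have "?d (koszul_h i (yi i)) S = yi i S" for i
    proof (cases "i \<in> vars_of c")
      case True
      then have "?d (koszul_h i (yi i)) S + koszul_h i (?d (yi i)) S = yi i S"
        by (intro koszul_homotopy) (simp add: on_vars_def)
      with hd show ?thesis by simp
    next
      case False
      then have "koszul_h i (yi i) = (\<lambda>S. 0)" by (simp add: koszul_h_def yi_0 fun_eq_iff)
      then show ?thesis using yi_0[OF False] by simp
    qed
    then have "?d Y S = (\<Sum>i\<in>UNIV. yi i S)"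
      unfolding Y_def koszul_d_sum by simp
    also have "\<dots> = (\<Sum>i\<in>UNIV. if i = j then y S else 0)"
      by (rule sum.cong) (use j other in \<open>auto simp: yi_def\<close>)
    finally show ?thesis by (simp add: \<eta>_def)
  qed
  moreover have "\<eta> \<in> mchains UNIV (Suc p) c"
    unfolding \<eta>_def by (rule mchains_diff[OF y(1) dY])
  ultimately have "\<eta> \<in> mchains L (Suc p) c" using mchains_restrict[of \<eta> "Suc p" c L] by blast
  moreover have "?d \<eta> = \<zeta>"
    by (simp add: \<eta>_def[abs_def] koszul_d_diff koszul_d_koszul_d y(2) fun_eq_iff)
  ultimately show "\<exists>\<eta>\<in>mchains L (Suc p) c. ?d \<eta> = \<zeta>" by blast
qed

text \<open>Let \<open>y\<close> be the part outside \<open>Q i\<close> of the boundary of the top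
  chain. Its own boundary lies in \<open>L\<close>. A preimage \<open>\<eta>\<close> in
  \<open>L\<close> differs from \<open>y\<close> by a multiple \<open>a\<close> of the boundary of
  the top chain; comparing at the complements of \<open>i\<close> and of \<open>j\<close> gives a =
  1 and a = 0.\<close>

lemma nonvanish_pair:
  assumes ij: "i \<noteq> j" and b: "b \<notin> Q i" "b \<notin> Q j" "mdegree b + 1 = R"
  shows "\<not> mvanish TYPE('k::field) L (CARD('n) - 2) (b + ind UNIV)"
proof
  assume van: "mvanish TYPE('k) L (CARD('n) - 2) (b + ind UNIV)"
  let ?c = "b + ind UNIV" and ?n = "CARD('n)"
  let ?d = "koszul_d (on_vars ?c) :: _ \<Rightarrow> _ \<Rightarrow> 'k"
  have vars: "vars_of ?c = UNIV" by (auto simp: in_keys_iff lookup_add)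
  have n: "Suc (?n - 2) = ?n - 1" "Suc (?n - 1) = ?n" using card2 by auto
  define E :: "'n set \<Rightarrow> 'k" where "E = top_chain UNIV"
  have E: "E \<in> mchains UNIV (Suc (?n - 1)) ?c"
    unfolding n by (auto simp: E_def mchains_def top_chain_def vars)
  define y where "y S = (if ?c - ind S \<notin> Q i then ?d E S else 0)" for S
  have y: "y \<in> mchains UNIV (Suc (?n - 2)) ?c"
    using koszul_d_mchains[OF E] unfolding n by (auto simp: mchains_def y_def)
  have degS: "mdegree (?c - ind S) + card S = mdegree b + ?n" for S
    using mdegree_diff_ind[of S ?c] vars by (simp add: mdegree_add)
  have "?d y \<in> mchains L (?n - 2) ?c"
  proof (rule mchains_restrict[OF koszul_d_mchains[OF y]])
    fix S assume S: "card S = ?n - 2" "?c - ind S \<notin> L"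
    have "mdegree (?c - ind S) = R + 1"
      using degS[of S] S(1) b(3) card2 by simp
    then obtain k where k: "?c - ind S \<notin> Q k" using deg_L[OF S(2)] by auto
    have k': "?c - ind (insert x S) \<notin> Q k" if "x \<notin> S" for x
      by (rule not_upset_diff_ind[OF upQ _ that k]) (simp add: vars)
    \<comment> \<open>If \<open>k = i\<close>, all monomials of the sets \<open>insert x S\<close>
      are outside \<open>Q i\<close>, so \<open>y\<close> may be replaced by \<open>?d E\<close> and
      two differentials cancel. Otherwise they all lie in \<open>Q i\<close>, where \<open>y\<close>
      vanishes.\<close>
    show "?d y S = 0"
    proof (cases "k = i")
      case True
      have "?d y S = ?d (?d E) S"
        by (rule koszul_d_cong) (use k' True in \<open>simp add: y_def\<close>)
      then show ?thesis by (simp add: koszul_d_koszul_d)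
    next
      case False
      have "y (insert x S) = 0" if "x \<notin> S" for x
      proof -
        have "mdegree (?c - ind (insert x S)) = R"
          using degS[of "insert x S"] that S(1) b(3) card2 by simp
        then have "?c - ind (insert x S) \<in> Q i"
          using deg_QQ[OF False k'[OF that]] by force
        then show ?thesis by (simp add: y_def)
      qed
      then have "?d y S = ?d (\<lambda>S. 0) S" by (intro koszul_d_cong) simp
      then show ?thesis by simp
    qed
  qed
  moreover have "?d (?d y) = (\<lambda>S. 0)" by (simp add: koszul_d_koszul_d fun_eq_iff)
  ultimately obtain \<eta> where \<eta>: "\<eta> \<in> mchains L (?n - 1) ?c" "?d \<eta> = ?d y"
    using van unfolding mvanish_def n by blast
  define \<xi> where "\<xi> S = y S - \<eta> S" for S
  have "\<xi> \<in> mchains UNIV (?n - 1) ?c"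
    unfolding \<xi>_def using y \<eta>(1) unfolding n
    by (intro mchains_diff) (auto simp: mchains_def)
  moreover have "?d \<xi> = (\<lambda>S. 0)"
    by (simp add: \<xi>_def[abs_def] koszul_d_diff \<eta>(2) fun_eq_iff)
  moreover have "mvanish TYPE('k) UNIV (?n - 1) ?c" using card2 by (intro mvanish_UNIV) auto
  ultimately obtain \<theta> where \<theta>: "\<theta> \<in> mchains UNIV ?n ?c" "?d \<theta> = \<xi>"
    unfolding mvanish_def n by blast
  define a where "a = \<theta> UNIV"
  have "\<theta> S = a * E S" for S
  proof (cases "S = UNIV")
    case False
    then have "card S \<noteq> ?n" using card_subset_eq[of UNIV S] by auto
    then show ?thesis using \<theta>(1) False by (auto simp: mchains_def E_def top_chain_def)
  qed (simp add: a_def E_def top_chain_def)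
  then have "\<theta> = (\<lambda>S. a * E S)" by auto
  then have \<xi>: "\<xi> S = a * ?d E S" for S
    using \<theta>(2) koszul_d_mult[of "on_vars ?c" a E S] by simp
  have dE: "?d E (UNIV - {l}) \<noteq> 0" for l
    using koszul_d_top_chain[of l UNIV "on_vars ?c :: _ \<Rightarrow> 'k"] by (simp add: E_def on_vars_def vars)
  have cl: "?c - ind (UNIV - {l}) = b + expo l" for l
    using diff_ind_insert[of l "UNIV - {l}" ?c] by (simp add: vars insert_absorb)
  \<comment> \<open>The monomial at the complement of \<open>l\<close> is \<open>b + expo l\<close>,
    which saturation keeps outside \<open>Q l\<close> and hence outside \<open>L\<close>.\<close>
  have \<eta>0: "\<eta> (UNIV - {l}) = 0" if "b \<notin> Q l" for l
  proof (rule ccontr)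
    assume "\<eta> (UNIV - {l}) \<noteq> 0"
    then have "?c - ind (UNIV - {l}) \<in> L" using \<eta>(1) unfolding mchains_def by blast
    then show False using that sat LQ unfolding cl by blast
  qed
  have "y (UNIV - {i}) = ?d E (UNIV - {i})"
    using b(1) sat by (auto simp: y_def cl)
  then have "a = 1" using \<xi>[of "UNIV - {i}"] \<eta>0[OF b(1)] dE[of i] by (simp add: \<xi>_def)
  have "b + expo j \<notin> Q j" using b(2) sat by blast
  moreover have "mdegree (b + expo j) = R" using b(3) by (simp add: mdegree_add)
  ultimately have "b + expo j \<in> Q i" using deg_QQ[OF ij] by force
  then have "y (UNIV - {j}) = 0" by (simp add: y_def cl)
  then have "a = 0" using \<xi>[of "UNIV - {j}"] \<eta>0[OF b(2)] dE[of j] by (simp add: \<xi>_def)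
  with \<open>a = 1\<close> show False by simp
qed

lemma reg_eq:
  assumes low: "(\<exists>b. b \<notin> L \<and> (\<forall>l. b + expo l \<in> L) \<and> mdegree b = R) \<or>
    (\<exists>i b. b \<notin> Q i \<and> lookup b i = 0 \<and> mdegree b = R) \<or>
    (\<exists>i j b. i \<noteq> j \<and> b \<notin> Q i \<and> b \<notin> Q j \<and> mdegree b + 1 = R)"
  shows "reg (monideal L :: ('n, 'k::field) mpoly set) = int R + 1"
proof -
  \<comment> \<open>With n variables the cycles have homological degrees n - 1, n - 2, n - 2 and
    total degrees R + n, R + n - 1, R + n - 1, so the difference is R + 1 each time.\<close>
  have "\<exists>p c. int (mdegree c) - int p = int R + 1 \<and> \<not> mvanish TYPE('k) L p c"
    using low
  proof (elim disjE exE conjE)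
    fix b assume "b \<notin> L" "\<forall>l. b + expo l \<in> L" "mdegree b = R"
    then have "\<not> mvanish TYPE('k) L (CARD('n) - 1) (b + ind UNIV)"
      by (intro socle_nonvanish) auto
    moreover have "int (mdegree (b + ind UNIV)) - int (CARD('n) - 1) = int R + 1"
      using \<open>mdegree b = R\<close> card2 by (simp add: mdegree_add of_nat_diff)
    ultimately show ?thesis by blast
  next
    fix i b assume b: "b \<notin> Q i" "lookup b i = 0" "mdegree b = R"
    let ?W = "UNIV - {i}"
    have card: "card ?W = CARD('n) - 1" by (simp add: card_Diff_singleton)
    \<comment> \<open>Outside \<open>L\<close> this monomial of degree R + 1 would be outside some
      \<open>Q j\<close>. If j = i this contradicts \<open>deg_Q\<close>, x_i being still absent;
      otherwise \<open>b\<close> itself contradicts \<open>deg_QQ\<close>.\<close>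
    have "b + expo l \<in> L" if "l \<in> ?W" for l
    proof (rule ccontr)
      assume nL: "b + expo l \<notin> L"
      have deg: "mdegree (b + expo l) = R + 1" using b(3) by (simp add: mdegree_add)
      obtain j where j: "b + expo l \<notin> Q j" using deg_L[OF nL] deg by auto
      show False
      proof (cases "i = j")
        case True
        then show False using deg_Q[OF j] b(2) that deg by (simp add: lookup_add lookup_single)
      next
        case False
        have "b \<notin> Q j" using j upsetD(1)[OF upQ] by blast
        from deg_QQ[OF False b(1) this] b(3) show False by simp
      qed
    qed
    moreover have "b \<notin> L" using b(1) LQ by blast
    moreover have "vars_of b \<subseteq> ?W" using b(2) by (auto simp: in_keys_iff)
    moreover have "card ?W \<noteq> 0" using card card2 by simp
    then have "?W \<noteq> {}" by (metis card.empty)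
    ultimately have "\<not> mvanish TYPE('k) L (card ?W - 1) (b + ind ?W)"
      by (intro socle_nonvanish)
    moreover have "int (mdegree (b + ind ?W)) - int (card ?W - 1) = int R + 1"
      using b(3) card2 by (simp add: mdegree_add card of_nat_diff)
    ultimately show ?thesis by blast
  next
    fix i j b assume b: "i \<noteq> j" "b \<notin> Q i" "b \<notin> Q j" "mdegree b + 1 = R"
    then have "\<not> mvanish TYPE('k) L (CARD('n) - 2) (b + ind UNIV)" by (rule nonvanish_pair)
    moreover have "int (mdegree (b + ind UNIV)) - int (CARD('n) - 2) = int R + 1"
      using b(4) card2 by (simp add: mdegree_add of_nat_diff)
    ultimately show ?thesis by blast
  qed
  then obtain p c where pc: "int (mdegree c) - int p = int R + 1" "\<not> mvanish TYPE('k) L p c"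
      by blast
  show ?thesis
  proof (rule reg_monideal[OF upL])
    fix p j assume "int R + 1 < j - int p"
    then show "pvanish TYPE('k) L p j"
      unfolding pvanish_iff_mvanish by (auto intro!: mvanish_above)
  next
    show "int (mdegree c) - int p = int R + 1" by (rule pc(1))
    show "\<not> pvanish TYPE('k) L p (int (mdegree c))"
      using pc(2) by (auto simp: pvanish_iff_mvanish)
  qed
qed

end

section \<open>Powers of the edge ideal of a weighted oriented complete graph\<close>

definition expo_of :: "('n::finite \<Rightarrow> nat) \<Rightarrow> 'n \<Rightarrow>\<^sub>0 nat" where
  "expo_of f = Abs_poly_mapping f"

lemma lookup_expo_of [simp]: "lookup (expo_of f) = f"
  by (simp add: expo_of_def)

definition edge_monomials :: "('n \<times> 'n) set \<Rightarrow> ('n \<Rightarrow> nat) \<Rightarrow> ('n \<Rightarrow>\<^sub>0 nat) set" where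
  "edge_monomials E w = {expo i + single j (w j) + t | i j t. (i, j) \<in> E}"

primrec power_monomials :: "('n \<times> 'n) set \<Rightarrow> ('n \<Rightarrow> nat) \<Rightarrow> nat \<Rightarrow> ('n \<Rightarrow>\<^sub>0 nat) set" where
  "power_monomials E w 0 = UNIV"
| "power_monomials E w (Suc k) = {s + t | s t. s \<in> edge_monomials E w \<and> t \<in> power_monomials E w k}"

lemma edge_monomials_alt:
  "edge_monomials E w = {s + t | s t. s \<in> {expo i + single j (w j) | i j. (i, j) \<in> E}}"
  unfolding edge_monomials_def by auto

lemma upset_edge_monomials: "upset (edge_monomials E w)"
  unfolding edge_monomials_alt by (rule upset_generated)

lemma upset_power_monomials: "upset (power_monomials E w k)"
proof (induction k)
  case (Suc k)
  then show ?case
    using upsetD(1)[OF Suc.IH] by (auto simp: upset_def add.assoc) blast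
qed (simp add: upset_def)

lemma edge_ideal_eq:
  "edge_ideal E w = (monideal (edge_monomials E w) :: ('n::finite, 'k::field) mpoly set)"
proof -
  have "mvar i * mvar j ^ w j = single (expo i + single j (w j)) (1 :: 'k)" for i j
    unfolding mvar_power by (simp add: mvar_def mult_single)
  then have "{mvar i * mvar j ^ w j | i j. (i, j) \<in> E}
      = (\<lambda>s. single s (1 :: 'k)) ` {expo i + single j (w j) | i j. (i, j) \<in> E}"
    by auto
  then show ?thesis
    unfolding edge_ideal_def edge_monomials_alt by (simp only: ideal_of_monomials)
qed

lemma ideal_power_eq:
  "ideal_power (edge_ideal E w) k = (monideal (power_monomials E w k) :: ('n::finite, 'k::field)
      mpoly set)"
proof (induction k)
  case 0
  then show ?case by (simp add: monideal_def)
next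
  case (Suc k)
  then show ?case
    by (simp add: edge_ideal_eq ideal_mult_monideal upset_edge_monomials upset_power_monomials)
qed

text \<open>One more edge factor raises exponents by at most \<open>M\<close>. The bound later makes
  the socle finite and yields finite irreducible decompositions.\<close>

lemma power_monomials_bounded:
  fixes E :: "('n::finite \<times> 'n) set"
  shows "\<exists>N. \<forall>b\<in>power_monomials E w k. \<exists>g\<in>power_monomials E w k.
    \<forall>i. lookup g i \<le> lookup b i \<and> lookup g i \<le> N"
proof (induction k)
  case 0
  show ?case by (intro exI[of _ 0] ballI bexI[of _ 0]) auto
next
  case (Suc k)
  then obtain N where N: "\<And>b. b \<in> power_monomials E w k \<Longrightarrow> \<exists>g\<in>power_monomials E w k.
    \<forall>i. lookup g i \<le> lookup b i \<and> lookup g i \<le> N"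
    by blast
  define M where "M = Suc (Max (Set.range w))"
  have M: "w j < M" for j by (simp add: M_def less_Suc_eq_le)
  show ?case
  proof (intro exI[of _ "M + N"] ballI)
    fix b assume "b \<in> power_monomials E w (Suc k)"
    then obtain i j s t where b: "b = expo i + single j (w j) + s + t" "(i, j) \<in> E"
      "t \<in> power_monomials E w k"
      by (auto simp: edge_monomials_def)
    from N[OF b(3)] obtain g where g: "g \<in> power_monomials E w k"
      "\<And>i. lookup g i \<le> lookup t i \<and> lookup g i \<le> N"
      by blast
    let ?e = "expo i + single j (w j)"
    have "?e \<in> edge_monomials E w"
      unfolding edge_monomials_def using b(2)
          by (intro CollectI exI[of _ i] exI[of _ j] exI[of _ 0]) simp
    then have "?e + g \<in> power_monomials E w (Suc k)" using g(1) by auto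
    moreover have "lookup (?e + g) l \<le> lookup b l \<and>
        lookup (?e + g) l \<le> M + N" for l
      using g(2)[of l] M[of j] by (auto simp: b(1) lookup_add lookup_single when_def)
    ultimately show "\<exists>g\<in>power_monomials E w (Suc k). \<forall>i. lookup g i \<le> lookup b i
        \<and> lookup g i \<le> M + N"
      by blast
  qed
qed

lemma div_add_le: "a div m + b div m \<le> (a + b) div m" for a b m :: nat
proof (cases "m = 0")
  case False
  have "m * (a div m + b div m) \<le> a + b"
    using add_mono[OF times_div_less_eq_dividend[of m a] times_div_less_eq_dividend[of m b]]
    by (simp add: distrib_left)
  then show ?thesis using False by (simp add: less_eq_div_iff_mult_less_eq mult.commute)
qed simp

lemma le_mult_div: "x \<le> m * (x div m) + (m - 1)" if "0 < m" for x m :: nat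
proof -
  have "x = m * (x div m) + x mod m" by simp
  moreover have "x mod m < m" using that by simp
  ultimately show ?thesis by linarith
qed

locale complete_graph =
  fixes E :: "('n::finite \<times> 'n) set" and w :: "'n \<Rightarrow> nat"
  assumes card2: "2 \<le> CARD('n)" and graph: "weighted_oriented_complete_graph E w"
begin

lemma irrefl_E: "(i, i) \<notin> E"
  and asym_E: "(i, j) \<in> E \<Longrightarrow> (j, i) \<notin> E"
  and w_pos: "1 \<le> w i"
  and total_E: "i \<noteq> j \<Longrightarrow> (i, j) \<in> E \<or> (j, i) \<in> E"
  using graph
  by (auto simp: weighted_oriented_complete_graph_def weighted_oriented_graph_def irrefl_def
      asym_on_def total_on_def)

lemma w_neq_0 [simp]: "w i \<noteq> 0" "0 < w i"
  using w_pos[of i] by auto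

text \<open>
  Localizing at the prime of the variables other than \<open>i\<close>, the edge ideal becomes the complete
  intersection of the powers \<open>x\<^sub>l ^ lweight i l\<close>.
\<close>

definition lweight :: "'n \<Rightarrow> 'n \<Rightarrow> nat" where
  "lweight i l = (if (i, l) \<in> E then w l else 1)"

text \<open>The order of a monomial with respect to this complete intersection: the number of
  generators that can be split off.\<close>

definition lorder :: "'n \<Rightarrow> ('n \<Rightarrow>\<^sub>0 nat) \<Rightarrow> nat" where
  "lorder i b = (\<Sum>l\<in>UNIV - {i}. lookup b l div lweight i l)"

text \<open>The \<open>k\<close>-th power of the complete intersection. The exponent of x_i does not
  enter, which makes it saturated with respect to x_i.\<close>

definition component :: "nat \<Rightarrow> 'n \<Rightarrow> ('n \<Rightarrow>\<^sub>0 nat) set" where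
  "component k i = {b. k \<le> lorder i b}"

lemma lweight_pos [simp]: "0 < lweight i l" "lweight i l \<noteq> 0"
  by (auto simp: lweight_def)

lemma lweight_le: "lweight i l \<le> w l"
  using w_pos by (simp add: lweight_def)

lemma lorder_add: "lorder i s + lorder i t \<le> lorder i (s + t)"
  unfolding lorder_def sum.distrib[symmetric] lookup_add by (rule sum_mono) (rule div_add_le)

lemma lorder_ge_1:
  assumes "l \<noteq> i" "lweight i l \<le> lookup b l"
  shows "1 \<le> lorder i b"
proof -
  have "1 \<le> lookup b l div lweight i l"
    using assms(2) by (simp add: less_eq_div_iff_mult_less_eq)
  also have "\<dots> \<le> lorder i b"
    unfolding lorder_def using assms(1) by (intro member_le_sum) auto
  finally show ?thesis .
qed

text \<open>An edge into \<open>b\<close> other than \<open>i\<close> brings x_b with its full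
  weight, which is at least the local weight. An edge \<open>(a, i)\<close> brings x_a, whose local
  weight is 1 by the orientation.\<close>

lemma lorder_edge:
  assumes "s \<in> edge_monomials E w" shows "1 \<le> lorder i s"
proof -
  obtain a b t where s: "s = expo a + single b (w b) + t" "(a, b) \<in> E"
    using assms by (auto simp: edge_monomials_def)
  show ?thesis
  proof (cases "b = i")
    case False
    then show ?thesis
      using lweight_le[of i b] by (intro lorder_ge_1[of b]) (auto simp: s(1) lookup_add)
  next
    case True
    then have "a \<noteq> i" "(i, a) \<notin> E" using s(2) irrefl_E asym_E by auto
    then show ?thesis
      by (intro lorder_ge_1[of a]) (auto simp: s(1) lookup_add lweight_def)
  qed
qed

lemma power_subset_component: "power_monomials E w k \<subseteq> component k i"
proof (induction k)
  case 0
  show ?case by (simp add: component_def)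
next
  case (Suc k)
  show ?case
  proof
    fix b assume "b \<in> power_monomials E w (Suc k)"
    then obtain s t where b: "b = s + t" "s \<in> edge_monomials E w" "t \<in> power_monomials E w k"
        by auto
    then have "1 \<le> lorder i s" "k \<le> lorder i t"
      using lorder_edge Suc.IH by (auto simp: component_def)
    with lorder_add[of i s t] show "b \<in> component (Suc k) i" by (simp add: component_def b(1))
  qed
qed

lemma upset_component: "upset (component k i)"
  using lorder_add[of i] by (auto simp: upset_def component_def intro: order_trans[OF
      trans_le_add1])

lemma lorder_single: "lorder i (b + single i N) = lorder i b"
  unfolding lorder_def by (rule sum.cong) (auto simp: lookup_add lookup_single)

lemma component_saturated: "b + single i N \<in> component k i \<longleftrightarrow> b \<in> component k i"
  by (simp add: component_def lorder_single)

lemma edge_monomial_single: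
  assumes "l \<noteq> i"
  shows "single l (lweight i l) + single i (w i) \<in> edge_monomials E w"
proof (cases "(i, l) \<in> E")
  case True
  then have "expo i + single l (w l) + 0 \<in> edge_monomials E w"
    unfolding edge_monomials_def by blast
  then show ?thesis
    by (rule upset_mono[OF upset_edge_monomials])
      (use True w_pos in \<open>auto simp: lookup_add lookup_single when_def lweight_def Suc_le_eq\<close>)
next
  case False
  then have "(l, i) \<in> E" using total_E[OF assms] by auto
  then have "expo l + single i (w i) + 0 \<in> edge_monomials E w"
    unfolding edge_monomials_def by blast
  then show ?thesis using False by (simp add: lweight_def)
qed

text \<open>Each split-off generator x_l^(lweight i l) becomes an edge monomial with
  \<open>w i\<close> further copies of x_i, and \<open>k\<close> of them are split off.\<close>

lemma component_power:
  assumes "b \<in> component k i"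
  shows "b + single i (k * w i) \<in> power_monomials E w k"
  using assms
proof (induction k arbitrary: b)
  case (Suc k)
  then have "0 < lorder i b" by (simp add: component_def)
  then obtain l where l: "l \<noteq> i" "lookup b l div lweight i l \<noteq> 0"
    unfolding lorder_def by (auto elim!: sum.not_neutral_contains_not_neutral[rotated] simp:
        neq0_conv[symmetric] simp del: neq0_conv)
  then have le: "lweight i l \<le> lookup b l" by (auto simp: div_eq_0_iff)
  let ?g = "single l (lweight i l)"
  define b' where "b' = b - ?g"
  have b: "b = ?g + b'"
    unfolding b'_def by (rule exponent_diff_add[symmetric]) (use le in \<open>auto simp: lookup_single
        when_def\<close>)
  have "lorder i b = (\<Sum>m\<in>UNIV - {i}. lookup b' m div lweight i m + (if m = l then 1 else 0))"
    unfolding lorder_def by (rule sum.cong) (auto simp: b lookup_add lookup_single)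
  also have "\<dots> = lorder i b' + 1"
    using l(1) by (simp add: sum.distrib lorder_def)
  finally have "b' \<in> component k i" using Suc.prems by (simp add: component_def)
  from Suc.IH[OF this] have "(?g + single i (w i)) + (b' + single i (k * w i))
      \<in> power_monomials E w (Suc k)"
    using edge_monomial_single[OF l(1)] by auto
  then show ?case
    by (simp add: b single_add algebra_simps)
qed simp

text \<open>Divide every exponent by its local weight. The remainders are below the weights, the
  quotients sum to at most k - 1, and each unit of a quotient costs at most the largest weight
  \<open>M\<close>.\<close>

lemma mdegree_component_le:
  assumes b: "b \<notin> component k i" and b0: "lookup b i = 0"
  shows "mdegree b \<le> r_vertex E w k i"
proof -
  define M where "M = max_weight w (out_nbhd E i)"
  have wM: "w l \<le> M" if "(i, l) \<in> E" for l
    using that by (auto simp: M_def max_weight_def out_nbhd_def intro!: Max_ge)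
  \<comment> \<open>Local weights 1 have to be covered as well; for a vertex without out-neighbours
    this is the convention on the empty maximum.\<close>
  have "1 \<le> M"
  proof (cases "out_nbhd E i = {}")
    case False
    then obtain l where "(i, l) \<in> E" by (auto simp: out_nbhd_def)
    with wM[of l] w_pos[of l] show ?thesis by simp
  qed (simp add: M_def max_weight_def)
  with wM have lM: "lweight i l \<le> M" for l
    by (simp add: lweight_def)
  have "mdegree b = (\<Sum>l\<in>UNIV - {i}. lookup b l)"
    using b0 by (simp add: mdegree_def sum.remove[of UNIV i])
  also have "\<dots> \<le> (\<Sum>l\<in>UNIV - {i}. M * (lookup b l div lweight i l) + (lweight i l - 1))"
  proof (rule sum_mono)
    fix l
    have "lookup b l \<le> lweight i l * (lookup b l div lweight i l) + (lweight i l - 1)"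
      by (rule le_mult_div) simp
    also have "lweight i l * (lookup b l div lweight i l) \<le> M * (lookup b l div lweight i l)"
      by (simp add: lM)
    finally show "lookup b l \<le> M * (lookup b l div lweight i l) + (lweight i l - 1)" by simp
  qed
  also have "\<dots> = M * lorder i b + (\<Sum>l\<in>UNIV - {i}. lweight i l - 1)"
    by (simp add: sum.distrib lorder_def sum_distrib_left)
  also have "(\<Sum>l\<in>UNIV - {i}. lweight i l - 1) = (\<Sum>l\<in>out_nbhd E i. w l - 1)"
    using irrefl_E by (intro sum.mono_neutral_cong_right) (auto simp: lweight_def out_nbhd_def)
  also have "M * lorder i b \<le> M * (k - 1)"
    using b by (intro mult_le_mono2) (simp add: component_def)
  finally show ?thesis by (simp add: r_vertex_def M_def)
qed

lemma ex_other: "\<exists>m :: 'n. m \<noteq> i"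
proof (rule ccontr)
  assume "\<nexists>m. m \<noteq> i"
  then have "(UNIV :: 'n set) = {i}" by auto
  then have "CARD('n) = card {i}" by (rule arg_cong)
  with card2 show False by simp
qed

text \<open>Take full remainders everywhere and spend the whole order k - 1 on one vertex
  \<open>m\<close> of local weight \<open>M\<close>. If \<open>i\<close> has no out-neighbours, any
  other vertex serves.\<close>

lemma mdegree_component_attained:
  assumes "1 \<le> k"
  shows "\<exists>b. b \<notin> component k i \<and> lookup b i = 0 \<and> mdegree b = r_vertex E w k i"
proof -
  define M where "M = max_weight w (out_nbhd E i)"
  obtain m where m: "m \<noteq> i" "lweight i m = M"
  proof (cases "out_nbhd E i = {}")
    case True
    with that ex_other[of i] show ?thesis
        by (auto simp: lweight_def M_def max_weight_def out_nbhd_def)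
  next
    case False
    then have "M \<in> w ` out_nbhd E i" by (simp add: M_def max_weight_def)
    then obtain x where x: "(i, x) \<in> E" "M = w x" by (auto simp: out_nbhd_def)
    then have "x \<noteq> i" using irrefl_E by auto
    with that[of x] x show ?thesis by (simp add: lweight_def)
  qed
  define f where "f l = (if l = i then 0 else (lweight i l - 1) + (if l
      = m then (k - 1) * M else 0))" for l
  have "lorder i (expo_of f) = (\<Sum>l\<in>UNIV - {i}. if l = m then k - 1 else 0)"
    unfolding lorder_def
    by (rule sum.cong) (auto simp: f_def m(2)[symmetric] div_add1_eq)
  also have "\<dots> = k - 1" using m(1) by simp
  finally have "expo_of f \<notin> component k i" using assms by (simp add: component_def)
  moreover have "mdegree (expo_of f) = r_vertex E w k i"
  proof -
    have "mdegree (expo_of f) = (\<Sum>l\<in>UNIV - {i}. (lweight i l - 1) + (if l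
        = m then (k - 1) * M else 0))"
      by (simp add: mdegree_def sum.remove[of UNIV i] f_def)
    also have "\<dots> = (\<Sum>l\<in>UNIV - {i}. lweight i l - 1) + (k - 1) * M"
      using m(1) by (simp add: sum.distrib)
    also have "(\<Sum>l\<in>UNIV - {i}. lweight i l - 1) = (\<Sum>l\<in>out_nbhd E i. w l - 1)"
      using irrefl_E by (intro sum.mono_neutral_cong_right) (auto simp: lweight_def out_nbhd_def)
    finally show ?thesis by (simp add: r_vertex_def M_def)
  qed
  ultimately show ?thesis by (intro exI[of _ "expo_of f"]) (simp add: f_def)
qed

section \<open>Largest degree of a monomial outside two components\<close>

definition common :: "'n \<Rightarrow> 'n \<Rightarrow> 'n set" where
  "common i j = out_nbhd E i \<inter> out_nbhd E j"

lemma out_closed_out: "(i, j) \<in> E \<Longrightarrow> out_nbhd E i \<inter> closed_out_nbhd E j = insert j (common i j)"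
  by (auto simp: closed_out_nbhd_def out_nbhd_def common_def)

lemma not_in_common: "i \<notin> common i j" "j \<notin> common i j"
  using irrefl_E by (auto simp: common_def out_nbhd_def)

lemma r_edge_eq:
  assumes "(i, j) \<in> E"
  shows "r_edge E w k i j = Max (insert (w j + 1) (w ` common i j)) * (k - 1)
    + ((w j - 1) + (\<Sum>x\<in>common i j. w x - 1))"
  unfolding r_edge_def out_closed_out[OF assms] common_def[symmetric]
  by (subst sum.insert) (auto simp: not_in_common)

text \<open>With \<open>p\<close> and \<open>q\<close> the contributions to the orders at
  \<open>i\<close> and \<open>j\<close>, each exponent is at most (W - 1) p + q + r, and both orders
  are at most k - 1. At \<open>i\<close> the exponent is \<open>q\<close> itself. At
  \<open>j\<close> the weight \<open>w j\<close> is charged to \<open>p\<close> alone, hence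
  \<open>w j + 1\<close> in \<open>W\<close>. At a common out-neighbour p = q, and W splits as (W -
  1) + 1. Elsewhere one of the two local weights is 1.\<close>

lemma mdegree_components_le:
  assumes ij: "(i, j) \<in> E" and bi: "b \<notin> component k i" and bj: "b \<notin> component k j"
  shows "mdegree b \<le> r_edge E w k i j"
proof -
  define W where "W = Max (insert (w j + 1) (w ` common i j))"
  have W: "w j + 1 \<le> W" "\<And>l. l \<in> common i j \<Longrightarrow> w l \<le> W"
    by (auto simp: W_def intro!: Max_ge)
  let ?x = "lookup b"
  define p where "p l = (if l = i then 0 else ?x l div lweight i l)" for l
  define q where "q l = (if l = j then 0 else ?x l div lweight j l)" for l
  define r where "r l = (if l \<in> insert j (common i j) then w l - 1 else 0)" for l
  have le: "?x l \<le> (W - 1) * p l + q l + r l" for l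
  proof -
    consider "l = i" | "l = j" | "l \<in> common i j" | "l \<noteq> i" "l \<noteq> j" "l \<notin> common i j" by blast
    then show ?thesis
    proof cases
      case 1
      then have "q l = ?x l" using asym_E[OF ij] ij irrefl_E by (auto simp: q_def lweight_def)
      then show ?thesis by simp
    next
      case 2
      then have pl: "p l = ?x l div w j" using ij irrefl_E by (auto simp: p_def lweight_def)
      have "?x l \<le> w j * p l + (w j - 1)" unfolding pl using 2 by (intro le_mult_div) simp
      also have "w j * p l \<le> (W - 1) * p l" using W(1) by (intro mult_le_mono1) simp
      finally show ?thesis using 2 by (simp add: r_def)
    next
      case 3
      then have "l \<noteq> i" "l \<noteq> j" using not_in_common by auto
      with 3 have pq: "p l = ?x l div w l" "q l = ?x l div w l"
        by (auto simp: p_def q_def lweight_def common_def out_nbhd_def)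
      have "?x l \<le> w l * p l + (w l - 1)" unfolding pq by (rule le_mult_div) simp
      also have "w l * p l \<le> W * p l" using W(2)[OF 3] by (intro mult_le_mono1)
      also have "W * p l = (W - 1) * p l + q l" using W(1) by (cases W) (auto simp: pq)
      finally show ?thesis using 3 by (simp add: r_def)
    next
      case 4
      then have "?x l = q l \<or> ?x l = p l"
        by (auto simp: p_def q_def lweight_def common_def out_nbhd_def)
      moreover have "1 \<le> W - 1" using W(1) w_pos[of j] by linarith
      then have "1 * p l \<le> (W - 1) * p l" by (rule mult_le_mono1)
      ultimately show ?thesis by linarith
    qed
  qed
  have sp: "sum p UNIV = lorder i b"
    unfolding lorder_def p_def by (simp add: sum.remove[of UNIV i])
  have sq: "sum q UNIV = lorder j b"
    unfolding lorder_def q_def by (simp add: sum.remove[of UNIV j])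
  have sr: "sum r UNIV = (w j - 1) + (\<Sum>x\<in>common i j. w x - 1)"
  proof -
    have "sum r UNIV = (\<Sum>x\<in>insert j (common i j). w x - 1)"
      unfolding r_def by (rule sum.mono_neutral_cong_right) auto
    then show ?thesis using not_in_common by simp
  qed
  have "mdegree b \<le> (\<Sum>l\<in>UNIV. (W - 1) * p l + q l + r l)"
    unfolding mdegree_def by (rule sum_mono) (rule le)
  also have "\<dots> = (W - 1) * lorder i b + lorder j b + ((w j - 1) + (\<Sum>x\<in>common i j. w x - 1))"
    by (simp add: sum.distrib sum_distrib_left[symmetric] sp sq sr)
  also have "(W - 1) * lorder i b + lorder j b \<le> (W - 1) * (k - 1) + (k - 1)"
    using bi bj by (intro add_mono mult_le_mono2) (auto simp: component_def)
  also have "(W - 1) * (k - 1) + (k - 1) = W * (k - 1)" using W(1) by (cases W) auto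
  finally show ?thesis unfolding r_edge_eq[OF ij] W_def by simp
qed

text \<open>\<open>r\<close> takes the full remainders. If W = w j + 1, x_i fills the order at
  \<open>j\<close> and x_j the order at \<open>i\<close>, at costs 1 and \<open>w j\<close> per
  unit. Otherwise a common out-neighbour of weight \<open>W\<close> fills both orders at
  once.\<close>

lemma mdegree_components_attained:
  assumes ij: "(i, j) \<in> E" and k: "1 \<le> k"
  shows "\<exists>b. b \<notin> component k i \<and> b \<notin> component k j \<and> mdegree b = r_edge E w k i j"
proof -
  define W where "W = Max (insert (w j + 1) (w ` common i j))"
  have ne: "i \<noteq> j" using ij irrefl_E by auto
  define r where "r l = (if l \<in> insert j (common i j) then w l - 1 else 0)" for l
  have sr: "sum r UNIV = (w j - 1) + (\<Sum>x\<in>common i j. w x - 1)"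
  proof -
    have "sum r UNIV = (\<Sum>x\<in>insert j (common i j). w x - 1)"
      unfolding r_def by (rule sum.mono_neutral_cong_right) auto
    then show ?thesis using not_in_common by simp
  qed
  have ri: "r l div lweight i l = 0" for l
    using ij w_pos[of l] by (auto simp: r_def lweight_def common_def out_nbhd_def)
  have rj: "r l div lweight j l = 0" if "l \<noteq> j" for l
    using that w_pos[of l] by (auto simp: r_def lweight_def common_def out_nbhd_def)
  have "W \<in> insert (w j + 1) (w ` common i j)"
    unfolding W_def by (rule Max_in) auto
  then consider "W = w j + 1" | c where "c \<in> common i j" "W = w c" by auto
  then obtain f where f: "lorder i (expo_of f) = k - 1" "lorder j (expo_of f) = k - 1"
    "sum f UNIV = W * (k - 1) + sum r UNIV"
  proof cases
    case 1
    define f where "f l = r l + (if l = i then k - 1 else 0) + (if l = j then (k - 1) * w j else 0)"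
        for l
    have lw: "lweight i j = w j" "lweight j i = 1" "r i = 0"
      using ij asym_E[OF ij] ne not_in_common by (auto simp: lweight_def r_def)
    have "lorder i (expo_of f) = (\<Sum>l\<in>UNIV - {i}. if l = j then k - 1 else 0)"
      unfolding lorder_def
      by (rule sum.cong) (use ri ri[of j, unfolded lw] lw in \<open>auto simp: f_def\<close>)
    moreover have "lorder j (expo_of f) = (\<Sum>l\<in>UNIV - {j}. if l = i then k - 1 else 0)"
      unfolding lorder_def
      by (rule sum.cong) (use rj lw in \<open>auto simp: f_def\<close>)
    moreover have "sum f UNIV = W * (k - 1) + sum r UNIV"
      using k by (cases k) (simp_all add: f_def sum.distrib 1 algebra_simps)
    ultimately show ?thesis using that[of f] ne by simp
  next
    case 2
    then have cE: "(i, c) \<in> E" "(j, c) \<in> E" by (simp_all add: common_def out_nbhd_def)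
    with irrefl_E[of c] have c: "c \<noteq> i" "c \<noteq> j" by blast+
    have lw: "lweight i c = w c" "lweight j c = w c" using cE by (simp_all add: lweight_def)
    define f where "f l = r l + (if l = c then (k - 1) * w c else 0)" for l
    have "lorder i (expo_of f) = (\<Sum>l\<in>UNIV - {i}. if l = c then k - 1 else 0)"
      unfolding lorder_def
      by (rule sum.cong) (use ri ri[of c, unfolded lw] lw in \<open>auto simp: f_def\<close>)
    moreover have "lorder j (expo_of f) = (\<Sum>l\<in>UNIV - {j}. if l = c then k - 1 else 0)"
      unfolding lorder_def
      by (rule sum.cong) (use rj rj[OF c(2), unfolded lw] lw in \<open>auto simp: f_def\<close>)
    moreover have "sum f UNIV = W * (k - 1) + sum r UNIV"
      by (simp add: f_def sum.distrib 2(2))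
    ultimately show ?thesis using that[of f] c by simp
  qed
  then have "mdegree (expo_of f) = r_edge E w k i j"
    unfolding r_edge_eq[OF ij] sr by (simp add: mdegree_def W_def)
  with f k show ?thesis by (intro exI[of _ "expo_of f"]) (simp add: component_def)
qed

end

section \<open>Irreducible components of monomial ideals\<close>

definition pure_powers :: "'n set \<Rightarrow> ('n \<Rightarrow> nat) \<Rightarrow> ('n \<Rightarrow>\<^sub>0 nat) set" where
  "pure_powers S a = {t. \<exists>i\<in>S. a i \<le> lookup t i}"

lemma upset_pure_powers: "upset (pure_powers S a)"
  by (force simp: upset_def pure_powers_def lookup_add intro: trans_le_add1)

lemma ideal_of_pure_powers:
  "ideal_of ((\<lambda>i. mvar i ^ a i) ` S) = (monideal (pure_powers S a) :: ('n::finite, 'k::field) mpoly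
      set)"
proof -
  have "(\<lambda>i. mvar i ^ a i :: ('n, 'k) mpoly) ` S
      = (\<lambda>s. single s 1) ` (\<lambda>i. single i (a i)) ` S"
    by (simp add: mvar_power image_image)
  moreover have "{s + t | s t. s \<in> (\<lambda>i. single i (a i)) ` S} = pure_powers S a"
  proof (intro subset_antisym subsetI)
    fix t assume "t \<in> pure_powers S a"
    then obtain i where i: "i \<in> S" "a i \<le> lookup t i" by (auto simp: pure_powers_def)
    then have "t = single i (a i) + (t - single i (a i))"
      by (intro exponent_diff_add[symmetric]) (auto simp: lookup_single when_def)
    with i(1) show "t \<in> {s + t | s t. s \<in> (\<lambda>i. single i (a i)) ` S}" by blast
  next
    fix t assume "t \<in> {s + t | s t. s \<in> (\<lambda>i. single i (a i)) ` S}"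
    then obtain i u where "i \<in> S" "t = single i (a i) + u" by blast
    then show "t \<in> pure_powers S a"
      unfolding pure_powers_def by (intro CollectI bexI[of _ i]) (simp_all add: lookup_add)
  qed
  ultimately show ?thesis by (simp only: ideal_of_monomials)
qed

lemma irreducible_monideal:
  assumes "irreducible_monomial_ideal (J :: ('n::finite, 'k::field) mpoly set)"
  obtains S a where "\<forall>i\<in>S. 1 \<le> a i" "J = monideal (pure_powers S a)"
  using assms unfolding irreducible_monomial_ideal_def ideal_of_pure_powers by blast

definition socle :: "('n \<Rightarrow>\<^sub>0 nat) set \<Rightarrow> ('n \<Rightarrow>\<^sub>0 nat) set" where
  "socle L = {b. b \<notin> L \<and> (\<forall>l. b + expo l \<in> L)}"

text \<open>Irredundance gives a monomial \<open>t\<close> that lies in all other components but not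
  in \<open>L\<close>, hence not in \<open>J\<close>. It divides \<open>b\<close>, the largest
  monomial outside \<open>J\<close>, so every multiple of \<open>b\<close> lies in the other
  components.\<close>

lemma full_component_imp_socle:
  fixes L :: "('n::finite \<Rightarrow>\<^sub>0 nat) set"
  assumes C: "irredundant_irreducible_decomposition (monideal L :: ('n, 'k::field) mpoly set) C"
    and J: "ideal_of (Set.range (\<lambda>i. mvar i ^ \<alpha> i)) \<in> C" and \<alpha>: "\<And>i. 1 \<le> \<alpha> i"
  shows "expo_of (\<lambda>i. \<alpha> i - 1) \<in> socle L"
proof -
  define b where "b = expo_of (\<lambda>i. \<alpha> i - 1)"
  define J :: "('n, 'k) mpoly set" where "J = monideal (pure_powers UNIV \<alpha>)"
  have JC: "J \<in> C" using J unfolding ideal_of_pure_powers J_def .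
  have inter: "\<Inter>C = monideal L" and irred: "\<Inter>(C - {J}) \<noteq> monideal L"
    and mono: "\<And>K. K \<in> C \<Longrightarrow> irreducible_monomial_ideal K"
    using C JC by (auto simp: irredundant_irreducible_decomposition_def)
  have "\<Inter>C \<subseteq> \<Inter>(C - {J})" by blast
  with irred inter obtain f where f: "f \<in> \<Inter>(C - {J})" "f \<notin> monideal L" by blast
  from f(2) obtain t where t: "t \<in> keys f" "t \<notin> L" by (auto simp: monideal_def)
  have up: "single u 1 \<in> K"
    if K: "K \<in> C" "K \<noteq> J" and u: "\<And>i. lookup t i \<le> lookup u i" for K u
  proof -
    obtain S a where S: "K = monideal (pure_powers S a)"
      using irreducible_monideal[OF mono[OF K(1)]] by blast
    have "f \<in> K" using f(1) K by blast
    then have "t \<in> pure_powers S a" using t(1) by (auto simp: S monideal_def)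
    then have "u \<in> pure_powers S a" by (rule upset_mono[OF upset_pure_powers _ u])
    then show ?thesis by (simp add: S single_mem_monideal)
  qed
  have "t \<notin> pure_powers UNIV \<alpha>"
  proof
    assume "t \<in> pure_powers UNIV \<alpha>"
    then have "single t 1 \<in> J" by (simp add: J_def single_mem_monideal)
    then have "single t 1 \<in> \<Inter>C" using up[of _ t] by blast
    with t(2) show False by (simp add: inter single_mem_monideal)
  qed
  then have "lookup t i < \<alpha> i" for i
    by (auto simp: pure_powers_def not_le)
  then have tb: "lookup t i \<le> lookup b i" for i
    using less_imp_Suc_add[of "lookup t i" "\<alpha> i"] by (auto simp: b_def)
  have "b \<notin> pure_powers UNIV \<alpha>"
    using \<alpha> by (auto simp: pure_powers_def b_def not_le Suc_le_eq)
  then have "single b 1 \<notin> J" by (simp add: J_def single_mem_monideal)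
  with JC have "single b 1 \<notin> \<Inter>C" by blast
  then have "b \<notin> L" by (simp add: inter single_mem_monideal)
  moreover have "b + expo l \<in> L" for l
  proof -
    have "b + expo l \<in> pure_powers UNIV \<alpha>"
      using \<alpha>[of l] by (auto simp: pure_powers_def b_def lookup_add intro!: exI[of _ l])
    then have "single (b + expo l) 1 \<in> J" by (simp add: J_def single_mem_monideal)
    moreover have "single (b + expo l) 1 \<in> K" if "K \<in> C" "K \<noteq> J" for K
      using tb by (intro up[OF that]) (simp add: lookup_add trans_le_add1)
    ultimately have "single (b + expo l) 1 \<in> \<Inter>C" by blast
    then show ?thesis by (simp add: inter single_mem_monideal)
  qed
  ultimately show ?thesis by (simp add: socle_def b_def)
qed

text \<open>A form of finite generation: the generators have exponents at most \<open>N\<close>, so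
  membership in an upset depends only on the exponents cut off at \<open>N\<close>.\<close>

definition bounded_monomials :: "nat \<Rightarrow> ('n \<Rightarrow>\<^sub>0 nat) set \<Rightarrow> bool" where
  "bounded_monomials N L \<longleftrightarrow> (\<forall>b\<in>L. \<exists>g\<in>L. \<forall>i.
     lookup g i \<le> lookup b i \<and> lookup g i \<le> N)"

lemma bounded_monomials_mono:
  assumes "bounded_monomials N L" "upset L" "b \<in> L"
    and "\<And>i. min (lookup b i) N \<le> lookup t i"
  shows "t \<in> L"
proof -
  obtain g where "g \<in> L" "\<And>i. lookup g i \<le> min (lookup b i) N"
    using assms(1,3) unfolding bounded_monomials_def by (meson min.boundedI)
  with assms(4) show ?thesis by (meson upset_mono[OF assms(2)] order_trans)
qed

lemma finite_socle:
  fixes L :: "('n::finite \<Rightarrow>\<^sub>0 nat) set"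
  assumes "bounded_monomials N L" "upset L"
  shows "finite (socle L)"
proof (rule finite_subset)
  show "socle L \<subseteq> {b. mdegree b \<le> CARD('n) * N}"
  proof
    fix b assume b: "b \<in> socle L"
    have "lookup b i \<le> N" for i
    proof (rule ccontr)
      assume n: "\<not> lookup b i \<le> N"
      have "b \<in> L"
        by (rule bounded_monomials_mono[OF assms, of "b + expo i"])
          (use b n in \<open>auto simp: socle_def lookup_add lookup_single when_def\<close>)
      with b show False by (simp add: socle_def)
    qed
    then show "b \<in> {b. mdegree b \<le> CARD('n) * N}"
      using sum_bounded_above[of UNIV "lookup b" N] by (simp add: mdegree_def)
  qed
qed (rule finite_mdegree_le)

text \<open>Each monomial of the box with side \<open>N\<close> outside \<open>L\<close> yields an
  irreducible ideal containing \<open>L\<close>, and together they intersect in \<open>L\<close>; a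
  smallest subfamily with this intersection is irredundant. Some member misses \<open>b\<close> but
  contains all \<open>b + expo l\<close>, and this determines it.\<close>

lemma socle_imp_full_component:
  fixes L :: "('n::finite \<Rightarrow>\<^sub>0 nat) set"
  assumes bd: "bounded_monomials N L" and up: "upset L" and b: "b \<in> socle L"
  shows "\<exists>C. irredundant_irreducible_decomposition (monideal L :: ('n, 'k::field) mpoly set) C \<and>
    ideal_of (Set.range (\<lambda>i. mvar i ^ (lookup b i + 1))) \<in> C"
proof -
  \<comment> \<open>An exponent equal to \<open>N\<close> stands for infinity: its variable gets no
    generator.\<close>
  define K :: "('n \<Rightarrow>\<^sub>0 nat) \<Rightarrow> ('n, 'k) mpoly set"
    where "K \<beta> = monideal (pure_powers {i. lookup \<beta> i < N} (\<lambda>i. lookup \<beta> i + 1))" for \<beta>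
  define T where "T = {\<beta>. \<beta> \<notin> L \<and> (\<forall>i. lookup \<beta> i \<le> N)}"
  have "T \<subseteq> {\<beta>. mdegree \<beta> \<le> CARD('n) * N}"
    using sum_bounded_above[of UNIV "lookup _" N] by (auto simp: T_def mdegree_def)
  then have "finite T" by (rule finite_subset) (rule finite_mdegree_le)
  have KL: "monideal L \<subseteq> K \<beta>" if \<beta>: "\<beta> \<in> T" for \<beta>
  proof -
    have "t \<in> pure_powers {i. lookup \<beta> i < N} (\<lambda>i. lookup \<beta> i + 1)" if "t \<in> L" for t
    proof (rule ccontr)
      assume n: "t \<notin> pure_powers {i. lookup \<beta> i < N} (\<lambda>i. lookup \<beta> i + 1)"
      have "min (lookup t i) N \<le> lookup \<beta> i" for i
        using n \<beta> by (cases "lookup \<beta> i < N") (auto simp: pure_powers_def T_def not_le)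
      from bounded_monomials_mono[OF bd up that this] \<beta> show False by (simp add: T_def)
    qed
    then show ?thesis by (auto simp: K_def monideal_def)
  qed
  have "\<Inter>(K ` T) = monideal L"
  proof (intro subset_antisym subsetI)
    fix f assume f: "f \<in> \<Inter>(K ` T)"
    show "f \<in> monideal L"
      unfolding monideal_def
    proof (intro CollectI subsetI, rule ccontr)
      fix t assume t: "t \<in> keys f" "t \<notin> L"
      define \<beta> where "\<beta> = expo_of (\<lambda>i. min (lookup t i) N)"
      have "\<beta> \<notin> L"
      proof
        assume "\<beta> \<in> L"
        then have "t \<in> L" by (rule upset_mono[OF up]) (simp add: \<beta>_def)
        with t(2) show False ..
      qed
      then have "\<beta> \<in> T" by (simp add: T_def \<beta>_def)
      with f t(1) have "t \<in> pure_powers {i. lookup \<beta> i < N} (\<lambda>i. lookup \<beta> i + 1)"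
        by (auto simp: K_def monideal_def)
      then show False by (auto simp: pure_powers_def \<beta>_def min_def split: if_splits)
    qed
  qed (use KL in blast)
  then have "K ` T \<subseteq> K ` T \<and> \<Inter>(K ` T) = monideal L" by simp
  from ex_has_least_nat[of "\<lambda>C. C \<subseteq> K ` T \<and> \<Inter>C = monideal L", OF this, of card]
  obtain C where C: "C \<subseteq> K ` T" "\<Inter>C = monideal L"
    and min: "\<And>D. D \<subseteq> K ` T \<Longrightarrow> \<Inter>D = monideal L \<Longrightarrow> card C \<le> card D"
    by auto
  have "finite C" using C(1) \<open>finite T\<close> finite_subset by blast
  have irr: "irreducible_monomial_ideal (K \<beta>)" for \<beta>
    unfolding irreducible_monomial_ideal_def K_def ideal_of_pure_powers
    by (intro exI[of _ "{i. lookup \<beta> i < N}"] exI[of _ "\<lambda>i. lookup \<beta> i + 1"]) simp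
  have "irredundant_irreducible_decomposition (monideal L) C"
    unfolding irredundant_irreducible_decomposition_def
  proof (intro conjI ballI)
    fix Q assume Q: "Q \<in> C"
    show "irreducible_monomial_ideal Q" using Q C(1) irr by blast
    show "\<Inter>(C - {Q}) \<noteq> monideal L"
    proof
      assume "\<Inter>(C - {Q}) = monideal L"
      with C(1) have "card C \<le> card (C - {Q})" by (intro min) auto
      with card_Diff1_less[OF \<open>finite C\<close> Q] show False by simp
    qed
  qed (use C(2) \<open>finite C\<close> in auto)
  moreover have "ideal_of (Set.range (\<lambda>i. mvar i ^ (lookup b i + 1))) \<in> C"
  proof -
    have "single b 1 \<notin> \<Inter>C" using b by (simp add: C(2) single_mem_monideal socle_def)
    then obtain Q where Q: "Q \<in> C" "single b 1 \<notin> Q" by blast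
    then obtain \<beta> where \<beta>: "Q = K \<beta>" using C(1) by blast
    have nb: "lookup b i \<le> lookup \<beta> i" if "lookup \<beta> i < N" for i
      using Q(2) that by (auto simp: \<beta> K_def single_mem_monideal pure_powers_def not_le)
    \<comment> \<open>\<open>b + expo l\<close> enters \<open>Q\<close> although \<open>b\<close>
      does not, so \<open>Q\<close> has a generator in the variable \<open>l\<close>, with exponent
      one above that of \<open>b\<close>.\<close>
    have eq: "lookup \<beta> l < N \<and> lookup \<beta> l = lookup b l" for l
    proof -
      have "single (b + expo l) 1 \<in> \<Inter>C"
        using b by (simp add: C(2) single_mem_monideal socle_def)
      then have "b + expo l \<in> pure_powers {i. lookup \<beta> i < N} (\<lambda>i. lookup \<beta> i + 1)"
        using Q(1) by (auto simp: \<beta> K_def single_mem_monideal)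
      then obtain i where i: "lookup \<beta> i < N"
        "lookup \<beta> i + 1 \<le> lookup (b + expo l) i"
        by (auto simp: pure_powers_def)
      with nb[OF i(1)] have "i = l" by (auto simp: lookup_add lookup_single when_def split:
          if_splits)
      with i nb[OF i(1)] show ?thesis by (simp add: lookup_add)
    qed
    have "{i. lookup \<beta> i < N} = UNIV" using eq by blast
    moreover have "\<beta> = b" by (rule poly_mapping_eqI) (use eq in blast)
    ultimately have "Q = monideal (pure_powers UNIV (\<lambda>i. lookup b i + 1))"
      unfolding \<beta> K_def by (simp only:)
    with Q(1) show ?thesis by (simp only: ideal_of_pure_powers)
  qed
  ultimately show ?thesis by blast
qed

lemma full_components_socle:
  fixes L :: "('n::finite \<Rightarrow>\<^sub>0 nat) set"
  assumes "bounded_monomials N L" "upset L"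
  shows "full_components (monideal L :: ('n, 'k::field) mpoly set)
    = (\<lambda>b i. lookup b i + 1) ` socle L"
proof (intro subset_antisym subsetI)
  fix \<alpha> assume "\<alpha> \<in> full_components (monideal L :: ('n, 'k) mpoly set)"
  then obtain C where C: "\<And>i. 1 \<le> \<alpha> i"
    "irredundant_irreducible_decomposition (monideal L :: ('n, 'k) mpoly set) C"
    "ideal_of (Set.range (\<lambda>i. mvar i ^ \<alpha> i)) \<in> C"
    by (auto simp: full_components_def irreducible_components_def)
  from full_component_imp_socle[OF C(2,3,1)] have "expo_of (\<lambda>i. \<alpha> i - 1) \<in> socle L" .
  moreover have "\<alpha> = (\<lambda>i. lookup (expo_of (\<lambda>i. \<alpha> i - 1)) i + 1)"
  proof
    fix i
    show "\<alpha> i = lookup (expo_of (\<lambda>i. \<alpha> i - 1)) i + 1"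
      using C(1)[of i] by simp
  qed
  ultimately show "\<alpha> \<in> (\<lambda>b i. lookup b i + 1) ` socle L" by blast
next
  fix \<alpha> assume "\<alpha> \<in> (\<lambda>b i. lookup b i + 1) ` socle L"
  then obtain b where "b \<in> socle L" "\<alpha> = (\<lambda>i. lookup b i + 1)" by blast
  with socle_imp_full_component[OF assms, of b, where 'k = 'k]
  show "\<alpha> \<in> full_components (monideal L :: ('n, 'k) mpoly set)"
    unfolding full_components_def irreducible_components_def by auto
qed

section \<open>Symbolic powers\<close>

text \<open>The form of the leading term argument used below: only the term \<open>a0\<close> of
  \<open>u\<close> can contribute at this exponent.\<close>

lemma lookup_mult_unique:
  fixes u f :: "('n, 'k::field) mpoly"
  assumes "\<And>a b. a \<in> keys u \<Longrightarrow> b \<in> keys f \<Longrightarrow> a + b = a0 + b0 \<Longrightarrow> a = a0"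
  shows "lookup (u * f) (a0 + b0) = lookup u a0 * lookup f b0"
proof -
  define c where "c = lookup u a0"
  define u1 where "u1 = u - single a0 c"
  have u1: "a \<in> keys u \<and> a \<noteq> a0" if "a \<in> keys u1" for a
    using that by (auto simp: u1_def c_def in_keys_iff lookup_minus lookup_single when_def split:
        if_splits)
  have "a0 + b0 \<notin> keys (u1 * f)"
  proof
    assume "a0 + b0 \<in> keys (u1 * f)"
    then obtain a b where "a0 + b0 = a + b" "a \<in> keys u1" "b \<in> keys f"
      using keys_mult[of u1 f] by auto
    then show False using assms[of a b] u1[of a] by simp
  qed
  moreover have "u * f = single a0 c * f + u1 * f"
    by (simp add: u1_def algebra_simps)
  ultimately show ?thesis
    by (simp add: lookup_add lookup_monom_mult_add c_def in_keys_iff)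
qed

text \<open>Dropping the terms of \<open>f\<close> inside \<open>L\<close> changes the product with
  \<open>u\<close> only within the ideal. Then one surviving extremal term suffices for a
  contradiction.\<close>

lemma not_in_monideal_part:
  fixes f :: "('n::finite, 'k::field) mpoly"
  assumes L: "upset L" and uf: "u * f \<in> monideal L" and f: "f \<notin> monideal L"
  obtains g where "u * g \<in> monideal L" "keys g \<noteq> {}" "keys g \<inter> L = {}"
proof
  define h where "h = poly_of (keys f \<inter> L) (lookup f)"
  have h: "lookup h t = (if t \<in> L then lookup f t else 0)" for t
    unfolding h_def by (rule poly_of_restrict_lookup)
  have id: "is_ideal (monideal L :: ('n, 'k) mpoly set)" by (rule is_ideal_monideal[OF L])
  have "h \<in> monideal L" by (simp add: mem_monideal_iff h)
  then have "u * h \<in> monideal L" by (rule poly_ideal.subspace_scale[OF id])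
  with uf have "u * f - u * h \<in> monideal L" by (rule poly_ideal.subspace_diff[OF id])
  then show "u * (f - h) \<in> monideal L" by (simp add: algebra_simps)
  show "keys (f - h) \<inter> L = {}"
    by (auto simp: in_keys_iff lookup_minus h)
  from f obtain t where "t \<notin> L" "lookup f t \<noteq> 0" by (auto simp: mem_monideal_iff)
  then have "t \<in> keys (f - h)" by (simp add: in_keys_iff lookup_minus h)
  then show "keys (f - h) \<noteq> {}" by blast
qed

text \<open>A term of least degree in the part of \<open>f\<close> outside \<open>L\<close> meets
  only the constant of \<open>u\<close>, so it cannot cancel.\<close>

lemma monideal_local:
  fixes f :: "('n::finite, 'k::field) mpoly"
  assumes L: "upset L" and u: "lookup u 0 \<noteq> 0" and uf: "u * f \<in> monideal L"
  shows "f \<in> monideal L"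
proof (rule ccontr)
  assume "f \<notin> monideal L"
  from not_in_monideal_part[OF L uf this] obtain g where
    g: "u * g \<in> monideal L" "keys g \<noteq> {}" "keys g \<inter> L = {}" .
  from g(2) obtain t0 where "t0 \<in> keys g" by blast
  from ex_has_least_nat[of "\<lambda>t. t \<in> keys g", OF this, of mdegree]
  obtain t where t: "t \<in> keys g" "\<And>s. s \<in> keys g \<Longrightarrow> mdegree t \<le> mdegree s"
    by blast
  have "a = 0" if "b \<in> keys g" "a + b = 0 + t" for a b
  proof -
    have "mdegree a + mdegree b = mdegree t" using that(2) by (simp flip: mdegree_add)
    with t(2)[OF that(1)] have "mdegree a = 0" by linarith
    then show ?thesis by simp
  qed
  then have "lookup (u * g) (0 + t) = lookup u 0 * lookup g t"
    by (intro lookup_mult_unique)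
  with u t(1) have "t \<in> keys (u * g)" by (simp add: in_keys_iff)
  with g(1,3) t(1) show False by (auto simp: monideal_def)
qed

definition axis_prime :: "'n \<Rightarrow> ('n::finite, 'k::field) mpoly set" where
  "axis_prime i = monideal {t. \<exists>l. l \<noteq> i \<and> 0 < lookup t l}"

lemma mem_axis_prime:
  "f \<in> axis_prime i \<longleftrightarrow> (\<forall>n. lookup f (single i n) = 0)"
proof -
  have "(\<exists>l. l \<noteq> i \<and> 0 < lookup t l) \<longleftrightarrow> (\<forall>n. t \<noteq> single i n)" for t :: "'a \<Rightarrow>\<^sub>0 nat"
  proof
    assume "\<forall>n. t \<noteq> single i n"
    then have "t \<noteq> single i (lookup t i)" by blast
    then show "\<exists>l. l \<noteq> i \<and> 0 < lookup t l"
      by (auto simp: poly_mapping_eq_iff fun_eq_iff lookup_single when_def split: if_splits)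
  qed (auto simp: lookup_single when_def)
  then show ?thesis by (auto simp: axis_prime_def mem_monideal_iff)
qed

lemma upset_axis: "upset {t. \<exists>l. l \<noteq> i \<and> 0 < lookup t l}"
  by (auto simp: upset_def lookup_add)

text \<open>Exponents are compared first by \<open>off\<close>, the degree in the other variables,
  then by the exponent of x_i. The lowest pure power of x_i in \<open>u\<close> times the lowest
  term of \<open>g\<close> cannot cancel, and saturation removes that power. So \<open>u\<close> is
  a nonzerodivisor modulo the ideal.\<close>

lemma monideal_primary:
  fixes f :: "('n::finite, 'k::field) mpoly"
  assumes M: "upset M" and sat: "\<And>t n. t + single i n \<in> M \<Longrightarrow> t \<in> M"
    and u: "u \<notin> axis_prime i" and uf: "u * f \<in> monideal M"
  shows "f \<in> monideal M"
proof (rule ccontr)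
  assume "f \<notin> monideal M"
  from not_in_monideal_part[OF M uf this] obtain g where
    g: "u * g \<in> monideal M" "keys g \<noteq> {}" "keys g \<inter> M = {}" .
  define off where "off t = (\<Sum>l\<in>UNIV - {i}. lookup t l)" for t :: "'n \<Rightarrow>\<^sub>0 nat"
  have off_add: "off (s + t) = off s + off t" for s t
    by (simp add: off_def lookup_add sum.distrib)
  define m where "m = (LEAST n. lookup u (single i n) \<noteq> 0)"
  have "\<exists>n. lookup u (single i n) \<noteq> 0" using u by (auto simp: mem_axis_prime)
  then have m: "lookup u (single i m) \<noteq> 0" unfolding m_def by (rule LeastI_ex)
  have m_le: "m \<le> n" if "lookup u (single i n) \<noteq> 0" for n
    unfolding m_def using that by (rule Least_le)
  from g(2) obtain t0 where "t0 \<in> keys g" by blast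
  from wfE_min[OF wf_measures[of "[off, \<lambda>t. lookup t i]"] this]
  obtain t where t: "t \<in> keys g"
    and min: "\<And>s. (s, t) \<in> measures [off, \<lambda>t. lookup t i] \<Longrightarrow> s \<notin> keys g"
    by blast
  have "a = single i m"
    if ab: "a \<in> keys u" "b \<in> keys g" "a + b = single i m + t" for a b
  proof -
    have "off (single i m) = 0" by (simp add: off_def lookup_single)
    then have "off a + off b = off t" using ab(3) by (metis off_add add_0)
    moreover have "\<not> off b < off t" using min[of b] ab(2) by auto
    ultimately have off: "off b = off t" "off a = 0" by auto
    then have "a = single i (lookup a i)"
      by (auto simp: off_def poly_mapping_eq_iff fun_eq_iff lookup_single when_def)
    moreover have "lookup a i = m"
    proof -
      have "m \<le> lookup a i" using ab(1) calculation by (intro m_le) (simp add: in_keys_iff)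
      moreover have "lookup a i + lookup b i = m + lookup t i"
        using arg_cong[OF ab(3), of "\<lambda>s. lookup s i"] by (simp add: lookup_add)
      moreover have "\<not> lookup b i < lookup t i" using min[of b] ab(2) off(1) by auto
      ultimately show ?thesis by linarith
    qed
    ultimately show ?thesis by simp
  qed
  then have "lookup (u * g) (single i m + t)
      = lookup u (single i m) * lookup g t"
    by (intro lookup_mult_unique)
  with m t have "single i m + t \<in> keys (u * g)" by (simp add: in_keys_iff)
  then have "t + single i m \<in> M" using g(1) by (auto simp: monideal_def add.commute)
  then have "t \<in> M" by (rule sat)
  with g(3) t show False by blast
qed

text \<open>Primality is \<open>monideal_primary\<close> applied to the prime itself, which is
  saturated with respect to x_i.\<close>

lemma prime_axis_prime: "is_prime_ideal (axis_prime i :: ('n::finite, 'k::field) mpoly set)"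
  unfolding is_prime_ideal_def
proof (intro conjI allI impI)
  show "is_ideal (axis_prime i :: ('n, 'k) mpoly set)"
    unfolding axis_prime_def by (rule is_ideal_monideal[OF upset_axis])
  have "(1 :: ('n, 'k) mpoly) \<notin> axis_prime i"
    by (auto simp: mem_axis_prime intro!: exI[of _ 0])
  then show "(axis_prime i :: ('n, 'k) mpoly set) \<noteq> UNIV" by blast
  fix a b :: "('n, 'k) mpoly"
  assume ab: "a * b \<in> axis_prime i"
  show "a \<in> axis_prime i \<or> b \<in> axis_prime i"
  proof (cases "a \<in> axis_prime i")
    case False
    have sat: "t \<in> {t. \<exists>l. l \<noteq> i \<and> 0 < lookup t l}"
      if "t + single i n \<in> {t. \<exists>l. l \<noteq> i \<and> 0 < lookup t l}" for t :: "'n \<Rightarrow>\<^sub>0 nat" and n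
      using that by (auto simp: lookup_add lookup_single)
    have "b \<in> axis_prime i"
      using monideal_primary[OF upset_axis sat False] ab by (simp only: axis_prime_def)
    then show ?thesis ..
  qed simp
qed

definition const_free_ideal :: "('n::finite, 'k::field) mpoly set" where
  "const_free_ideal = {f. lookup f 0 = 0}"

lemma local_contraction_const_free:
  assumes L: "upset L"
  shows "local_contraction (monideal L :: ('n::finite, 'k::field) mpoly set) const_free_ideal
      = monideal L"
proof (intro subset_antisym subsetI)
  fix f :: "('n, 'k) mpoly"
  assume "f \<in> local_contraction (monideal L) const_free_ideal"
  then obtain a s t where a: "a \<in> monideal L" "lookup s 0 \<noteq> 0" "lookup t 0 \<noteq> 0"
    "t * (s * f - a) = 0"
    by (auto simp: local_contraction_def const_free_ideal_def)
  then have "(t * s) * f = t * a" by (simp add: algebra_simps)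
  also have "\<dots> \<in> monideal L"
    by (rule poly_ideal.subspace_scale[OF is_ideal_monideal[OF L] a(1)])
  finally show "f \<in> monideal L"
    by (rule monideal_local[OF L, rotated]) (simp add: lookup_mult_zero a)
next
  fix f :: "('n, 'k) mpoly"
  assume "f \<in> monideal L"
  then show "f \<in> local_contraction (monideal L) const_free_ideal"
    unfolding local_contraction_def const_free_ideal_def
    by (intro CollectI bexI[of _ f] exI[of _ 1] conjI) auto
qed

lemma mult_monomial_power:
  fixes f :: "('n::finite, 'k::field) mpoly"
  shows "mvar i ^ n * f \<in> monideal L
     \<longleftrightarrow> (\<forall>t\<in>keys f. t + single i n \<in> L)"
proof -
  have "lookup (mvar i ^ n * f) (single i n + t) = lookup f t" for t
    unfolding mvar_power by (simp add: lookup_monom_mult_add)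
  moreover have "keys (mvar i ^ n * f) \<subseteq> {single i n + t | t. t \<in> keys f}"
    using keys_mult[of "mvar i ^ n" f] by (auto simp: mvar_power)
  ultimately show ?thesis
    unfolding monideal_def by (fastforce simp: in_keys_iff add.commute)
qed

section \<open>Associated primes and symbolic powers of the edge ideal\<close>

context complete_graph
begin

lemma axis_prime_assoc:
  "(axis_prime i :: ('n, 'k::field) mpoly set) \<in> assoc_primes (edge_ideal E w)"
  unfolding assoc_primes_def
proof (intro CollectI conjI exI)
  show "is_prime_ideal (axis_prime i :: ('n, 'k) mpoly set)" by (rule prime_axis_prime)
  \<comment> \<open>The top monomial outside the local complete intersection, times x_i^(w i). One
    more x_l with l \<noteq> i completes the monomial of \<open>edge_monomial_single\<close>, while
    powers of x_i keep the local order at zero.\<close>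
  define u where "u = expo_of (\<lambda>l. if l = i then w i else lweight i l - 1)"
  have ord: "lorder i u = 0"
    unfolding lorder_def by (rule sum.neutral) (simp add: u_def)
  have iff: "u + t \<in> edge_monomials E w \<longleftrightarrow> (\<exists>l. l \<noteq> i \<and> 0 < lookup t l)" for t
  proof
    assume mem: "u + t \<in> edge_monomials E w"
    show "\<exists>l. l \<noteq> i \<and> 0 < lookup t l"
    proof (rule ccontr)
      assume "\<nexists>l. l \<noteq> i \<and> 0 < lookup t l"
      then have "t = single i (lookup t i)"
        by (auto simp: poly_mapping_eq_iff fun_eq_iff lookup_single when_def)
      then have "lorder i (u + t) = 0" using ord lorder_single by metis
      with lorder_edge[OF mem, of i] show False by simp
    qed
  next
    assume "\<exists>l. l \<noteq> i \<and> 0 < lookup t l"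
    then obtain l where l: "l \<noteq> i" "0 < lookup t l" by blast
    from edge_monomial_single[OF l(1)] show "u + t \<in> edge_monomials E w"
      by (rule upset_mono[OF upset_edge_monomials])
        (use l in \<open>auto simp: u_def lookup_add lookup_single when_def\<close>)
  qed
  have keys: "g * single u 1 \<in> monideal (edge_monomials E w)
      \<longleftrightarrow> (\<forall>t\<in>keys g. u + t \<in> edge_monomials E w)" for g :: "('n, 'k) mpoly"
  proof -
    have "lookup (single u 1 * g) (u + t) = lookup g t" for t
      by (simp add: lookup_monom_mult_add)
    moreover have "keys (single u 1 * g) \<subseteq> {u + t | t. t \<in> keys g}"
      using keys_mult[of "single u 1" g] by auto
    ultimately show ?thesis
      unfolding monideal_def mult.commute[of g] by (fastforce simp: in_keys_iff)
  qed
  show "axis_prime i = {g :: ('n, 'k) mpoly. g * single u 1 \<in> edge_ideal E w}"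
    unfolding edge_ideal_eq keys iff unfolding axis_prime_def monideal_def by blast
qed

text \<open>\<open>P\<close> contains an end of every edge, so at most one variable is missing. As
  \<open>f\<close> is outside the ideal, elements of \<open>P\<close> have constant coefficient
  zero; if x_i is missing, this excludes anything beyond \<open>axis_prime i\<close>.\<close>

lemma assoc_prime_cases:
  assumes P: "(P :: ('n, 'k::field) mpoly set) \<in> assoc_primes (edge_ideal E w)"
  shows "P = const_free_ideal \<or> (\<exists>i. P = axis_prime i)"
proof -
  let ?I = "monideal (edge_monomials E w) :: ('n, 'k) mpoly set"
  from P obtain f where prime: "is_prime_ideal P" and f: "P = {g. g * f \<in> ?I}"
    by (auto simp: assoc_primes_def edge_ideal_eq)
  have idP: "is_ideal P" and neq: "P \<noteq> UNIV" and pr: "\<And>a b. a * b \<in> P \<Longrightarrow> a \<in> P \<or> b \<in> P"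
    using prime by (auto simp: is_prime_ideal_def)
  have idI: "is_ideal ?I" by (rule is_ideal_monideal[OF upset_edge_monomials])
  have "f \<notin> ?I"
    using neq poly_ideal.subspace_scale[OF idI] by (auto simp: f)
  then have sub: "P \<subseteq> const_free_ideal"
    using monideal_local[OF upset_edge_monomials] by (auto simp: f const_free_ideal_def)
  have pw: "mvar i \<in> P" if "mvar i ^ n \<in> P" for i n
    using that
  proof (induction n)
    case 0
    then have "1 \<in> P" by simp
    with sub show ?case by (auto simp: const_free_ideal_def)
  next
    case (Suc n)
    then show ?case using pr[of "mvar i" "mvar i ^ n"] by auto
  qed
  have edge: "mvar i \<in> P \<or> mvar j \<in> P" if "i \<noteq> j" for i j
  proof -
    have gen: "mvar a \<in> P \<or> mvar b \<in> P" if "(a, b) \<in> E" for a b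
    proof -
      have "expo a + single b (w b) + 0 \<in> edge_monomials E w"
        unfolding edge_monomials_def using that by blast
      then have "mvar a * mvar b ^ w b \<in> ?I"
        unfolding mvar_power by (simp add: mvar_def mult_single single_mem_monideal)
      then have "f * (mvar a * mvar b ^ w b) \<in> ?I" by (rule poly_ideal.subspace_scale[OF idI])
      then have "mvar a * mvar b ^ w b \<in> P" by (simp add: f mult.commute)
      then show ?thesis using pr pw by blast
    qed
    with total_E[OF that] show ?thesis by blast
  qed
  have single_mem: "single t 1 \<in> P" if "mvar l \<in> P" "0 < lookup t l" for l t
  proof -
    have "single (t - expo l) 1 * mvar l \<in> P"
      by (rule poly_ideal.subspace_scale[OF idP that(1)])
    then show ?thesis
      using expo_diff_add[OF that(2)] by (simp add: mvar_def mult_single add.commute)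
  qed
  show ?thesis
  proof (cases "\<exists>i. mvar i \<notin> P")
    case False
    have "const_free_ideal \<subseteq> P"
    proof -
      have "monideal (- {0}) \<subseteq> P"
      proof (rule monideal_subset_ideal[OF idP])
        fix t :: "'n \<Rightarrow>\<^sub>0 nat" assume "t \<in> - {0}"
        then obtain l where "0 < lookup t l" by (auto simp: poly_mapping_eq_iff fun_eq_iff)
        with False single_mem show "single t 1 \<in> P" by blast
      qed
      then show ?thesis by (auto simp: const_free_ideal_def mem_monideal_iff subset_iff)
    qed
    with sub show ?thesis by blast
  next
    case True
    then obtain i where i: "mvar i \<notin> P" by blast
    have ax: "axis_prime i \<subseteq> P"
      unfolding axis_prime_def
      by (rule monideal_subset_ideal[OF idP]) (use edge i single_mem in blast)
    have "P \<subseteq> axis_prime i"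
    proof (rule ccontr)
      assume "\<not> P \<subseteq> axis_prime i"
      then obtain g where g: "g \<in> P" "g \<notin> axis_prime i" by blast
      \<comment> \<open>On the axis of x_i the polynomial \<open>g\<close> starts with x_i^m.
        Dividing the terms divisible by this power gives \<open>q\<close> with nonzero constant
        coefficient, and \<open>mvar i ^ m * q\<close> agrees with \<open>g\<close> modulo
        \<open>axis_prime i\<close>.\<close>
      define m where "m = (LEAST n. lookup g (single i n) \<noteq> 0)"
      have "\<exists>n. lookup g (single i n) \<noteq> 0" using g(2) by (auto simp: mem_axis_prime)
      then have m: "lookup g (single i m) \<noteq> 0" unfolding m_def by (rule LeastI_ex)
      have m_le: "m \<le> n" if "lookup g (single i n) \<noteq> 0" for n
        unfolding m_def using that by (rule Least_le)
      define T where "T = (\<lambda>t. t - single i m) ` keys g"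
      define q where "q = poly_of T (\<lambda>s. lookup g (s + single i m))"
      have q: "lookup q s = lookup g (single i m + s)" for s
      proof -
        have "s \<in> T" if "lookup g (s + single i m) \<noteq> 0"
          unfolding T_def using that by (intro image_eqI[of _ _ "s + single i m"]) (auto simp:
              in_keys_iff)
        moreover have "finite T" by (simp add: T_def)
        ultimately show ?thesis by (auto simp: q_def lookup_poly_of add.commute)
      qed
      have "lookup (mvar i ^ m * q) (single i n)
          = lookup g (single i n)" for n
      proof (cases "m \<le> n")
        case True
        then have n: "single i n = single i m + single i (n - m)"
          by (simp flip: single_add)
        show ?thesis
          unfolding n mvar_power lookup_monom_mult_add by (simp add: q)
      next
        case False
        have "single i n \<noteq> single i m + t" for t
        proof
          assume "single i n = single i m + t"
          from arg_cong[OF this, of "\<lambda>s. lookup s i"] False show "False"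
            by (simp add: lookup_add)
        qed
        then show ?thesis
          using m_le[of n] False unfolding mvar_power by (auto simp: lookup_monom_mult_eq_0)
      qed
      then have "g - mvar i ^ m * q \<in> axis_prime i"
        by (simp add: mem_axis_prime lookup_minus)
      with ax have "g - mvar i ^ m * q \<in> P" by blast
      with g(1) have "g - (g - mvar i ^ m * q) \<in> P" by (rule poly_ideal.subspace_diff[OF idP])
      then have "mvar i ^ m * q \<in> P" by simp
      then have "q \<in> P" using pr pw i by blast
      then have "lookup q 0 = 0" using sub by (auto simp: const_free_ideal_def)
      with m show False by (simp add: q)
    qed
    with ax show ?thesis by blast
  qed
qed

text \<open>The component contains the power, and elements outside the prime cancel modulo it.
  Conversely \<open>mvar i ^ (k * w i)\<close> is outside the prime and carries the component into
  the power.\<close>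

lemma local_contraction_axis_prime:
  "local_contraction (monideal (power_monomials E w k)) (axis_prime i)
    = (monideal (component k i) :: ('n, 'k::field) mpoly set)"
proof (intro subset_antisym subsetI)
  fix f :: "('n, 'k) mpoly"
  assume "f \<in> local_contraction (monideal (power_monomials E w k)) (axis_prime i)"
  then obtain a s t where a: "a \<in> monideal (power_monomials E w k)" "s \<notin> axis_prime i" "t \<notin>
      axis_prime i"
    "t * (s * f - a) = 0"
    by (auto simp: local_contraction_def)
  have "a \<in> monideal (component k i)" using a(1) power_subset_component by (auto simp: monideal_def)
  then have "t * a \<in> monideal (component k i)"
    by (rule poly_ideal.subspace_scale[OF is_ideal_monideal[OF upset_component]])
  moreover have "t * a = (t * s) * f" using a(4) by (simp add: algebra_simps)
  moreover have "t * s \<notin> axis_prime i"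
    using prime_axis_prime[of i] a(2,3) unfolding is_prime_ideal_def by blast
  ultimately show "f \<in> monideal (component k i)"
    using monideal_primary[OF upset_component, of i k i "t * s" f]
        by (simp add: component_saturated)
next
  fix f :: "('n, 'k) mpoly"
  assume f: "f \<in> monideal (component k i)"
  then have "mvar i ^ (k * w i) * f \<in> monideal (power_monomials E w k)"
    unfolding mult_monomial_power using component_power by (auto simp: monideal_def)
  moreover have "mvar i ^ n \<notin> (axis_prime i :: ('n, 'k) mpoly set)" for n
    by (auto simp: mem_axis_prime mvar_power intro!: exI[of _ n])
  moreover from this[of 0] have "1 \<notin> (axis_prime i :: ('n, 'k) mpoly set)" by simp
  ultimately show "f \<in> local_contraction (monideal (power_monomials E w k)) (axis_prime i)"
    unfolding local_contraction_def
    by (intro CollectI bexI[of _ "mvar i ^ (k * w i) * f"] exI[of _ "mvar i ^ (k * w i)"] conjI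
        exI[of _ 1]) auto
qed

text \<open>The two cases are whether the maximal ideal is associated. If it is, its contraction is
  the power itself, which is contained in every component.\<close>

lemma symbolic_power_eq:
  "symbolic_power (edge_ideal E w) k = (monideal (power_monomials E w k) :: ('n, 'k::field) mpoly
      set) \<or>
   symbolic_power (edge_ideal E w) k = (monideal (\<Inter>i. component k i) :: ('n, 'k) mpoly set)"
proof -
  let ?A = "assoc_primes (edge_ideal E w) :: ('n, 'k) mpoly set set"
  let ?L = "monideal (power_monomials E w k) :: ('n, 'k) mpoly set"
  have ax: "Set.range axis_prime \<subseteq> ?A" using axis_prime_assoc by blast
  have A: "?A \<subseteq> insert const_free_ideal (Set.range axis_prime)" using assoc_prime_cases by blast
  have comp: "(\<Inter>P\<in>Set.range axis_prime. local_contraction ?L P) = monideal (\<Inter>i. component k i)"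
    by (simp add: local_contraction_axis_prime) (auto simp: monideal_def)
  show ?thesis
  proof (cases "const_free_ideal \<in> ?A")
    case True
    with A ax have "?A = insert const_free_ideal (Set.range axis_prime)" by blast
    then have "symbolic_power (edge_ideal E w) k
        = local_contraction ?L const_free_ideal \<inter> (\<Inter>P\<in>Set.range axis_prime. local_contraction ?L P)"
      by (simp add: symbolic_power_def ideal_power_eq)
    also have "\<dots> = ?L \<inter> monideal (\<Inter>i. component k i)"
      by (simp only: comp local_contraction_const_free[OF upset_power_monomials])
    also have "\<dots> = ?L" using power_subset_component by (auto simp: monideal_def)
    finally show ?thesis ..
  next
    case False
    with A ax have "?A = Set.range axis_prime" by blast
    then have "symbolic_power (edge_ideal E w) k
        = (\<Inter>P\<in>Set.range axis_prime. local_contraction ?L P)"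
      by (simp add: symbolic_power_def ideal_power_eq)
    then show ?thesis unfolding comp by blast
  qed
qed

text \<open>Multiples of \<open>b\<close> outside the power have bounded exponents, because
  \<open>b\<close> times x_i^(k * w i) is already inside. One of largest degree is a socle
  monomial.\<close>

lemma mdegree_le_socle:
  assumes b: "b \<notin> power_monomials E w k" "\<And>i. b \<in> component k i"
  shows "\<exists>s\<in>socle (power_monomials E w k). mdegree b \<le> mdegree s"
proof -
  let ?L = "power_monomials E w k"
  define P where "P s \<longleftrightarrow> s \<notin> ?L \<and> (\<forall>i. lookup b i \<le> lookup s i)" for s
  define B where "B = (\<Sum>i\<in>UNIV. lookup b i + k * w i)"
  have "mdegree s \<le> B" if s: "P s" for s
  proof -
    have "lookup s i \<le> lookup b i + k * w i" for i
    proof (rule ccontr)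
      assume n: "\<not> lookup s i \<le> lookup b i + k * w i"
      have "s \<in> ?L"
        by (rule upset_mono[OF upset_power_monomials component_power[OF b(2)[of i]]])
          (use n s in \<open>auto simp: P_def lookup_add lookup_single when_def\<close>)
      with s show False by (simp add: P_def)
    qed
    then show ?thesis unfolding mdegree_def B_def by (intro sum_mono)
  qed
  moreover have "P b" using b(1) by (simp add: P_def)
  ultimately obtain s where s: "P s" "\<And>t. P t \<Longrightarrow> mdegree t \<le> mdegree s"
    using ex_has_greatest_nat[of P b mdegree "Suc B"] by (auto simp: less_Suc_eq_le)
  have "s + expo l \<in> ?L" for l
  proof (rule ccontr)
    assume "s + expo l \<notin> ?L"
    then have "P (s + expo l)" using s(1) by (simp add: P_def lookup_add trans_le_add1)
    from s(2)[OF this] show False by (simp add: mdegree_add)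
  qed
  then have "s \<in> socle ?L" using s(1) by (simp add: socle_def P_def)
  with s(2)[OF \<open>P b\<close>] show ?thesis by blast
qed

section \<open>Assembly of the regularity formulas\<close>

definition edge_max :: "nat \<Rightarrow> nat" where
  "edge_max k = Max {r_edge E w k i j | i j. (i, j) \<in> E}"

definition vertex_max :: "nat \<Rightarrow> nat" where
  "vertex_max k = Max {r_vertex E w k i | i. i \<in> UNIV}"

lemma finite_edge_values: "finite {r_edge E w k i j | i j. (i, j) \<in> E}"
proof -
  have "{r_edge E w k i j | i j. (i, j) \<in> E} = (\<lambda>(i, j). r_edge E w k i j) ` E" by auto
  then show ?thesis by simp
qed

lemma edge_max: "(i, j) \<in> E \<Longrightarrow> r_edge E w k i j \<le> edge_max k"
  unfolding edge_max_def using finite_edge_values by (intro Max_ge) auto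

lemma edge_max_attained: "\<exists>i j. (i, j) \<in> E \<and> r_edge E w k i j = edge_max k"
proof -
  obtain i j :: 'n where "i \<noteq> j" using ex_other by blast
  then have "{r_edge E w k i j | i j. (i, j) \<in> E} \<noteq> {}" using total_E by blast
  then have "edge_max k \<in> {r_edge E w k i j | i j. (i, j) \<in> E}"
    unfolding edge_max_def by (intro Max_in finite_edge_values)
  then obtain i j where "edge_max k = r_edge E w k i j" "(i, j) \<in> E" by blast
  then show ?thesis by (intro exI[of _ i] exI[of _ j]) simp
qed

lemma finite_vertex_values: "finite {r_vertex E w k i | i. i \<in> UNIV}"
proof -
  have "{r_vertex E w k i | i. i \<in> UNIV} = Set.range (r_vertex E w k)" by auto
  then show ?thesis by simp
qed

lemma vertex_max: "r_vertex E w k i \<le> vertex_max k"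
  unfolding vertex_max_def by (rule Max_ge[OF finite_vertex_values]) auto

lemma vertex_max_attained: "\<exists>i. r_vertex E w k i = vertex_max k"
proof -
  have "vertex_max k \<in> {r_vertex E w k i | i. i \<in> UNIV}"
    unfolding vertex_max_def by (rule Max_in[OF finite_vertex_values]) auto
  then obtain i where "vertex_max k = r_vertex E w k i" by blast
  then show ?thesis by (intro exI[of _ i]) simp
qed

text \<open>Outside two components the degree is at most \<open>edge_max k\<close>; the summand 1
  provides the strict inequality of \<open>deg_QQ\<close>.\<close>

lemma line_components_component:
  assumes "upset L" "L \<subseteq> (\<Inter>i. component k i)" "edge_max k + 1 \<le> R" "vertex_max k \<le> R"
    and "\<And>b. b \<notin> L \<Longrightarrow> (\<And>i. b \<in> component k i) \<Longrightarrow> mdegree b \<le> R"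
  shows "line_components L (component k) R"
proof (unfold_locales)
  fix i j b assume "i \<noteq> j" "b \<notin> component k i" "b \<notin> component k j"
  then have "mdegree b \<le> edge_max k"
    using total_E mdegree_components_le[of i j b k] mdegree_components_le[of j i b k] edge_max[of i
        j k] edge_max[of j i k]
    by (meson order_trans)
  then show "mdegree b < R" using assms(3) by simp
next
  fix i b assume "b \<notin> component k i" "lookup b i = 0"
  then show "mdegree b \<le> R"
    using mdegree_component_le vertex_max assms(4) order_trans by meson
next
  fix b assume "b \<notin> L" "R < mdegree b"
  with assms(5)[of b] show "\<exists>i. b \<notin> component k i" by force
qed (use assms card2 upset_component component_saturated[of _ _ "Suc 0"] in \<open>auto\<close>)

lemma low_component:
  assumes "1 \<le> k" "R = edge_max k + 1 \<or> R = vertex_max k"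
  shows "(\<exists>i b. b \<notin> component k i \<and> lookup b i = 0 \<and> mdegree b = R) \<or>
    (\<exists>i j b. i \<noteq> j \<and> b \<notin> component k i \<and> b \<notin> component k j \<and> mdegree b + 1 = R)"
  using assms(2)
proof
  assume R: "R = edge_max k + 1"
  obtain i j where ij: "(i, j) \<in> E" "r_edge E w k i j = edge_max k" using edge_max_attained by blast
  moreover have "i \<noteq> j" using ij(1) irrefl_E by auto
  ultimately show ?thesis
    using mdegree_components_attained[OF ij(1) assms(1)] R by (metis Suc_eq_plus1)
next
  assume R: "R = vertex_max k"
  obtain i where "r_vertex E w k i = vertex_max k" using vertex_max_attained by blast
  with mdegree_component_attained[OF assms(1), of i] R show ?thesis by metis
qed

text \<open>A monomial outside the intersection is outside some component, so the bound on the
  remaining monomials is void and no socle term enters.\<close>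

lemma reg_saturation:
  assumes "1 \<le> k"
  shows "reg (monideal (\<Inter>i. component k i) :: ('n, 'k::field) mpoly set)
    = int (max (edge_max k + 1) (vertex_max k)) + 1"
proof -
  interpret line_components "\<Inter>i. component k i" "component k" "max (edge_max k + 1) (vertex_max k)"
    by (rule line_components_component) (use upset_component in \<open>auto simp: upset_def\<close>)
  show ?thesis
    by (rule reg_eq) (use low_component[OF assms] in \<open>auto simp: max_def\<close>)
qed

lemma reg_power:
  assumes "1 \<le> k"
  defines "D \<equiv> insert (edge_max k + 1) (insert (vertex_max k) (mdegree ` socle (power_monomials E w
      k)))"
  shows "finite D" and "reg (monideal (power_monomials E w k) :: ('n, 'k::field) mpoly set)
      = int (Max D) + 1"
proof -
  obtain N where "bounded_monomials N (power_monomials E w k)"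
    using power_monomials_bounded[of E w k] unfolding bounded_monomials_def by blast
  then have "finite (socle (power_monomials E w k))"
      by (rule finite_socle[OF _ upset_power_monomials])
  then show fin: "finite D" by (simp add: D_def)
  have ge: "d \<le> Max D" if "d \<in> D" for d using fin that by (rule Max_ge)
  interpret line_components "power_monomials E w k" "component k" "Max D"
  proof (rule line_components_component[OF upset_power_monomials])
    fix b assume b: "b \<notin> power_monomials E w k" "\<And>i. b \<in> component k i"
    from mdegree_le_socle[OF this] obtain s
        where "s \<in> socle (power_monomials E w k)" "mdegree b \<le> mdegree s"
      by blast
    with ge[of "mdegree s"] show "mdegree b \<le> Max D" by (simp add: D_def)
  next
    show "power_monomials E w k \<subseteq> (\<Inter>i. component k i)" using power_subset_component by blast
    show "edge_max k + 1 \<le> Max D" "vertex_max k \<le> Max D" by (rule ge, simp add: D_def)+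
  qed
  have "Max D \<in> D" using fin by (rule Max_in) (simp add: D_def)
  then consider "Max D = edge_max k + 1 \<or> Max D = vertex_max k" | s where
    "s \<in> socle (power_monomials E w k)" "mdegree s = Max D"
    by (auto simp: D_def)
  then show "reg (monideal (power_monomials E w k) :: ('n, 'k) mpoly set) = int (Max D) + 1"
  proof cases
    case 1
    from low_component[OF assms(1) this] show ?thesis by (intro reg_eq) blast
  next
    case 2
    then show ?thesis by (intro reg_eq) (auto simp: socle_def)
  qed
qed

end

theorem theorem5p7:
  fixes E :: "('n::finite \<times> 'n) set" and w :: "'n \<Rightarrow> nat"
    and I :: "('n, 'k::field) mpoly set" and k :: nat
  assumes "CARD('n) \<ge> 2"
    and "weighted_oriented_complete_graph E w"
    and "I = edge_ideal E w"
    and "k \<ge> 1"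
  shows "reg (ideal_power I k) =
           int (Max ({Max {r_edge E w k i j | i j. (i, j) \<in> E} + 2,
                      Max {r_vertex E w k i | i. i \<in> UNIV} + 1} \<union>
                     (if full_components (ideal_power I k) = {} then {}
                      else {Max {(\<Sum>i\<in>UNIV. (\<alpha> i - 1)) | \<alpha>.
                                   \<alpha> \<in> full_components (ideal_power I k)} + 1})))
         \<and> reg (symbolic_power I k) \<le> reg (ideal_power I k)"
proof -
  interpret complete_graph E w by standard (fact assms(1,2))+
  let ?L = "power_monomials E w k"
  have pow: "ideal_power I k = monideal ?L"
    unfolding assms(3) by (rule ideal_power_eq)
  obtain N where N: "bounded_monomials N ?L"
    using power_monomials_bounded[of E w k] unfolding bounded_monomials_def by blast
  have full: "full_components (ideal_power I k) = (\<lambda>b i. lookup b i + 1) ` socle ?L"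
    unfolding pow by (rule full_components_socle[OF N upset_power_monomials])
  \<comment> \<open>The exponents of a full component exceed those of its socle monomial by 1, so
    each sum is the degree of a socle monomial.\<close>
  have degs: "{(\<Sum>i\<in>UNIV. (\<alpha> i - 1)) | \<alpha>. \<alpha> \<in> full_components (ideal_power I k)} = mdegree ` socle ?L"
    unfolding full Setcompr_eq_image image_image by (rule image_cong) (simp_all add: mdegree_def)
  define D where "D = insert (edge_max k + 1) (insert (vertex_max k) (mdegree ` socle ?L))"
  have fin: "finite D"
    unfolding D_def by (rule reg_power(1)[OF assms(4)])
  have reg: "reg (ideal_power I k) = int (Max D) + 1"
    unfolding D_def pow by (rule reg_power(2)[OF assms(4)])
  \<comment> \<open>\<open>D\<close> raised by 1, with the socle degrees replaced by their maximum,
    which is left out when there are none.\<close>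
  let ?S = "{edge_max k + 2, vertex_max k + 1} \<union>
    (if socle ?L = {} then {} else {Max (mdegree ` socle ?L) + 1})"
  have fs: "finite (mdegree ` socle ?L)"
    by (rule finite_subset[OF _ fin]) (auto simp: D_def)
  have le: "edge_max k + 1 \<le> Max D" "vertex_max k \<le> Max D"
    by (rule Max_ge[OF fin], simp add: D_def)+
  have "Max ?S = Max D + 1"
  proof (rule Max_eqI)
    fix y assume y: "y \<in> ?S"
    have "Max (mdegree ` socle ?L) \<le> Max D" if "socle ?L \<noteq> {}"
      using that fin fs by (intro Max_mono) (auto simp: D_def)
    then show "y \<le> Max D + 1" using y le by (auto split: if_splits)
  next
    have "Max D \<in> D" using fin by (rule Max_in) (simp add: D_def)
    moreover have "Max D = Max (mdegree ` socle ?L)" if "Max D \<in> mdegree ` socle ?L"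
      using that fs fin by (intro antisym Max_ge Max_mono) (auto simp: D_def)
    ultimately show "Max D + 1 \<in> ?S" by (auto simp: D_def)
  qed simp
  then have formula: "reg (ideal_power I k) = int (Max ?S)" using reg by simp
  have "reg (symbolic_power I k) \<le> reg (ideal_power I k)"
    using symbolic_power_eq[of k, where 'k = 'k]
  proof
    assume "symbolic_power (edge_ideal E w) k = (monideal ?L :: ('n, 'k) mpoly set)"
    then show ?thesis by (simp add: pow assms(3) flip: pow)
  next
    assume s: "symbolic_power (edge_ideal E w) k = (monideal (\<Inter>i. component k i) :: ('n, 'k) mpoly set)"
    show ?thesis
      unfolding assms(3) s reg_saturation[OF assms(4)] reg[unfolded assms(3)] using le by simp
  qed
  moreover have "full_components (ideal_power I k) = {} \<longleftrightarrow> socle ?L = {}"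
    unfolding full by simp
  ultimately show ?thesis
    using formula unfolding degs edge_max_def vertex_max_def by simp
qed

end
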